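(* Let $k$ be a field of characteristic $0$, $\lambda\in k$, $I$ a nonempty well-ordered set, $X=\{x_i\mid i\in I\}$ ordered by $x_i>x_j$ iff $i>j$. Let $RB(X)$ be the free nonunitary Rota-Baxter algebra of weight $\lambda$ on $X$, let $S\subset RB(X)$ consist of all $x_ix_j-x_jx_i$ ($i>j$, $i,j\in I$) and all $P(u)x_i-x_iP(u)$ ($u\in\Phi(X)$, $i\in I$), and let $RB(X|S)=RB(X)/Id(S)$, which is the free commutative (nonunitary) Rota-Baxter algebra of weight $\lambda$ generated by $X$. Then $$Irr(S)=Y_1\cup Y_2\cup Y_3$$ is a $k$-basis of $RB(X|S)$ (i.e. the images of its elements form a basis), where $$Y_1=\{y_1y_2\cdots y_n\in S(X)\mid n\ge 1,\ y_i\in X,\ y_1\le y_2\le\cdots\le y_n\},$$ $$Y_2=\{P^{l_1}(u_1P^{l_2}(\cdots(u_{t-1}P^{l_t}(u_t))\cdots))\in\Phi(X)\mid t\ge1,\ u_j\in Y_1,\ l_j\ge1,\ j=1,\dots,t\},$$ $$Y_3=\{uv\in\Phi(X)\mid u\in Y_1,\ v\in Y_2\}.$$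
   Context: Rota-Baxter algebras. A Rota-Baxter algebra of weight $\lambda\in k$ is an associative $k$-algebra $A$ (not assumed unital) with a $k$-linear $P:A\to A$ satisfying $P(x)P(y)=P(P(x)y)+P(xP(y))+\lambda P(xy)$. A Rota-Baxter ideal is a two-sided ideal $I$ with $P(I)\subseteq I$; $Id(S)$ is the Rota-Baxter ideal generated by $S$. $P^l$ is the $l$-fold iterate of $P$. Free Rota-Baxter algebra $RB(X)$. $S(X)$ is the free semigroup (no identity) on $X$. Put $\Phi_0=S(X)$, and let $\Phi_n$ be the set of all nonempty finite formal words that alternate between factors from $S(X)$ and factors of the form $P(z)$, $z\in\Phi_{n-1}$ (starting and ending with either type; so no two factors $P(z_1)P(z_2)$ are adjacent). $\Phi(X)=\bigcup_{n\ge0}\Phi_n$. An element of $X\cup P(\Phi(X))$ is called prime; every $u\in\Phi(X)$ is uniquely $u=u_1\cdots u_n$ with $u_i$ prime and no two consecutive $u_i$ both in $P(\Phi(X))$. $RB(X)$ is the $k$-vector space with basis $\Phi(X)$, with $P$ the linear extension of $u\mapsto P(u)$ and with bilinear product defined recursively: for primes $u,v$, $u\cdot v=P(P(u')\cdot v')+P(u'\cdot P(v'))+\lambda P(u'\cdot v')$ if $u=P(u')$, $v=P(v')$, and $u\cdot v=uv$ (concatenation) otherwise; for $u=u_1\cdots u_s$, $v=v_1\cdots v_l$ (prime factorizations), $u\cdot v=u_1\cdots u_{s-1}(u_s\cdot v_1)v_2\cdots v_l$. Ordering. For $T\subseteq X\cup\{P\}$, $\deg_T(u)$ is the number of occurrences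 in $u$ of symbols of $T$; $Deg(u)=(\deg_{\{P\}\cup X}(u),\deg_{\{P\}}(u))$, ordered lexicographically. For $u,v\in\Phi(X)$: if $Deg(u)>Deg(v)$ then $u>v$. If $Deg(u)=Deg(v)$: for $u,v\in X$ use the order of $X$; if $u=P(u')$, $v=P(v')$ then $u>v$ iff $u'>v'$; otherwise, with prime factorizations $u=u_1\cdots u_l$, $v=v_1\cdots v_s$ ($l>1$ or $s>1$), $u>v$ iff $(u_1,\dots,u_l)>(v_1,\dots,v_s)$ lexicographically. For $0\ne f\in RB(X)$, $\bar f\in\Phi(X)$ denotes its largest basis word (leading term). $Irr(S)$. $\star\notin X$ is a new symbol; $\Phi^\star(X)$ is the set of words in $\Phi(X\cup\{\star\})$ with exactly one occurrence of $\star$. For $u\in\Phi^\star(X)$ and $s\in RB(X)$, $u|_s\in RB(X)$ is the result of replacing $\star$ by $s$ and evaluating in $RB(X)$; it is a normal $s$-word if $\overline{u|_s}=u|_{\bar s}$. $Irr(S)=\{u\in\Phi(X)\mid u\ne v|_{\bar s}$ for all $s\in S$ and all $v\in\Phi^\star(X)$ such that $v|_s$ is a normal $s$-word$\}$. *)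

theory Defs
  imports "Jordan_Normal_Form.VS_Connect" "HOL-Algebra.QuotRing" "HOL-Library.Poly_Mapping"
begin

section \<open>Rota-Baxter algebras\<close>

text \<open>
  Algebras are not assumed to be unital. They are carried by the library's module records, whose
  field \<^const>\<open>one\<close> is never used. The ground field is a type \<open>'k\<close>, viewed
  as a ring record through \<^term>\<open>class_ring\<close>.
\<close>

record ('k, 'a) rb_struct = "('k, 'a) module" +
  rbop :: "'a \<Rightarrow> 'a"

locale rota_baxter_algebra = vectorspace "class_ring :: 'k ring" A
  for lam :: "'k::field" and A :: "('k, 'a, 'm) rb_struct_scheme" (structure) +
  assumes mult_closed: "\<lbrakk>x \<in> carrier A; y \<in> carrier A\<rbrakk> \<Longrightarrow> x \<otimes>\<^bsub>A\<^esub> y \<in> carrier A"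
    and mult_assoc: "\<lbrakk>x \<in> carrier A; y \<in> carrier A; z \<in> carrier A\<rbrakk> \<Longrightarrow>
      (x \<otimes>\<^bsub>A\<^esub> y) \<otimes>\<^bsub>A\<^esub> z = x \<otimes>\<^bsub>A\<^esub> (y \<otimes>\<^bsub>A\<^esub> z)"
    and mult_add_left: "\<lbrakk>x \<in> carrier A; y \<in> carrier A; z \<in> carrier A\<rbrakk> \<Longrightarrow>
      (x \<oplus>\<^bsub>A\<^esub> y) \<otimes>\<^bsub>A\<^esub> z = x \<otimes>\<^bsub>A\<^esub> z \<oplus>\<^bsub>A\<^esub> y \<otimes>\<^bsub>A\<^esub> z"
    and mult_add_right: "\<lbrakk>x \<in> carrier A; y \<in> carrier A; z \<in> carrier A\<rbrakk> \<Longrightarrow>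
      x \<otimes>\<^bsub>A\<^esub> (y \<oplus>\<^bsub>A\<^esub> z) = x \<otimes>\<^bsub>A\<^esub> y \<oplus>\<^bsub>A\<^esub> x \<otimes>\<^bsub>A\<^esub> z"
    and mult_smult_left: "\<lbrakk>x \<in> carrier A; y \<in> carrier A\<rbrakk> \<Longrightarrow>
      (c \<odot>\<^bsub>A\<^esub> x) \<otimes>\<^bsub>A\<^esub> y = c \<odot>\<^bsub>A\<^esub> (x \<otimes>\<^bsub>A\<^esub> y)"
    and mult_smult_right: "\<lbrakk>x \<in> carrier A; y \<in> carrier A\<rbrakk> \<Longrightarrow>
      x \<otimes>\<^bsub>A\<^esub> (c \<odot>\<^bsub>A\<^esub> y) = c \<odot>\<^bsub>A\<^esub> (x \<otimes>\<^bsub>A\<^esub> y)"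
    and rbop_linear: "rbop A \<in> LinearCombinations.module_hom class_ring A A"
    and rota_baxter: "\<lbrakk>x \<in> carrier A; y \<in> carrier A\<rbrakk> \<Longrightarrow>
      rbop A x \<otimes>\<^bsub>A\<^esub> rbop A y =
        rbop A (rbop A x \<otimes>\<^bsub>A\<^esub> y) \<oplus>\<^bsub>A\<^esub> rbop A (x \<otimes>\<^bsub>A\<^esub> rbop A y)
          \<oplus>\<^bsub>A\<^esub> lam \<odot>\<^bsub>A\<^esub> rbop A (x \<otimes>\<^bsub>A\<^esub> y)"

locale comm_rota_baxter_algebra = rota_baxter_algebra +
  assumes mult_comm: "\<lbrakk>x \<in> carrier A; y \<in> carrier A\<rbrakk> \<Longrightarrow> x \<otimes>\<^bsub>A\<^esub> y = y \<otimes>\<^bsub>A\<^esub> x"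

definition rb_hom ::
  "('k::field, 'a, 'm) rb_struct_scheme \<Rightarrow> ('k, 'b, 'n) rb_struct_scheme \<Rightarrow> ('a \<Rightarrow> 'b) set" where
  "rb_hom A B = {h \<in> LinearCombinations.module_hom class_ring A B.
     (\<forall>x\<in>carrier A. \<forall>y\<in>carrier A. h (x \<otimes>\<^bsub>A\<^esub> y) = h x \<otimes>\<^bsub>B\<^esub> h y) \<and>
     (\<forall>x\<in>carrier A. h (rbop A x) = rbop B (h x))}"

text \<open>
  The universal property is tested against all commutative Rota-Baxter algebras whose carrier is a
  set of elements of \<open>'b\<close>; a theorem stating it for a type variable \<open>'b\<close> asserts it for all
  target algebras.
\<close>

definition free_comm_rb_algebra ::
  "'b itself \<Rightarrow> 'k::field \<Rightarrow> ('k, 'a) rb_struct \<Rightarrow> ('x \<Rightarrow> 'a) \<Rightarrow> bool" where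
  "free_comm_rb_algebra _ lam A \<iota> \<longleftrightarrow>
     comm_rota_baxter_algebra lam A \<and> range \<iota> \<subseteq> carrier A \<and>
     (\<forall>(B :: ('k, 'b) rb_struct) f. comm_rota_baxter_algebra lam B \<and> range f \<subseteq> carrier B \<longrightarrow>
        (\<exists>!h. h \<in> rb_hom A B \<inter> extensional (carrier A) \<and> (\<forall>x. h (\<iota> x) = f x)))"

definition rb_ideal :: "('k::field, 'a, 'm) rb_struct_scheme \<Rightarrow> 'a set \<Rightarrow> bool" where
  "rb_ideal A I \<longleftrightarrow> LinearCombinations.submodule class_ring I A \<and>
     (\<forall>a\<in>carrier A. \<forall>x\<in>I. a \<otimes>\<^bsub>A\<^esub> x \<in> I \<and> x \<otimes>\<^bsub>A\<^esub> a \<in> I) \<and>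
     rbop A ` I \<subseteq> I"

definition rb_ideal_gen :: "('k::field, 'a, 'm) rb_struct_scheme \<Rightarrow> 'a set \<Rightarrow> 'a set" where
  "rb_ideal_gen A S = \<Inter>{I. rb_ideal A I \<and> S \<subseteq> I}"

text \<open>The additive and multiplicative structure of the quotient is that of \<^const>\<open>FactRing\<close>.\<close>

definition rb_quot :: "('k, 'a) rb_struct \<Rightarrow> 'a set \<Rightarrow> ('k, 'a set) rb_struct" where
  "rb_quot A I =
     \<lparr>carrier = a_rcosets\<^bsub>A\<^esub> I, mult = rcoset_mult A I, one = undefined,
      zero = I, add = set_add A,
      smult = (\<lambda>c C. \<Union>a\<in>C. I +>\<^bsub>A\<^esub> (c \<odot>\<^bsub>A\<^esub> a)),
      rbop = (\<lambda>C. \<Union>a\<in>C. I +>\<^bsub>A\<^esub> rbop A a)\<rparr>"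


section \<open>Rota-Baxter words\<close>

text \<open>
  A word is represented by the list of its prime factors; concatenation of words is \<^term>\<open>(@)\<close>.
  \<^term>\<open>Op w\<close> stands for \<open>P(w)\<close>. The raw type also contains the empty word and words with adjacent
  factors \<open>P(z\<^sub>1)P(z\<^sub>2)\<close>; these are excluded by \<open>\<Phi>\<close>.
\<close>

datatype 'x prime_word = Gen 'x | Op "'x prime_word list"

type_synonym 'x rb_word = "'x prime_word list"

fun is_Op :: "'x prime_word \<Rightarrow> bool" where
  "is_Op (Op w) = True"
| "is_Op (Gen x) = False"

primrec Phi_level :: "nat \<Rightarrow> 'x rb_word set" where
  "Phi_level 0 = {map Gen xs | xs. xs \<noteq> []}"
| "Phi_level (Suc n) = {w. w \<noteq> [] \<and> (\<forall>z. Op z \<in> set w \<longrightarrow> z \<in> Phi_level n) \<and>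
     successively (\<lambda>p q. \<not> (is_Op p \<and> is_Op q)) w}"

definition Phi :: "'x rb_word set" where
  "Phi = (\<Union>n. Phi_level n)"


subsection \<open>Degrees and the ordering\<close>

datatype 'x symb = SymX 'x | SymP

fun symbols :: "'x prime_word \<Rightarrow> 'x symb list" where
  "symbols (Gen x) = [SymX x]"
| "symbols (Op w) = SymP # concat (map symbols w)"

definition deg :: "'x symb set \<Rightarrow> 'x rb_word \<Rightarrow> nat" where
  "deg T w = length (filter (\<lambda>a. a \<in> T) (concat (map symbols w)))"

definition Deg :: "'x rb_word \<Rightarrow> nat \<times> nat" where
  "Deg w = (deg UNIV w, deg {SymP} w)"

text \<open>
  In rule \<open>lex\<close> the words agree up to their first differing prime factors \<open>p\<close>, \<open>q\<close>. A proper
  prefix of a word has smaller \<^const>\<open>Deg\<close>, so the lexicographic comparison of words of equal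
  \<^const>\<open>Deg\<close> is always decided in this way.
\<close>

inductive rb_less :: "'x::linorder rb_word \<Rightarrow> 'x rb_word \<Rightarrow> bool" where
  Deg: "(Deg u, Deg v) \<in> less_than <*lex*> less_than \<Longrightarrow> rb_less u v"
| Gen: "x < y \<Longrightarrow> rb_less [Gen x] [Gen y]"
| Op: "Deg [Op u] = Deg [Op v] \<Longrightarrow> rb_less u v \<Longrightarrow> rb_less [Op u] [Op v]"
| lex: "Deg (w @ p # u) = Deg (w @ q # v) \<Longrightarrow>
    length (w @ p # u) > 1 \<or> length (w @ q # v) > 1 \<Longrightarrow>
    rb_less [p] [q] \<Longrightarrow> rb_less (w @ p # u) (w @ q # v)"


section \<open>The free Rota-Baxter algebra\<close>

abbreviation mon :: "'x rb_word \<Rightarrow> 'x rb_word \<Rightarrow>\<^sub>0 'k::field" where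
  "mon w \<equiv> Poly_Mapping.single w 1"

definition pm_scale :: "'k::field \<Rightarrow> ('w \<Rightarrow>\<^sub>0 'k) \<Rightarrow> 'w \<Rightarrow>\<^sub>0 'k" where
  "pm_scale c f = Poly_Mapping.map ((*) c) f"

definition lin_ext :: "('v \<Rightarrow> 'w \<Rightarrow>\<^sub>0 'k) \<Rightarrow> ('v \<Rightarrow>\<^sub>0 'k::field) \<Rightarrow> 'w \<Rightarrow>\<^sub>0 'k" where
  "lin_ext F f = (\<Sum>w\<in>Poly_Mapping.keys f. pm_scale (Poly_Mapping.lookup f w) (F w))"

definition P_ext :: "('x rb_word \<Rightarrow>\<^sub>0 'k::field) \<Rightarrow> 'x rb_word \<Rightarrow>\<^sub>0 'k" where
  "P_ext = lin_ext (\<lambda>w. mon [Op w])"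

text \<open>The value on empty words is irrelevant.\<close>

function (sequential)
      prime_mult :: "'k::field \<Rightarrow> 'x prime_word \<Rightarrow> 'x prime_word \<Rightarrow> 'x rb_word \<Rightarrow>\<^sub>0 'k"
  and word_mult :: "'k \<Rightarrow> 'x rb_word \<Rightarrow> 'x rb_word \<Rightarrow> 'x rb_word \<Rightarrow>\<^sub>0 'k" where
  "prime_mult lam (Op u) (Op v) =
     P_ext (word_mult lam [Op u] v) + P_ext (word_mult lam u [Op v])
       + pm_scale lam (P_ext (word_mult lam u v))"
| "prime_mult lam p q = mon [p, q]"
| "word_mult lam u v =
     (if u = [] \<or> v = [] then 0
      else lin_ext (\<lambda>w. mon (butlast u @ w @ tl v)) (prime_mult lam (last u) (hd v)))"
  by pat_completeness auto
termination
proof -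
  have last_size: "size (last u) < size_list size u" if "u \<noteq> []" for u :: "'x prime_word list"
    using that by (induction u) auto
  have hd_size: "size (hd u) < size_list size u" if "u \<noteq> []" for u :: "'x prime_word list"
    using that by (cases u) auto
  have "Suc (size (last u) + size (hd v)) < size_list size u + size_list size v"
    if "u \<noteq> []" "v \<noteq> []" for u v :: "'x prime_word list"
    using last_size[OF that(1)] hd_size[OF that(2)] by linarith
  then show ?thesis
    by (relation "measure (\<lambda>x. case x of
          Inl (l, p, q) \<Rightarrow> size p + size q + 1
        | Inr (l, u, v) \<Rightarrow> size_list size u + size_list size v)") auto
qed

definition RB :: "'k::field \<Rightarrow> ('k, 'x rb_word \<Rightarrow>\<^sub>0 'k) rb_struct" where
  "RB lam =
     \<lparr>carrier = {f. Poly_Mapping.keys f \<subseteq> Phi},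
      mult = (\<lambda>f g. lin_ext (\<lambda>u. lin_ext (\<lambda>v. word_mult lam u v) g) f), one = undefined,
      zero = 0, add = (+), smult = pm_scale, rbop = P_ext\<rparr>"


subsection \<open>Leading terms, substitution and irreducible words\<close>

definition lead :: "('x::linorder rb_word \<Rightarrow>\<^sub>0 'k::zero) \<Rightarrow> 'x rb_word" where
  "lead f = (THE w. w \<in> Poly_Mapping.keys f \<and> (\<forall>v\<in>Poly_Mapping.keys f. v \<noteq> w \<longrightarrow> rb_less v w))"

primrec eval_prime :: "('k, 'a, 'm) rb_struct_scheme \<Rightarrow> ('x \<Rightarrow> 'a) \<Rightarrow> 'x prime_word \<Rightarrow> 'a"
  and eval_word :: "('k, 'a, 'm) rb_struct_scheme \<Rightarrow> ('x \<Rightarrow> 'a) \<Rightarrow> 'x prime_word list \<Rightarrow> 'a" where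
  "eval_prime A \<theta> (Gen x) = \<theta> x"
| "eval_prime A \<theta> (Op w) = rbop A (eval_word A \<theta> w)"
| "eval_word A \<theta> [] = undefined"
| "eval_word A \<theta> (p # w) =
     (if w = [] then eval_prime A \<theta> p else eval_prime A \<theta> p \<otimes>\<^bsub>A\<^esub> eval_word A \<theta> w)"

text \<open>The new symbol \<open>\<star>\<close> is \<^const>\<open>None\<close>, and \<open>x \<in> X\<close> becomes \<^term>\<open>Some x\<close>.\<close>

definition Phi_star :: "'x option rb_word set" where
  "Phi_star = {v \<in> Phi. deg {SymX None} v = 1}"

definition plug :: "'k::field \<Rightarrow> 'x option rb_word \<Rightarrow> ('x rb_word \<Rightarrow>\<^sub>0 'k) \<Rightarrow> 'x rb_word \<Rightarrow>\<^sub>0 'k" where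
  "plug lam v s = eval_word (RB lam) (\<lambda>y. case y of None \<Rightarrow> s | Some x \<Rightarrow> mon [Gen x]) v"

definition normal_s_word ::
  "'k::field \<Rightarrow> 'x::linorder option rb_word \<Rightarrow> ('x rb_word \<Rightarrow>\<^sub>0 'k) \<Rightarrow> bool" where
  "normal_s_word lam v s \<longleftrightarrow>
     plug lam v s \<noteq> 0 \<and> mon (lead (plug lam v s)) = plug lam v (mon (lead s))"

definition Irr :: "'k::field \<Rightarrow> ('x::linorder rb_word \<Rightarrow>\<^sub>0 'k) set \<Rightarrow> 'x rb_word set" where
  "Irr lam S = {u \<in> Phi. \<forall>s\<in>S. \<forall>v\<in>Phi_star.
     normal_s_word lam v s \<longrightarrow> mon u \<noteq> plug lam v (mon (lead s))}"


section \<open>The commutativity relations and the sets of words\<close>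

definition comm_rels :: "('x::linorder rb_word \<Rightarrow>\<^sub>0 'k::field) set" where
  "comm_rels =
     {mon [Gen i, Gen j] - mon [Gen j, Gen i] | i j. i > j} \<union>
     {mon [Op u, Gen i] - mon [Gen i, Op u] | u i. u \<in> Phi}"

definition comm_ideal :: "'k::field \<Rightarrow> ('x::linorder rb_word \<Rightarrow>\<^sub>0 'k) set" where
  "comm_ideal lam = rb_ideal_gen (RB lam) comm_rels"

definition comm_RB :: "'k::field \<Rightarrow> ('k, ('x::linorder rb_word \<Rightarrow>\<^sub>0 'k) set) rb_struct" where
  "comm_RB lam = rb_quot (RB lam) (comm_ideal lam)"

definition word_class :: "'k::field \<Rightarrow> 'x::linorder rb_word \<Rightarrow> ('x rb_word \<Rightarrow>\<^sub>0 'k) set" where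
  "word_class lam w = comm_ideal lam +>\<^bsub>RB lam\<^esub> mon w"

definition Y1 :: "'x::linorder rb_word set" where
  "Y1 = {map Gen ys | ys. ys \<noteq> [] \<and> sorted ys}"

text \<open>
  The list \<open>[(u\<^sub>1, l\<^sub>1), \<dots>, (u\<^sub>t, l\<^sub>t)]\<close> encodes the nested word
  \<open>P\<^sup>l\<^sup>1(u\<^sub>1P\<^sup>l\<^sup>2(\<dots>P\<^sup>l\<^sup>t(u\<^sub>t)\<dots>))\<close>.
\<close>

fun nested :: "('x rb_word \<times> nat) list \<Rightarrow> 'x rb_word" where
  "nested [] = []"
| "nested ((u, l) # r) = ((\<lambda>w. [Op w]) ^^ l) (u @ nested r)"

definition Y2 :: "'x::linorder rb_word set" where
  "Y2 = {nested r | r. r \<noteq> [] \<and> (\<forall>(u, l)\<in>set r. u \<in> Y1 \<and> l \<ge> 1)} \<inter> Phi"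

definition Y3 :: "'x::linorder rb_word set" where
  "Y3 = {u @ v | u v. u \<in> Y1 \<and> v \<in> Y2} \<inter> Phi"

end

theory Submission
  imports Defs
begin

text \<open>
  Call a word normal if it is a sorted product of generators, possibly followed by one factor
  \<open>P(w)\<close> with \<open>w\<close> normal. A word of \<open>\<Phi>\<close> that is not normal contains \<open>x\<^sub>ix\<^sub>j\<close> with \<open>i > j\<close> or
  \<open>P(u)x\<^sub>i\<close>, and replacing this factor by \<open>\<star>\<close> gives a normal \<open>s\<close>-word; conversely, substituting the
  leading term of a relation never produces a normal word, because a collision
  \<open>P(z)P(u)x\<^sub>i\<close> still leaves a factor \<open>P(\<dots>)x\<^sub>i\<close>. Hence the irreducible words are the normal ones.

  Modulo the ideal every word can be sorted, so normal words span the quotient. For linear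
  independence, \<open>RB(X)\<close> is evaluated in a commutative Rota-Baxter algebra built from the polynomial
  ring and the quasi-shuffle product, in which distinct normal words become distinct basis vectors.
  The quotient therefore embeds into this model, which also gives its associativity and
  commutativity without a proof of associativity for \<open>RB(X)\<close>.
\<close>

subsection \<open>Linear extension\<close>

text \<open>The obstacle is that the product is concatenation only as long as no \<open>P(y)\<close>
  meets a \<open>P(z)\<close>; at such a collision it becomes a sum of other words, and collisions
  may recur inside these. Contexts around an element f are therefore bracketed as b(fc), nested to
  the right like \<open>eval_word\<close>, and it is shown case by case where such a context acts by
  mere concatenation. The model is the mixable shuffle construction A \<otimes> QSh(A) over the
  polynomial algebra A. The delta function at a multiset m and a list m1, ..., mn of multisets
  stands for x^m P(x^m1 P( ... P(x^mn) ... )), so \<open>P\<close> only pushes the outer monomial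
  onto the list. As A has a unit, the empty multiset is a legitimate letter; this is what encodes
  iterated \<open>P\<close>, for instance P(P(x)) by the outer monomial 1 and the list 1, x. A
  normal word is thereby read off from its code: each sorted block of generators is determined by
  its multiset. The last multiset in the code of a normal word is nonempty, so the model is larger
  than the quotient, and only an embedding is claimed.\<close>

lemma lookup_pm_scale [simp]:
  "Poly_Mapping.lookup (pm_scale c f) w = c * Poly_Mapping.lookup f w"
  by (simp add: pm_scale_def Poly_Mapping.map.rep_eq when_def)

lemma pm_scale_simps [simp]:
  "pm_scale c 0 = 0" "pm_scale 0 f = 0" "pm_scale 1 f = f"
  "pm_scale c (pm_scale d f) = pm_scale (c * d) f"
  by (auto intro!: poly_mapping_eqI)

lemma pm_scale_add: "pm_scale c (f + g) = pm_scale c f + pm_scale c g"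
  by (rule poly_mapping_eqI) (simp add: lookup_add algebra_simps)

lemma pm_scale_add_left: "pm_scale (c + d) f = pm_scale c f + pm_scale d f"
  by (rule poly_mapping_eqI) (simp add: lookup_add algebra_simps)

lemma pm_scale_diff: "pm_scale c (f - g) = pm_scale c f - pm_scale c g"
  by (rule poly_mapping_eqI) (simp add: lookup_minus right_diff_distrib)

lemma pm_scale_minus_one: "pm_scale (- 1) f = - f"
  by (auto intro!: poly_mapping_eqI)

lemma pm_scale_sum: "pm_scale c (\<Sum>i\<in>A. f i) = (\<Sum>i\<in>A. pm_scale c (f i))"
  by (induction A rule: infinite_finite_induct) (auto simp: pm_scale_add)

lemma pm_scale_single [simp]: "pm_scale c (Poly_Mapping.single w d) = Poly_Mapping.single w (c * d)"
  by (auto intro!: poly_mapping_eqI simp: lookup_single when_def)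

lemma keys_pm_scale: "Poly_Mapping.keys (pm_scale c f) \<subseteq> Poly_Mapping.keys f"
  by (auto simp: in_keys_iff)

text \<open>A common finite index set lets sums for different arguments be compared term by term;
  additivity takes the union of two supports.\<close>

lemma lin_ext_superset:
  assumes "finite A" "Poly_Mapping.keys f \<subseteq> A"
  shows "lin_ext F f = (\<Sum>w\<in>A. pm_scale (Poly_Mapping.lookup f w) (F w))"
  unfolding lin_ext_def
  by (rule sum.mono_neutral_left) (use assms in \<open>auto simp: in_keys_iff\<close>)

lemma lin_ext_0 [simp]: "lin_ext F 0 = 0"
  by (simp add: lin_ext_def)

lemma lin_ext_single [simp]: "lin_ext F (Poly_Mapping.single w c) = pm_scale c (F w)"
  by (cases "c = 0") (simp_all add: lin_ext_def)

lemma lin_ext_add: "lin_ext F (f + g) = lin_ext F f + lin_ext F g"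
proof -
  let ?A = "Poly_Mapping.keys f \<union> Poly_Mapping.keys g"
  have "Poly_Mapping.keys (f + g) \<subseteq> ?A"
    by (rule keys_add)
  then show ?thesis
    by (simp add: lin_ext_superset[of ?A] lookup_add pm_scale_add_left sum.distrib)
qed

lemma lin_ext_scale: "lin_ext F (pm_scale c f) = pm_scale c (lin_ext F f)"
  using lin_ext_superset[OF finite_keys keys_pm_scale, of F c f]
  by (simp add: lin_ext_def pm_scale_sum)

lemma lin_ext_uminus: "lin_ext F (- f) = - lin_ext F f"
  by (metis lin_ext_scale pm_scale_minus_one)

lemma lin_ext_diff: "lin_ext F (f - g) = lin_ext F f - lin_ext F g"
  by (metis add_uminus_conv_diff lin_ext_add lin_ext_uminus)

lemma lin_ext_sum: "lin_ext F (\<Sum>i\<in>A. f i) = (\<Sum>i\<in>A. lin_ext F (f i))"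
  by (induction A rule: infinite_finite_induct) (auto simp: lin_ext_add)

lemma lin_ext_cong:
  "(\<And>w. w \<in> Poly_Mapping.keys f \<Longrightarrow> F w = G w) \<Longrightarrow> lin_ext F f = lin_ext G f"
  by (simp add: lin_ext_def)

lemma lin_ext_lin_ext: "lin_ext F (lin_ext G f) = lin_ext (\<lambda>w. lin_ext F (G w)) f"
proof -
  have "lin_ext F (lin_ext G f) =
      (\<Sum>w\<in>Poly_Mapping.keys f. lin_ext F (pm_scale (Poly_Mapping.lookup f w) (G w)))"
    by (simp only: lin_ext_def[of G] lin_ext_sum)
  then show ?thesis
    by (simp add: lin_ext_scale lin_ext_def[of "\<lambda>w. lin_ext F (G w)"])
qed

lemma lin_ext_fun_add: "lin_ext (\<lambda>w. F w + G w) f = lin_ext F f + lin_ext G f"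
  by (simp add: lin_ext_def pm_scale_add sum.distrib)

lemma lin_ext_fun_diff: "lin_ext (\<lambda>w. F w - G w) f = lin_ext F f - lin_ext G f"
  by (simp add: lin_ext_def pm_scale_diff sum_subtractf)

lemma lin_ext_fun_scale: "lin_ext (\<lambda>w. pm_scale c (F w)) f = pm_scale c (lin_ext F f)"
  by (simp add: lin_ext_def pm_scale_sum mult.commute)

lemma lin_ext_mon [simp]: "lin_ext (\<lambda>w. mon w) f = f"
proof (rule poly_mapping_eqI)
  fix v
  show "Poly_Mapping.lookup (lin_ext (\<lambda>w. mon w) f) v = Poly_Mapping.lookup f v"
    by (simp add: lin_ext_def lookup_sum lookup_single when_def in_keys_iff)
qed

lemma keys_lin_ext:
  "Poly_Mapping.keys (lin_ext F f) \<subseteq> (\<Union>w\<in>Poly_Mapping.keys f. Poly_Mapping.keys (F w))"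
  unfolding lin_ext_def by (rule order.trans[OF keys_sum]) (use keys_pm_scale in fast)

lemma keys_add_subset:
  "Poly_Mapping.keys f \<subseteq> A \<Longrightarrow> Poly_Mapping.keys g \<subseteq> A \<Longrightarrow> Poly_Mapping.keys (f + g) \<subseteq> A"
  using keys_add[of f g] by blast

lemma keys_diff_subset:
  "Poly_Mapping.keys f \<subseteq> A \<Longrightarrow> Poly_Mapping.keys g \<subseteq> A \<Longrightarrow>
    Poly_Mapping.keys (f - g :: 'a \<Rightarrow>\<^sub>0 'b::ab_group_add) \<subseteq> A"
  using keys_diff[of f g] by blast

lemma keys_pm_scale_subset:
  "Poly_Mapping.keys f \<subseteq> A \<Longrightarrow> Poly_Mapping.keys (pm_scale c f) \<subseteq> A"
  using keys_pm_scale[of c f] by blast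

lemma keys_lin_ext_subset:
  "(\<And>w. w \<in> Poly_Mapping.keys f \<Longrightarrow> Poly_Mapping.keys (F w) \<subseteq> A) \<Longrightarrow>
    Poly_Mapping.keys (lin_ext F f) \<subseteq> A"
  using keys_lin_ext[of F f] by fast

lemma keys_lin_ext_mon_subset:
  "Poly_Mapping.keys (lin_ext (\<lambda>w. mon (g w) :: 'x rb_word \<Rightarrow>\<^sub>0 'k::field) f) \<subseteq> g ` Poly_Mapping.keys f"
  by (rule keys_lin_ext_subset) simp


subsection \<open>Words\<close>

text \<open>The implication is the form into which the simplifier turns the adjacency condition of
  \<open>Phi_level\<close>.\<close>

abbreviation no_adjacent_Op :: "'x rb_word \<Rightarrow> bool" where
  "no_adjacent_Op \<equiv> successively (\<lambda>p q. is_Op p \<longrightarrow> \<not> is_Op q)"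

lemma is_Op_iff: "is_Op p \<longleftrightarrow> (\<exists>w. p = Op w)"
  by (cases p) auto

lemma no_adjacent_Op_map_Gen [simp]: "no_adjacent_Op (map Gen xs)"
  by (induction xs rule: induct_list012) auto

lemma Phi_level_mono: "Phi_level n \<subseteq> Phi_level (Suc n)"
proof (induction n)
  case 0
  show ?case by auto
next
  case (Suc n)
  then show ?case by auto
qed

lemma Phi_level_mono': "m \<le> n \<Longrightarrow> Phi_level m \<subseteq> Phi_level n"
  by (rule lift_Suc_mono_le[of Phi_level]) (use Phi_level_mono in auto)

text \<open>Levels increase and a word has finitely many factors, so one level contains the
  arguments of all its \<open>Op\<close> factors. This recursive description replaces the levels
  from here on.\<close>

lemma Phi_iff:
  "w \<in> Phi \<longleftrightarrow> w \<noteq> [] \<and> (\<forall>z. Op z \<in> set w \<longrightarrow> z \<in> Phi) \<and> no_adjacent_Op w"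
proof
  assume "w \<in> Phi"
  then obtain n where "w \<in> Phi_level (Suc n)"
    unfolding Phi_def using Phi_level_mono by blast
  then show "w \<noteq> [] \<and> (\<forall>z. Op z \<in> set w \<longrightarrow> z \<in> Phi) \<and> no_adjacent_Op w"
    unfolding Phi_def by auto
next
  assume *: "w \<noteq> [] \<and> (\<forall>z. Op z \<in> set w \<longrightarrow> z \<in> Phi) \<and> no_adjacent_Op w"
  \<comment> \<open>A common level is built up over subsets of the factors, taking a maximum at each
    new factor.\<close>
  have "\<exists>n. \<forall>z. Op z \<in> A \<longrightarrow> z \<in> Phi_level n" if "A \<subseteq> set w" for A
    using finite_subset[OF that finite_set] that
  proof (induction A rule: finite_induct)
    case (insert p A)
    then obtain n where n: "\<forall>z. Op z \<in> A \<longrightarrow> z \<in> Phi_level n"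
      by blast
    have "\<exists>m. \<forall>z. p = Op z \<longrightarrow> z \<in> Phi_level m"
      using * insert.prems unfolding Phi_def by (cases p) auto
    then obtain m where m: "\<forall>z. p = Op z \<longrightarrow> z \<in> Phi_level m" ..
    show ?case
      by (rule exI[of _ "max m n"])
        (use n m Phi_level_mono'[of m "max m n"] Phi_level_mono'[of n "max m n"] in auto)
  qed auto
  then obtain n where "\<forall>z. Op z \<in> set w \<longrightarrow> z \<in> Phi_level n"
    by blast
  with * have "w \<in> Phi_level (Suc n)"
    by simp
  then show "w \<in> Phi"
    unfolding Phi_def by blast
qed

lemma Nil_notin_Phi [simp]: "[] \<notin> Phi"
  by (subst Phi_iff) simp

lemma Gen_in_Phi [simp]: "[Gen x] \<in> Phi"
  by (subst Phi_iff) simp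

lemma Op_in_Phi_iff [simp]: "[Op w] \<in> Phi \<longleftrightarrow> w \<in> Phi"
  by (subst Phi_iff) simp

lemma Phi_append_iff:
  assumes "u \<noteq> []" "v \<noteq> []"
  shows "u @ v \<in> Phi \<longleftrightarrow> u \<in> Phi \<and> v \<in> Phi \<and> \<not> (is_Op (last u) \<and> is_Op (hd v))"
  using assms unfolding Phi_iff[of u] Phi_iff[of v] Phi_iff[of "u @ v"]
  by (auto simp: successively_append_iff)

lemma Phi_Cons_iff:
  "p # w \<in> Phi \<longleftrightarrow> [p] \<in> Phi \<and> (w = [] \<or> w \<in> Phi \<and> \<not> (is_Op p \<and> is_Op (hd w)))"
  using Phi_append_iff[of "[p]" w] by (cases "w = []") auto

lemma map_Gen_in_Phi [simp]: "map Gen xs \<in> Phi \<longleftrightarrow> xs \<noteq> []"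
  by (subst Phi_iff) auto

text \<open>Adjacency sees only \<open>is_Op\<close>, so exchanging a factor can spoil a word only
  by putting an \<open>Op\<close> where there was none.\<close>

lemma Phi_context:
  "b @ p # c \<in> Phi \<Longrightarrow> [q] \<in> Phi \<Longrightarrow> (is_Op q \<Longrightarrow> is_Op p) \<Longrightarrow> b @ q # c \<in> Phi"
proof -
  assume *: "b @ p # c \<in> Phi" "[q] \<in> Phi" "is_Op q \<Longrightarrow> is_Op p"
  have "q # c \<in> Phi" if "p # c \<in> Phi"
    using that * unfolding Phi_Cons_iff[of p c] Phi_Cons_iff[of q c] by blast
  then show ?thesis
    using * by (cases "b = []") (auto simp: Phi_append_iff)
qed


subsection \<open>Products of words\<close>

declare word_mult.simps [simp del] prime_mult.simps [simp del]

text \<open>The expression under \<open>P\<close> on the right of the Rota-Baxter identity, so that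
  P(u)P(v) = P(\<open>op_mult\<close> u v).\<close>

definition op_mult :: "'k::field \<Rightarrow> 'x rb_word \<Rightarrow> 'x rb_word \<Rightarrow> 'x rb_word \<Rightarrow>\<^sub>0 'k" where
  "op_mult lam u v =
    word_mult lam [Op u] v + word_mult lam u [Op v] + pm_scale lam (word_mult lam u v)"

lemma P_ext_linear:
  "P_ext (f + g) = P_ext f + P_ext g" "P_ext (f - g) = P_ext f - P_ext g"
  "P_ext (pm_scale c f) = pm_scale c (P_ext f)" "P_ext 0 = 0"
  by (simp_all add: P_ext_def lin_ext_add lin_ext_diff lin_ext_scale)

lemma P_ext_mon [simp]: "P_ext (mon w) = mon [Op w]"
  by (simp add: P_ext_def)

lemma keys_P_ext: "Poly_Mapping.keys (P_ext f) \<subseteq> (\<lambda>w. [Op w]) ` Poly_Mapping.keys f"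
  unfolding P_ext_def by (rule keys_lin_ext_mon_subset)

lemma prime_mult_Op: "prime_mult lam (Op u) (Op v) = P_ext (op_mult lam u v)"
  by (simp add: prime_mult.simps op_mult_def P_ext_linear)

lemma prime_mult_concat: "\<not> (is_Op p \<and> is_Op q) \<Longrightarrow> prime_mult lam p q = mon [p, q]"
  by (cases p; cases q) (auto simp: prime_mult.simps)

lemma word_mult_Nil [simp]: "word_mult lam [] v = 0" "word_mult lam u [] = 0"
  by (simp_all add: word_mult.simps)

lemma word_mult_concat:
  assumes "u \<noteq> []" "v \<noteq> []" "\<not> (is_Op (last u) \<and> is_Op (hd v))"
  shows "word_mult lam u v = mon (u @ v)"
proof -
  have eq: "butlast u @ last u # v = u @ v"
    using assms(1) by (metis append_butlast_last_id append.assoc append_Cons append_Nil)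
  show ?thesis
    using assms(1,2) by (simp add: word_mult.simps prime_mult_concat[OF assms(3)] eq)
qed

lemma word_mult_Op:
  "word_mult lam (b @ [Op u]) (Op v # c) = lin_ext (\<lambda>w. mon (b @ Op w # c)) (op_mult lam u v)"
  by (simp add: word_mult.simps prime_mult_Op P_ext_def lin_ext_lin_ext)

lemma last_is_OpE:
  assumes "u \<noteq> []" "is_Op (last u)"
  obtains b z where "u = b @ [Op z]"
  using assms by (cases u rule: rev_cases) (auto simp: is_Op_iff)

lemma hd_is_OpE:
  assumes "u \<noteq> []" "is_Op (hd u)"
  obtains z c where "u = Op z # c"
  using assms by (cases u) (auto simp: is_Op_iff)

text \<open>Eliminates the mutual recursion through \<open>prime_mult\<close>: either nothing
  collides, or the induction hypotheses are exactly those for the three products in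
  \<open>op_mult\<close>.\<close>

lemma word_mult_induct [case_names Nil_left Nil_right concat collide]:
  assumes "\<And>v. Q [] v" "\<And>u. Q u []"
    and "\<And>u v. u \<noteq> [] \<Longrightarrow> v \<noteq> [] \<Longrightarrow> \<not> (is_Op (last u) \<and> is_Op (hd v)) \<Longrightarrow> Q u v"
    and "\<And>b u v c. Q [Op u] v \<Longrightarrow> Q u [Op v] \<Longrightarrow> Q u v \<Longrightarrow> Q (b @ [Op u]) (Op v # c)"
  shows "Q u v"
proof (induction "size_list size u + size_list size v" arbitrary: u v rule: less_induct)
  case less
  show ?case
  proof (cases "u = [] \<or> v = [] \<or> \<not> (is_Op (last u) \<and> is_Op (hd v))")
    case True
    then show ?thesis using assms(1)[of v] assms(2)[of u] assms(3)[of u v] by metis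
  next
    case False
    then obtain b u' v' c where uv: "u = b @ [Op u']" "v = Op v' # c"
      by (meson last_is_OpE hd_is_OpE)
    show ?thesis
      unfolding uv by (rule assms(4); rule less.hyps) (simp_all add: uv)
  qed
qed

text \<open>A collision replaces two \<open>Op\<close> factors by a single one, whose neighbours in
  \<open>b\<close> and \<open>c\<close> were already next to an \<open>Op\<close> and hence are
  generators.\<close>

lemma word_mult_closed:
  "u \<in> Phi \<Longrightarrow> v \<in> Phi \<Longrightarrow> Poly_Mapping.keys (word_mult lam u v) \<subseteq> Phi"
proof (induction u v rule: word_mult_induct)
  case (concat u v)
  then show ?case by (simp add: word_mult_concat Phi_append_iff)
next
  case (collide b u v c)
  have "[Op u] \<in> Phi" "[Op v] \<in> Phi"
    using collide.prems by (auto simp: Phi_append_iff Phi_Cons_iff[of "Op v" c] split: if_splits)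
      (metis Op_in_Phi_iff Phi_append_iff append_Nil not_Cons_self2)+
  then have *: "Poly_Mapping.keys (op_mult lam u v) \<subseteq> Phi"
    unfolding op_mult_def by (intro keys_add_subset keys_pm_scale_subset collide.IH) auto
  have "b @ Op w # c \<in> Phi" if "w \<in> Phi" for w
  proof -
    have "Op w # c \<in> Phi"
      using Phi_context[of "[]" "Op v" c "Op w"] collide.prems that by simp
    then show ?thesis
      using collide.prems by (cases "b = []") (auto simp: Phi_append_iff)
  qed
  then show ?case
    unfolding word_mult_Op using keys_lin_ext_mon_subset * by fastforce
qed simp_all

text \<open>A collision at the head of \<open>u\<close> puts an \<open>Op\<close> in the place of an
  \<open>Op\<close>. Hence a prime that may stand before \<open>u\<close> may stand before every
  word of the product.\<close>

lemma hd_word_mult: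
  assumes "u \<noteq> []" "v \<noteq> []" "w \<in> Poly_Mapping.keys (word_mult lam u v)"
  shows "w \<noteq> [] \<and> is_Op (hd w) = is_Op (hd u)"
proof (cases "is_Op (last u) \<and> is_Op (hd v)")
  case True
  then obtain b u' v' c where "u = b @ [Op u']" "v = Op v' # c"
    using assms(1,2) by (meson last_is_OpE hd_is_OpE)
  then show ?thesis
    using assms(3) keys_lin_ext_mon_subset[of "\<lambda>w. b @ Op w # c" "op_mult lam u' v'"]
    by (auto simp: word_mult_Op hd_append)
next
  case False
  then show ?thesis using assms by (simp add: word_mult_concat)
qed

lemma word_mult_Cons:
  assumes "u \<noteq> []"
  shows "word_mult lam (p # u) v = lin_ext (\<lambda>w. mon (p # w)) (word_mult lam u v)"
  using assms by (simp add: word_mult.simps lin_ext_lin_ext)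


subsection \<open>Degrees\<close>

lemma deg_simps [simp]:
  "deg T [] = 0" "deg T (u @ v) = deg T u + deg T v"
  "deg T [Gen x] = (if SymX x \<in> T then 1 else 0)"
  "deg T [Op w] = (if SymP \<in> T then 1 else 0) + deg T w"
  by (auto simp: deg_def)

lemma deg_Cons: "deg T (p # w) = deg T [p] + deg T w"
  using deg_simps(2)[of T "[p]" w] by simp

text \<open>Of the three terms that replace a collision, two carry all symbols of both factors, up
  to losses in further collisions, and the weight term has one \<open>P\<close> fewer. So a product
  either keeps \<open>Deg\<close> or falls in total degree.\<close>

lemma deg_word_mult:
  "w \<in> Poly_Mapping.keys (word_mult lam u v) \<Longrightarrow>
    deg UNIV w < deg UNIV u + deg UNIV v \<or>
    deg UNIV w = deg UNIV u + deg UNIV v \<and> deg {SymP} w = deg {SymP} u + deg {SymP} v"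
proof (induction u v arbitrary: w rule: word_mult_induct)
  case (concat u v)
  then show ?case by (simp add: word_mult_concat)
next
  case (collide b u v c)
  from collide.prems obtain z where z: "w = b @ Op z # c" "z \<in> Poly_Mapping.keys (op_mult lam u v)"
    unfolding word_mult_Op using keys_lin_ext_mon_subset by fastforce
  \<comment> \<open>The summand 1 is the \<open>P\<close> kept inside by the first two terms; the
    second \<open>P\<close> of the collision is the one around \<open>z\<close>.\<close>
  have "deg UNIV z < 1 + deg UNIV u + deg UNIV v \<or>
      deg UNIV z = 1 + deg UNIV u + deg UNIV v \<and> deg {SymP} z = 1 + deg {SymP} u + deg {SymP} v"
  proof -
    from z(2) consider "z \<in> Poly_Mapping.keys (word_mult lam [Op u] v)"
      | "z \<in> Poly_Mapping.keys (word_mult lam u [Op v])" | "z \<in> Poly_Mapping.keys (word_mult lam u v)"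
      unfolding op_mult_def using keys_add keys_pm_scale by (metis (no_types, lifting) Un_iff subsetD)
    then show ?thesis
      using collide.IH by cases fastforce+
  qed
  then show ?case
    by (auto simp: z(1) deg_Cons[of _ _ c])
qed simp_all


subsection \<open>The ordering of words\<close>

abbreviation Deg_less :: "'x rb_word \<Rightarrow> 'x rb_word \<Rightarrow> bool" where
  "Deg_less u v \<equiv> (Deg u, Deg v) \<in> less_than <*lex*> less_than"

lemma Deg_less_iff:
  "Deg_less u v \<longleftrightarrow> deg UNIV u < deg UNIV v \<or> deg UNIV u = deg UNIV v \<and> deg {SymP} u < deg {SymP} v"
  by (simp add: Deg_def)

lemma Deg_eq_iff: "Deg u = Deg v \<longleftrightarrow> deg UNIV u = deg UNIV v \<and> deg {SymP} u = deg {SymP} v"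
  by (simp add: Deg_def)

lemma rb_less_Deg: "rb_less u v \<Longrightarrow> Deg_less u v \<or> Deg u = Deg v"
  by (induction rule: rb_less.induct) (auto simp: Deg_def)

lemma rb_less_neq: "rb_less u v \<Longrightarrow> u \<noteq> v"
  by (induction rule: rb_less.induct) (auto simp: Deg_less_iff)

lemma rb_less_singleE:
  assumes "rb_less [p] [q]"
  obtains "Deg_less [p] [q]"
    | x y where "p = Gen x" "q = Gen y" "x < y"
    | u v where "p = Op u" "q = Op v" "rb_less u v"
  using assms
proof cases
  case (lex w p' u q' v)
  then have "length (w @ p' # u) = 1" "length (w @ q' # v) = 1"
    by (metis length_Cons list.size(3) One_nat_def)+
  with lex show ?thesis by simp
qed (use that in blast)+

text \<open>Makes the definite description in \<open>lead\<close> unique. The delicate case is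
  \<open>lex\<close> against \<open>lex\<close>: both comparisons must locate the first difference
  at the same place.\<close>

lemma rb_less_asym: "rb_less u v \<Longrightarrow> \<not> rb_less v u"
proof (induction rule: rb_less.induct)
  case (Deg u v)
  then show ?case using rb_less_Deg[of v u] by (auto simp: Deg_less_iff Deg_eq_iff)
next
  case (Gen x y)
  then show ?case by (auto elim!: rb_less_singleE simp: Deg_less_iff)
next
  case (Op u v)
  then show ?case by (auto elim!: rb_less_singleE simp: Deg_less_iff Deg_eq_iff)
next
  case (lex w p u q v)
  show ?case
  proof
    assume "rb_less (w @ q # v) (w @ p # u)"
    then show False
    proof cases
      case Deg
      then show ?thesis using lex by (simp add: Deg_def)
    next
      case (Gen x y)
      then show ?thesis using lex by (auto simp: append_eq_Cons_conv)
    next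
      case (Op x y)
      then show ?thesis using lex by (auto simp: append_eq_Cons_conv)
    next
      case (lex w' p' u' q' v')
      consider "length w = length w'" | "length w < length w'" | "length w' < length w"
        by linarith
      then show ?thesis
      proof cases
        case 1
        then show ?thesis
          using lex \<open>\<not> rb_less [q] [p]\<close> by simp
      next
        \<comment> \<open>If the two positions differed, the entry at the earlier one would lie in
          the common prefix of the other comparison, so the primes compared there would be
          equal.\<close>
        case 2
        then have "p = (w @ p # u) ! length w" "q = (w @ q # v) ! length w"
          "(w' @ q' # v') ! length w = w' ! length w" "(w' @ p' # u') ! length w = w' ! length w"
          by (auto simp: nth_append)
        with lex have "p = q" by simp
        then show ?thesis using \<open>rb_less [p] [q]\<close> rb_less_neq by blast
      next
        case 3
        then have "p' = (w' @ p' # u') ! length w'" "q' = (w' @ q' # v') ! length w'"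
          "(w @ q # v) ! length w' = w ! length w'" "(w @ p # u) ! length w' = w ! length w'"
          by (auto simp: nth_append)
        with lex have "p' = q'" by simp
        then show ?thesis using \<open>rb_less [p'] [q']\<close> rb_less_neq by blast
      qed
    qed
  qed
qed

text \<open>The context adds the same to both degrees, so a difference in \<open>Deg\<close>
  persists and a tie is passed to \<open>lex\<close>. A nonempty context supplies the length greater
  than 1 that \<open>lex\<close> demands.\<close>

lemma rb_less_context:
  assumes "rb_less [p] [q]" "b \<noteq> [] \<or> c \<noteq> []"
  shows "rb_less (b @ p # c) (b @ q # c)"
proof (cases "Deg [p] = Deg [q]")
  case True
  then have "Deg (b @ p # c) = Deg (b @ q # c)"
    by (simp add: Deg_eq_iff deg_Cons[of _ p c] deg_Cons[of _ q c])
  with assms show ?thesis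
    by (intro rb_less.lex) auto
next
  case False
  with assms have "Deg_less [p] [q]"
    using rb_less_Deg by blast
  then show ?thesis
    by (intro rb_less.Deg) (auto simp: Deg_less_iff deg_Cons[of _ p c] deg_Cons[of _ q c])
qed

lemma rb_less_Op: "rb_less u v \<Longrightarrow> rb_less [Op u] [Op v]"
  using rb_less_Deg[of u v]
  by (auto intro: rb_less.Op rb_less.Deg simp: Deg_less_iff Deg_eq_iff)

lemma rb_less_Op_context: "rb_less u v \<Longrightarrow> rb_less (b @ Op u # c) (b @ Op v # c)"
  using rb_less_Op[of u v] rb_less_context[of "Op u" "Op v" b c] by (cases "b = [] \<and> c = []") auto

text \<open>The coefficient of \<open>w\<close> cannot cancel, since no word is below itself;
  asymmetry of the order excludes a second candidate for the leading word.\<close>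

lemma lead_eq:
  fixes g :: "'x::linorder rb_word \<Rightarrow>\<^sub>0 'k::field"
  assumes "\<And>t. t \<in> Poly_Mapping.keys g \<Longrightarrow> rb_less t w"
  shows "mon w - g \<noteq> 0" "lead (mon w - g) = w"
proof -
  have "w \<notin> Poly_Mapping.keys g"
    using assms rb_less_neq by blast
  then have w: "w \<in> Poly_Mapping.keys (mon w - g)"
    by (simp add: in_keys_iff lookup_minus)
  then show "mon w - g \<noteq> 0"
    by auto
  have less: "rb_less v w" if "v \<in> Poly_Mapping.keys (mon w - g)" "v \<noteq> w" for v
    using that assms[of v] by (auto simp: in_keys_iff lookup_minus lookup_single)
  show "lead (mon w - g) = w"
    unfolding lead_def
  proof (rule the_equality)
    show "w \<in> Poly_Mapping.keys (mon w - g) \<and>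
        (\<forall>v\<in>Poly_Mapping.keys (mon w - g). v \<noteq> w \<longrightarrow> rb_less v w)"
      using w less by simp
  next
    fix v
    assume "v \<in> Poly_Mapping.keys (mon w - g) \<and>
        (\<forall>u\<in>Poly_Mapping.keys (mon w - g). u \<noteq> v \<longrightarrow> rb_less u v)"
    then show "v = w"
      using w less[of v] rb_less_asym[of v w] by metis
  qed
qed


subsection \<open>Normal words\<close>

text \<open>An empty \<open>xs\<close> is allowed in \<open>op\<close>: powers of \<open>P\<close>
  arise by one application at a time, where \<open>nested\<close> uses exponents.\<close>

inductive_set NW :: "'x::linorder rb_word set" where
  gens: "xs \<noteq> [] \<Longrightarrow> sorted xs \<Longrightarrow> map Gen xs \<in> NW"
| op: "sorted xs \<Longrightarrow> w \<in> NW \<Longrightarrow> map Gen xs @ [Op w] \<in> NW"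

lemma NW_subset_Phi: "w \<in> NW \<Longrightarrow> w \<in> Phi"
proof (induction rule: NW.induct)
  case (op xs w)
  then show ?case by (cases "xs = []") (auto simp: Phi_append_iff last_map)
qed simp

lemma funpow_Op_NW: "w \<in> NW \<Longrightarrow> ((\<lambda>w. [Op w]) ^^ l) w \<in> NW"
proof (induction l)
  case (Suc l)
  then show ?case using NW.op[of "[]"] by simp
qed simp

text \<open>Every exponent is at least 1, so the nested word is a single \<open>Op\<close> factor;
  this is what allows a sorted block to be put in front of it in the next step.\<close>

lemma nested_NW:
  assumes "r \<noteq> []" "\<forall>(u, l)\<in>set r. u \<in> Y1 \<and> l \<ge> 1"
  shows "\<exists>w\<in>NW. nested r = [Op w]"
  using assms
proof (induction r rule: nested.induct)
  case (2 u l r)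
  then obtain ys where ys: "u = map Gen ys" "ys \<noteq> []" "sorted ys"
    by (auto simp: Y1_def)
  have "u @ nested r \<in> NW"
  proof (cases "r = []")
    case True
    then show ?thesis using ys by (simp add: NW.gens)
  next
    case False
    with 2 show ?thesis using ys NW.op by auto
  qed
  moreover obtain l' where "l = Suc l'"
    using 2 by (cases l) auto
  ultimately show ?case
    using funpow_Op_NW by auto
qed simp

text \<open>One more \<open>P\<close> raises the outermost exponent if the word already starts with
  \<open>P\<close>; otherwise its leading block of generators opens a new level with exponent
  1.\<close>

lemma Op_NW_Y2: "w \<in> Y1 \<union> Y2 \<union> Y3 \<Longrightarrow> w \<in> NW \<Longrightarrow> [Op w] \<in> Y2"
proof -
  assume *: "w \<in> Y1 \<union> Y2 \<union> Y3" "w \<in> NW"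
  have "\<exists>r. r \<noteq> [] \<and> (\<forall>(u, l)\<in>set r. u \<in> Y1 \<and> l \<ge> 1) \<and> [Op w] = nested r"
    using *(1)
  proof (elim UnE)
    assume "w \<in> Y1"
    then show ?thesis by (intro exI[of _ "[(w, 1)]"]) simp
  next
    assume "w \<in> Y2"
    then obtain r where r: "w = nested r" "r \<noteq> []" "\<forall>(u, l)\<in>set r. u \<in> Y1 \<and> l \<ge> 1"
      by (auto simp: Y2_def)
    then show ?thesis
      by (intro exI[of _ "(fst (hd r), Suc (snd (hd r))) # tl r"]) (cases r; auto)
  next
    assume "w \<in> Y3"
    then obtain u r where r: "w = u @ nested r" "u \<in> Y1" "\<forall>(u, l)\<in>set r. u \<in> Y1 \<and> l \<ge> 1"
      by (auto simp: Y2_def Y3_def)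
    then show ?thesis
      by (intro exI[of _ "(u, 1) # r"]) simp
  qed
  then show "[Op w] \<in> Y2"
    using NW_subset_Phi[OF *(2)] by (auto simp: Y2_def)
qed

lemma NW_eq: "NW = Y1 \<union> Y2 \<union> Y3"
proof (intro equalityI subsetI)
  fix w :: "'a rb_word"
  assume "w \<in> NW"
  then show "w \<in> Y1 \<union> Y2 \<union> Y3"
  proof (induction rule: NW.induct)
    case (gens xs)
    then show ?case by (auto simp: Y1_def)
  next
    case (op xs w)
    then have "[Op w] \<in> Y2" "map Gen xs @ [Op w] \<in> Phi"
      using Op_NW_Y2 NW.op NW_subset_Phi by blast+
    with op show ?case
      by (cases "xs = []") (auto simp: Y1_def Y3_def)
  qed
next
  fix w :: "'a rb_word"
  assume "w \<in> Y1 \<union> Y2 \<union> Y3"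
  moreover have *: "\<exists>v\<in>NW. w = [Op v]" if "w \<in> Y2" for w :: "'a rb_word"
    using that nested_NW by (auto simp: Y2_def)
  moreover have "w \<in> NW" if "w \<in> Y2" for w :: "'a rb_word"
    using *[OF that] NW.op[of "[]"] by auto
  moreover have "w \<in> NW" if "w \<in> Y3" for w :: "'a rb_word"
  proof -
    from that obtain ys v where "w = map Gen ys @ v" "sorted ys" "v \<in> Y2"
      by (auto simp: Y1_def Y3_def)
    then show ?thesis using * NW.op by blast
  qed
  ultimately show "w \<in> NW"
    using NW.gens by (auto simp: Y1_def)
qed

lemma sorted_map_Gen_factor:
  assumes "map Gen xs = b @ Gen i # Gen j # c" "sorted xs"
  shows "i \<le> j"
proof -
  obtain ys zs where "xs = ys @ zs" "map Gen zs = Gen i # Gen j # c"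
    using assms(1) by (metis map_eq_append_conv)
  then show ?thesis using assms(2) by (auto simp: Cons_eq_map_conv sorted_append)
qed

lemma NW_gens_factor:
  assumes "b @ Gen i # Gen j # c \<in> NW"
  shows "i \<le> j"
  using assms
proof (cases rule: NW.cases)
  case (gens xs)
  then show ?thesis using sorted_map_Gen_factor[of xs b i j c] by simp
next
  case (op xs w)
  then obtain c' where "b @ Gen i # Gen j # c' = map Gen xs"
    by (cases c rule: rev_cases) auto
  then show ?thesis using op sorted_map_Gen_factor by metis
qed

lemma NW_Op_last:
  assumes "b @ Op u # c \<in> NW"
  shows "u \<in> NW" "c = []"
proof -
  have no: "map Gen xs \<noteq> b @ Op u # c'" for xs c'
    by (auto simp: map_eq_append_conv Cons_eq_map_conv map_eq_Cons_conv)
  have "u \<in> NW \<and> c = []"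
    using assms
  proof (cases rule: NW.cases)
    case (gens xs)
    then show ?thesis using no[of xs c] by simp
  next
    case (op xs w)
    then show ?thesis using no[of xs, symmetric] by (cases c rule: rev_cases) auto
  qed
  then show "u \<in> NW" "c = []" by simp_all
qed

text \<open>If the tail is normal or empty, the fault lies at the first prime: a generator larger
  than its successor, an \<open>Op\<close> followed by a generator, or a last \<open>Op\<close> with
  a bad argument. Otherwise the fault is found in the tail.\<close>

lemma not_NW_cases:
  assumes "w \<in> Phi" "w \<notin> NW"
  obtains b i j c where "w = b @ Gen i # Gen j # c" "j < i"
    | b u i c where "w = b @ Op u # Gen i # c"
    | b u c where "w = b @ Op u # c" "u \<notin> NW"
proof -
  have "(\<exists>b i j c. w = b @ Gen i # Gen j # c \<and> j < i) \<or> (\<exists>b u i c. w = b @ Op u # Gen i # c)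
      \<or> (\<exists>b u c. w = b @ Op u # c \<and> u \<notin> NW)"
    using assms
  proof (induction w)
    case (Cons p w)
    show ?case
    proof (cases "w = [] \<or> w \<in> NW")
      case False
      then have "w \<in> Phi"
        using Cons.prems by (simp add: Phi_Cons_iff[of p w])
      with False Cons.IH show ?thesis
        by (metis append_Cons)
    next
      case w: True
      show ?thesis
      proof (cases p)
        case (Op z)
        show ?thesis
        proof (cases "w = []")
          case True
          then have "z \<notin> NW"
            using Cons.prems Op NW.op[of "[]" z] by auto
          with True Op show ?thesis by blast
        next
          case False
          then have "\<not> is_Op (hd w)"
            using Cons.prems(1) Op Phi_Cons_iff[of p w] by auto
          then obtain i c where "w = Gen i # c"
            using False by (cases w; cases "hd w") auto
          with Op show ?thesis by blast
        qed
      next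
        case (Gen x)
        have "w \<noteq> []"
          using Cons.prems Gen NW.gens[of "[x]"] by auto
        with w have "w \<in> NW" by simp
        then have "\<exists>xs t. w = map Gen xs @ t \<and> sorted xs \<and> (t = [] \<or> (\<exists>z\<in>NW. t = [Op z]))"
          by cases (metis append_Nil2, blast)
        then obtain xs t where t: "w = map Gen xs @ t" "sorted xs" "t = [] \<or> (\<exists>z\<in>NW. t = [Op z])"
          by blast
        \<comment> \<open>Otherwise \<open>x\<close> could be prepended to the sorted block and the
          whole word would be normal.\<close>
        have "xs \<noteq> [] \<and> hd xs < x"
        proof (rule ccontr)
          assume "\<not> (xs \<noteq> [] \<and> hd xs < x)"
          then have "sorted (x # xs)"
            using t(2) by (cases xs) auto
          then have "map Gen (x # xs) @ t \<in> NW"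
            using t(3) NW.gens[of "x # xs"] NW.op[of "x # xs"] by auto
          then show False
            using Cons.prems t Gen by simp
        qed
        then obtain y ys where "xs = y # ys" "y < x"
          by (cases xs) auto
        then have "p # w = [] @ Gen x # Gen y # map Gen ys @ t"
          using t Gen by simp
        with \<open>y < x\<close> show ?thesis by blast
      qed
    qed
  qed simp
  then show ?thesis using that by blast
qed


subsection \<open>Substitution\<close>

abbreviation emb :: "'x rb_word \<Rightarrow> 'x option rb_word" where
  "emb w \<equiv> map (map_prime_word Some) w"

lemma RB_simps [simp]:
  "carrier (RB lam) = {f. Poly_Mapping.keys f \<subseteq> Phi}"
  "f \<otimes>\<^bsub>RB lam\<^esub> g = lin_ext (\<lambda>u. lin_ext (\<lambda>v. word_mult lam u v) g) f"
  "\<zero>\<^bsub>RB lam\<^esub> = 0" "f \<oplus>\<^bsub>RB lam\<^esub> g = f + g" "c \<odot>\<^bsub>RB lam\<^esub> f = pm_scale c f" "rbop (RB lam) = P_ext"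
  by (simp_all add: RB_def)

lemma word_induct [case_names Gen Op Nil Cons]:
  fixes p :: "'x prime_word" and w :: "'x rb_word"
  assumes "\<And>x. Q (Gen x)" "\<And>w. R w \<Longrightarrow> Q (Op w)" "R []" "\<And>p w. Q p \<Longrightarrow> R w \<Longrightarrow> R (p # w)"
  shows "Q p" "R w"
  using eval_prime.induct[of Q R p] eval_word.induct[of Q R w] assms by blast+

lemma eval_map:
  fixes p :: "'x prime_word" and w :: "'x rb_word"
  shows "eval_prime A \<theta> (map_prime_word f p) = eval_prime A (\<lambda>x. \<theta> (f x)) p"
  "eval_word A \<theta> (map (map_prime_word f) w) = eval_word A (\<lambda>x. \<theta> (f x)) w"
  by (induction p and w rule: word_induct) auto

text \<open>Words of \<open>Phi\<close> have no adjacent \<open>Op\<close> factors, so each product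
  in the right-nested evaluation is a concatenation.\<close>

lemma eval_word_mon:
  fixes p :: "'x prime_word" and w :: "'x rb_word"
  shows "[p] \<in> Phi \<Longrightarrow> eval_prime (RB lam) (\<lambda>x. mon [Gen x]) p = mon [p]"
  "w \<in> Phi \<Longrightarrow> eval_word (RB lam) (\<lambda>x. mon [Gen x]) w = mon w"
proof (induction p and w rule: word_induct)
  case (Cons p w)
  then show ?case
    by (cases "w = []") (auto simp: Phi_Cons_iff[of p w] word_mult_concat)
qed auto

lemma plug_eval:
  "w \<in> Phi \<Longrightarrow> eval_word (RB lam) (\<lambda>y. case y of None \<Rightarrow> s | Some x \<Rightarrow> mon [Gen x]) (emb w) = mon w"
  "[p] \<in> Phi \<Longrightarrow>
    eval_prime (RB lam) (\<lambda>y. case y of None \<Rightarrow> s | Some x \<Rightarrow> mon [Gen x]) (map_prime_word Some p) = mon [p]"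
  by (simp_all add: eval_map eval_word_mon)

text \<open>The product b(fc). An empty context means that the factor is absent; it needs its own
  case because \<open>word_mult\<close> with an empty word is 0.\<close>

definition sandwich ::
  "'k::field \<Rightarrow> 'x rb_word \<Rightarrow> ('x rb_word \<Rightarrow>\<^sub>0 'k) \<Rightarrow> 'x rb_word \<Rightarrow> 'x rb_word \<Rightarrow>\<^sub>0 'k" where
  "sandwich lam b f c =
    (let g = (if c = [] then f else lin_ext (\<lambda>u. word_mult lam u c) f)
     in if b = [] then g else lin_ext (word_mult lam b) g)"

text \<open>An instance of associativity that involves no collision at the new bracket: by
  \<open>hd_word_mult\<close> the product of \<open>b\<close> with anything still starts like
  \<open>b\<close>, so \<open>p\<close> is merely prepended.\<close>

lemma sandwich_Cons:
  assumes "[] \<notin> Poly_Mapping.keys f" "b \<noteq> []" "p # b \<in> Phi"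
  shows "sandwich lam (p # b) f c = lin_ext (word_mult lam [p]) (sandwich lam b f c)"
proof -
  define g where "g = (if c = [] then f else lin_ext (\<lambda>u. word_mult lam u c) f)"
  have g: "[] \<notin> Poly_Mapping.keys g"
  proof
    assume *: "[] \<in> Poly_Mapping.keys g"
    then have "c \<noteq> []" using assms(1) by (auto simp: g_def)
    with * obtain u where "u \<in> Poly_Mapping.keys f" "[] \<in> Poly_Mapping.keys (word_mult lam u c)"
      using keys_lin_ext by (fastforce simp: g_def)
    then show False
      using hd_word_mult \<open>c \<noteq> []\<close> assms(1) by (metis)
  qed
  have "word_mult lam (p # b) v = lin_ext (word_mult lam [p]) (word_mult lam b v)"
    if "v \<in> Poly_Mapping.keys g" for v
  proof -
    have "v \<noteq> []" using that g by auto
    have "word_mult lam [p] w = mon (p # w)" if "w \<in> Poly_Mapping.keys (word_mult lam b v)" for w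
    proof -
      have "\<not> (is_Op p \<and> is_Op (hd w))" "w \<noteq> []"
        using hd_word_mult[OF assms(2) \<open>v \<noteq> []\<close> that] assms(2,3) by (auto simp: Phi_Cons_iff[of p b])
      then show ?thesis by (simp add: word_mult_concat)
    qed
    then show ?thesis
      using assms(2) by (simp add: word_mult_Cons cong: lin_ext_cong)
  qed
  then have "lin_ext (word_mult lam (p # b)) g = lin_ext (word_mult lam [p]) (lin_ext (word_mult lam b) g)"
    unfolding lin_ext_lin_ext by (rule lin_ext_cong)
  then show ?thesis
    using assms(2) by (simp only: sandwich_def Let_def g_def[symmetric]) simp
qed

lemma sandwich_single: "sandwich lam [p] f c = lin_ext (word_mult lam [p]) (sandwich lam [] f c)"
  by (simp add: sandwich_def Let_def)

lemma sandwich_diff: "sandwich lam b (f - g) c = sandwich lam b f c - sandwich lam b g c"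
  by (simp add: sandwich_def Let_def lin_ext_diff)

section \<open>Words with one star and their substitution instances\<close>

lemma is_Op_map [simp]: "is_Op (map_prime_word f p) = is_Op p"
  by (cases p) auto

lemma map_in_Phi_iff:
  fixes p :: "'x prime_word" and w :: "'x rb_word"
  shows "[map_prime_word f p] \<in> Phi \<longleftrightarrow> [p] \<in> Phi" "map (map_prime_word f) w \<in> Phi \<longleftrightarrow> w \<in> Phi"
proof (induction p and w rule: word_induct)
  case (Cons p w)
  then show ?case
    using Phi_Cons_iff[of p w] Phi_Cons_iff[of "map_prime_word f p" "map (map_prime_word f) w"]
    by (cases "w = []") (auto simp: hd_map)
qed auto

lemma deg_star_emb [simp]: "deg {SymX None} (emb w) = 0"
proof -
  have "deg {SymX None} [map_prime_word Some p] = 0" "deg {SymX None} (emb w) = 0" for p :: "'a prime_word"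
  proof (induction p and w rule: word_induct)
    case (Cons p w)
    then show ?case by (simp add: deg_Cons[of _ _ "emb w"])
  qed auto
  then show ?thesis by simp
qed

lemma deg_star_0E:
  fixes p :: "'x option prime_word" and w :: "'x option rb_word"
  shows "deg {SymX None} [p] = 0 \<Longrightarrow> \<exists>q. p = map_prime_word Some q"
    "deg {SymX None} w = 0 \<Longrightarrow> \<exists>v. w = emb v"
proof (induction p and w rule: word_induct)
  case (Gen x)
  then show ?case by (cases x) (auto intro: exI[of _ "Gen _"])
next
  case (Op w)
  then show ?case by (auto intro: exI[of _ "Op _"])
next
  case (Cons p w)
  then show ?case by (auto simp: deg_Cons[of _ p w] intro: exI[of _ "_ # _"])
qed auto

text \<open>The single star lies in exactly one prime factor; the words on either side contain no
  star and hence come from words over X.\<close>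

lemma Phi_star_cases:
  assumes "v \<in> Phi_star"
  obtains b p c where "v = emb b @ p # emb c" "b = [] \<or> b \<in> Phi" "c = [] \<or> c \<in> Phi"
    "p = Gen None \<or> (\<exists>v'\<in>Phi_star. p = Op v')"
proof -
  have v: "v \<in> Phi" "deg {SymX None} v = 1"
    using assms by (auto simp: Phi_star_def)
  have "\<exists>b p c. v = emb b @ p # emb c \<and> deg {SymX None} [p] = 1"
    using v(2)
  proof (induction v)
    case (Cons q w)
    show ?case
    proof (cases "deg {SymX None} w = 0")
      case True
      then have "deg {SymX None} [q] = 1"
        using Cons.prems by (simp add: deg_Cons[of _ q w])
      moreover obtain c where "w = emb c"
        using deg_star_0E(2)[OF True] by blast
      ultimately show ?thesis by (intro exI[of _ "[]"] exI[of _ q] exI[of _ c]) simp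
    next
      case False
      then have *: "deg {SymX None} [q] = 0" "deg {SymX None} w = 1"
        using Cons.prems by (simp_all add: deg_Cons[of _ q w])
      then obtain b p c r where "w = emb b @ p # emb c" "deg {SymX None} [p] = 1" "q = map_prime_word Some r"
        using Cons.IH deg_star_0E(1) by blast
      then show ?thesis by (intro exI[of _ "r # b"] exI[of _ p] exI[of _ c]) simp
    qed
  qed simp
  then obtain b p c where *: "v = emb b @ p # emb c" "deg {SymX None} [p] = 1"
    by blast
  have "b = [] \<or> b \<in> Phi" "p # emb c \<in> Phi"
    using v(1) map_in_Phi_iff(2)[of Some b] by (cases "b = []"; simp add: * Phi_append_iff)+
  moreover from this have "c = [] \<or> c \<in> Phi" "[p] \<in> Phi"
    using map_in_Phi_iff(2)[of Some c] Phi_Cons_iff[of p "emb c"] by auto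
  moreover have "p = Gen None \<or> (\<exists>v'\<in>Phi_star. p = Op v')"
    using *(2) \<open>[p] \<in> Phi\<close> by (cases p) (auto simp: Phi_star_def split: if_splits)
  ultimately show ?thesis using that * by blast
qed

abbreviation star_val :: "('x rb_word \<Rightarrow>\<^sub>0 'k::field) \<Rightarrow> 'x option \<Rightarrow> 'x rb_word \<Rightarrow>\<^sub>0 'k" where
  "star_val s \<equiv> (\<lambda>y. case y of None \<Rightarrow> s | Some x \<Rightarrow> mon [Gen x])"

text \<open>Evaluation nests to the right, so the primes of \<open>b\<close> are peeled off one at a
  time. The empty word must not occur in the value at the star, because multiplication by it gives 0
  instead of a concatenation.\<close>

lemma plug_context:
  assumes "b = [] \<or> b \<in> Phi" "c = [] \<or> c \<in> Phi"
    and "[] \<notin> Poly_Mapping.keys (eval_prime (RB lam) (star_val s) p)"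
  shows "plug lam (emb b @ p # emb c) s = sandwich lam b (eval_prime (RB lam) (star_val s) p) c"
  using assms(1)
proof (induction b)
  case Nil
  show ?case
    using assms(2) by (auto simp: plug_def sandwich_def plug_eval)
next
  case (Cons q b)
  then have q: "[q] \<in> Phi" "b = [] \<or> b \<in> Phi" "q # b \<in> Phi"
    using Phi_Cons_iff[of q b] by auto
  have "plug lam (emb (q # b) @ p # emb c) s =
      lin_ext (word_mult lam [q]) (plug lam (emb b @ p # emb c) s)"
    by (simp add: plug_def plug_eval[OF q(1)])
  also have "\<dots> = sandwich lam (q # b) (eval_prime (RB lam) (star_val s) p) c"
    using Cons.IH[OF q(2)] sandwich_Cons[OF assms(3) _ q(3)]
    by (cases "b = []") (simp_all add: sandwich_single)
  finally show ?case .
qed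

lemma sandwich_concat:
  assumes "b @ a @ c \<in> Phi" "a \<noteq> []"
  shows "sandwich lam b (mon a) c = mon (b @ a @ c)"
proof -
  have "a @ c \<in> Phi" "b \<noteq> [] \<Longrightarrow> \<not> (is_Op (last b) \<and> is_Op (hd (a @ c)))"
    using assms by (cases "b = []"; simp add: Phi_append_iff)+
  then show ?thesis
    using assms(2)
    by (cases "c = []"; cases "b = []") (auto simp: sandwich_def word_mult_concat Phi_append_iff)
qed

text \<open>The hypothesis says that an \<open>Op\<close> may stand between \<open>b\<close> and
  \<open>c\<close>; hence neither side collides with it, whatever its argument.\<close>

lemma sandwich_P_ext:
  assumes "b @ Op u # c \<in> Phi"
  shows "sandwich lam b (P_ext f) c = lin_ext (\<lambda>t. mon (b @ Op t # c)) f"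
proof -
  have b: "b \<noteq> [] \<Longrightarrow> \<not> is_Op (last b)" and c: "c \<noteq> [] \<Longrightarrow> \<not> is_Op (hd c)"
    using assms Phi_Cons_iff[of "Op u" c] by (cases "b = []"; simp add: Phi_append_iff; fail)
      (use assms Phi_Cons_iff[of "Op u" c] in \<open>cases "b = []"; simp add: Phi_append_iff\<close>)
  have "(if c = [] then P_ext f else lin_ext (\<lambda>u. word_mult lam u c) (P_ext f)) =
      lin_ext (\<lambda>t. mon (Op t # c)) f"
    using c by (auto simp: P_ext_def lin_ext_lin_ext word_mult_concat)
  then show ?thesis
    using b by (auto simp: sandwich_def Let_def lin_ext_lin_ext word_mult_concat)
qed


subsection \<open>Irreducible words\<close>

text \<open>Both monomials have the same symbols, so their first primes decide. A generator lies
  below every \<open>Op\<close> already by \<open>Deg\<close>.\<close>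

lemma comm_rel_lead:
  assumes "(\<exists>j. p = Gen j \<and> i < j) \<or> is_Op p"
  shows "rb_less [Gen i] [p]" "lead (mon [p, Gen i] - mon [Gen i, p] :: _ \<Rightarrow>\<^sub>0 'k::field) = [p, Gen i]"
proof -
  show "rb_less [Gen i] [p]"
    using assms
  proof
    assume "is_Op p"
    then show ?thesis by (intro rb_less.Deg) (auto simp: is_Op_iff Deg_less_iff)
  qed (auto intro: rb_less.Gen)
  then have "rb_less [Gen i, p] [p, Gen i]"
    using rb_less.lex[of "[]" "Gen i" "[p]" p "[Gen i]"]
    by (simp add: Deg_eq_iff deg_Cons[of _ "Gen i" "[p]"] deg_Cons[of _ p "[Gen i]"])
  then show "lead (mon [p, Gen i] - mon [Gen i, p] :: _ \<Rightarrow>\<^sub>0 'k::field) = [p, Gen i]"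
    by (intro lead_eq) simp
qed

lemma comm_rels_cases:
  assumes "s \<in> comm_rels"
  obtains p i where "s = mon [p, Gen i] - mon [Gen i, p]" "(\<exists>j. p = Gen j \<and> i < j) \<or> (\<exists>u\<in>Phi. p = Op u)"
  using assms unfolding comm_rels_def by blast

text \<open>Substitution may produce a sum of words, so the claim concerns every word in the
  support. A star below some \<open>Op\<close> hands a bad word to that \<open>Op\<close>, and a
  normal word has only normal arguments.\<close>

lemma plug_not_NW:
  fixes s :: "'x::linorder rb_word \<Rightarrow>\<^sub>0 'k::field" and lam :: 'k
  assumes "s \<in> comm_rels"
  shows "v \<in> Phi_star \<Longrightarrow> w \<in> Poly_Mapping.keys (plug lam v (mon (lead s))) \<Longrightarrow> w \<notin> NW"
proof (induction "size_list size v" arbitrary: v w rule: less_induct)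
  case less
  let ?s = "mon (lead s) :: 'x rb_word \<Rightarrow>\<^sub>0 'k"
  from assms obtain p i where "s = mon [p, Gen i] - mon [Gen i, p]"
    and p: "(\<exists>j. p = Gen j \<and> i < j) \<or> (\<exists>u\<in>Phi. p = Op u)"
    by (rule comm_rels_cases)
  with comm_rel_lead(2)[of p i] have s: "lead s = [p, Gen i]" "(\<exists>j. p = Gen j \<and> i < j) \<or> (\<exists>u\<in>Phi. p = Op u)"
    by auto
  from less.prems(1) obtain b q c where v: "v = emb b @ q # emb c" "b = [] \<or> b \<in> Phi" "c = [] \<or> c \<in> Phi"
    "q = Gen None \<or> (\<exists>v'\<in>Phi_star. q = Op v')"
    by (rule Phi_star_cases)
  have *: "plug lam v ?s = sandwich lam b (eval_prime (RB lam) (star_val ?s) q) c"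
    unfolding v(1) using v(2-4) s(1) keys_P_ext
    by (intro plug_context) fastforce+
  from v(4) show ?case
  proof (elim disjE bexE)
    assume "q = Gen None"
    then have "plug lam v ?s = sandwich lam b (mon [p, Gen i]) c"
      using * s(1) by simp
    also have "\<dots> = (if b = [] then mon (p # Gen i # c) else word_mult lam b (p # Gen i # c))"
      by (simp add: sandwich_def word_mult_concat)
    finally have w: "w \<in> Poly_Mapping.keys (if b = [] then mon (p # Gen i # c) else word_mult lam b (p # Gen i # c))"
      using less.prems(2) by simp
    show ?case
    proof (cases "b \<noteq> [] \<and> is_Op (last b) \<and> is_Op p")
      case True
      then obtain b' z u where "b = b' @ [Op z]" "p = Op u"
        by (metis last_is_OpE is_Op_iff)
      with w obtain z' where "w = b' @ Op z' # Gen i # c"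
        using keys_lin_ext_mon_subset[of "\<lambda>w. b' @ Op w # Gen i # c" "op_mult lam z u"]
        by (auto simp: word_mult_Op)
      then show ?thesis using NW_Op_last(2) by blast
    next
      case False
      then have "w = b @ p # Gen i # c"
        using w by (cases "b = []") (auto simp: word_mult_concat)
      then show ?thesis
        using s(2) NW_gens_factor[of b _ i c] NW_Op_last(2)[of b _ "Gen i # c"] leD by auto
    qed
  next
    fix v' assume v': "v' \<in> Phi_star" "q = Op v'"
    have "b @ Op u # c \<in> Phi" if "u \<in> Phi" for u
    proof -
      have "emb (b @ Op u # c) \<in> Phi"
        using Phi_context[of "emb b" q "emb c" "Op (emb u)"] less.prems(1) v(1) v' that
          map_in_Phi_iff(2)[of Some u] by (simp add: Phi_star_def)
      then show ?thesis using map_in_Phi_iff(2) by blast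
    qed
    \<comment> \<open>The word \<open>[Gen i]\<close> is an arbitrary witness that the context
      \<open>b\<close>, \<open>c\<close> admits an \<open>Op\<close> factor.\<close>
    from this[of "[Gen i]"] have "plug lam v ?s = lin_ext (\<lambda>t. mon (b @ Op t # c)) (plug lam v' ?s)"
      using * v'(2) sandwich_P_ext[of b "[Gen i]" c lam] by (simp add: plug_def)
    then obtain t where "t \<in> Poly_Mapping.keys (plug lam v' ?s)" "w = b @ Op t # c"
      using less.prems(2) keys_lin_ext_mon_subset by fastforce
    moreover from this have "t \<notin> NW"
      using less.hyps[of v' t] v' v(1) by simp
    ultimately show ?case
      using NW_Op_last(1) by blast
  qed
qed

lemma Phi_glue_Gen: "b = [] \<or> b \<in> Phi \<Longrightarrow> c = [] \<or> c \<in> Phi \<Longrightarrow> b @ Gen x # c \<in> Phi"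
  using Phi_Cons_iff[of "Gen x" c] by (cases "b = []") (auto simp: Phi_append_iff)

lemma Phi_split:
  assumes "b @ p # c \<in> Phi"
  shows "b = [] \<or> b \<in> Phi" "c = [] \<or> c \<in> Phi" "[p] \<in> Phi"
  using assms Phi_Cons_iff[of p c] by (cases "b = []"; auto simp: Phi_append_iff)+

lemma Phi_starI: "b = [] \<or> b \<in> Phi \<Longrightarrow> c = [] \<or> c \<in> Phi \<Longrightarrow> emb b @ Gen None # emb c \<in> Phi_star"
  by (simp add: Phi_star_def Phi_glue_Gen map_in_Phi_iff deg_Cons[of _ "Gen None" "emb c"])

text \<open>A reduction is recorded as a difference \<open>mon w - g\<close> with \<open>g\<close> supported below \<open>w\<close>, so that
  normality of the substituted word is a matter of reading off the leading term.\<close>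

lemma reduct_exists:
  fixes lam :: "'k::field" and w :: "'x::linorder rb_word"
  assumes "w \<in> Phi" "w \<notin> NW"
  shows "\<exists>s\<in>comm_rels. \<exists>v\<in>Phi_star. \<exists>g. plug lam v (mon (lead s)) = mon w \<and>
    plug lam v s = mon w - g \<and> (\<forall>t\<in>Poly_Mapping.keys g. rb_less t w)"
  using assms
proof (induction "size_list size w" arbitrary: w rule: less_induct)
  case less
  \<comment> \<open>Both kinds of relation at the outer level exchange a generator with a larger
    prime on its left, and are treated together.\<close>
  have swap: ?case if w: "w = b @ p # Gen i # c" and p: "(\<exists>j. p = Gen j \<and> i < j) \<or> is_Op p" for b p i c
  proof -
    note Phi = Phi_split[of b p "Gen i # c"]
    have c: "c = [] \<or> c \<in> Phi" and b: "b = [] \<or> b \<in> Phi" and "[p] \<in> Phi"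
      using Phi less.prems(1) Phi_split(2)[of "[]" "Gen i" c] unfolding w by auto
    define s :: "'x rb_word \<Rightarrow>\<^sub>0 'k" where "s = mon [p, Gen i] - mon [Gen i, p]"
    have s: "s \<in> comm_rels"
      using p \<open>[p] \<in> Phi\<close> unfolding s_def by (auto simp: comm_rels_def is_Op_iff)
    note lead = comm_rel_lead(2)[OF p, where 'k = 'k, folded s_def] and less_p = comm_rel_lead(1)[OF p]
    let ?v = "emb b @ Gen None # emb c"
    define g where "g = sandwich lam b (mon [Gen i, p]) c"
    have plug: "plug lam ?v f = sandwich lam b f c" if "[] \<notin> Poly_Mapping.keys f" for f
      using plug_context[OF b c, of lam f "Gen None"] that by simp
    have w': "sandwich lam b (mon [p, Gen i]) c = mon w"
      using sandwich_concat[of b "[p, Gen i]" c lam] less.prems(1) unfolding w by simp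
    have "plug lam ?v (mon (lead s)) = mon w"
      using w' lead by (simp add: plug)
    moreover have "[] \<notin> Poly_Mapping.keys s"
      by (simp add: s_def in_keys_iff lookup_minus lookup_single)
    then have "plug lam ?v s = mon w - g"
      unfolding g_def w'[symmetric] by (simp add: plug s_def sandwich_diff)
    moreover have "rb_less t w" if "t \<in> Poly_Mapping.keys g" for t
    proof -
      \<comment> \<open>After the exchange \<open>Gen i\<close> shields \<open>b\<close>, but
        \<open>p\<close> now meets \<open>c\<close> and may collide with an \<open>Op\<close> at its
        head; all words of \<open>g\<close> nevertheless start with \<open>b\<close> and
        \<open>Gen i\<close>.\<close>
      have "\<exists>z. t = b @ Gen i # z \<and> (z = p # c \<or> z \<in> Poly_Mapping.keys (word_mult lam [p] c))"
      proof (cases "c = []")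
        case True
        then have "g = mon (b @ [Gen i, p])"
          unfolding g_def using sandwich_concat[of b "[Gen i, p]" c lam] Phi_glue_Gen[OF b, of "[p]"] \<open>[p] \<in> Phi\<close>
          by simp
        then show ?thesis using that True by simp
      next
        case False
        have "g = lin_ext (\<lambda>z. mon (b @ Gen i # z)) (word_mult lam [p] c)"
          using False by (auto simp: g_def sandwich_def Let_def word_mult_Cons lin_ext_lin_ext word_mult_concat)
        then show ?thesis using that keys_lin_ext_mon_subset by fastforce
      qed
      then obtain z where z: "t = b @ Gen i # z"
        "deg UNIV z < deg UNIV (p # c) \<or> deg UNIV z = deg UNIV (p # c) \<and> deg {SymP} z = deg {SymP} (p # c)"
        using deg_word_mult[of _ lam "[p]" c] by (fastforce simp: deg_Cons[of _ p c])
      \<comment> \<open>If the collision loses degree, \<open>t\<close> is smaller for that reason.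
        If not, the two words first differ right after \<open>b\<close>, where \<open>Gen i\<close>
        stands against the larger \<open>p\<close>.\<close>
      show ?thesis
      proof (cases "Deg t = Deg w")
        case True
        then show ?thesis
          unfolding z(1) w by (intro rb_less.lex less_p) simp_all
      next
        case False
        then have "Deg_less t w"
          using z(2) unfolding z(1) w Deg_less_iff Deg_eq_iff
          by (auto simp: deg_Cons[of _ "Gen i" z] deg_Cons[of _ "Gen i" c] deg_Cons[of _ p c]
              deg_Cons[of _ p "Gen i # c"])
        then show ?thesis by (rule rb_less.Deg)
      qed
    qed
    ultimately show ?case
      using s Phi_starI[OF b c] by blast
  qed
  from less.prems show ?case
  proof (cases rule: not_NW_cases)
    case (1 b i j c)
    then show ?thesis using swap by blast
  next
    case (2 b u i c)
    then show ?thesis using swap[of b "Op u" i c] by simp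
  next
    case (3 b u c)
    note b = Phi_split[OF less.prems(1)[unfolded 3(1)]]
    from b(3) have "u \<in> Phi" by simp
    then obtain s v g where IH: "s \<in> (comm_rels :: ('x rb_word \<Rightarrow>\<^sub>0 'k) set)" "v \<in> Phi_star"
      "plug lam v (mon (lead s)) = mon u" "plug lam v s = mon u - g" "\<forall>t\<in>Poly_Mapping.keys g. rb_less t u"
      using less.hyps[of u] 3 by auto
    let ?v = "emb b @ Op v # emb c"
    have plug: "plug lam ?v f = lin_ext (\<lambda>t. mon (b @ Op t # c)) (plug lam v f)" for f
    proof -
      have "[] \<notin> Poly_Mapping.keys (eval_prime (RB lam) (star_val f) (Op v))"
        using keys_P_ext by fastforce
      then have "plug lam ?v f = sandwich lam b (eval_prime (RB lam) (star_val f) (Op v)) c"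
        by (rule plug_context[OF b(1,2)])
      then show ?thesis
        using sandwich_P_ext[OF less.prems(1)[unfolded 3(1)]] by (simp add: plug_def)
    qed
    have "emb b @ Op (emb u) # emb c \<in> Phi"
      using less.prems(1) map_in_Phi_iff(2)[of Some w] unfolding 3(1) by simp
    then have "?v \<in> Phi_star"
      using IH(2) Phi_context[of "emb b" "Op (emb u)" "emb c" "Op v"]
      by (simp add: Phi_star_def deg_Cons[of _ "Op v" "emb c"])
    moreover have "plug lam ?v (mon (lead s)) = mon w"
      unfolding plug IH(3) 3(1) by simp
    moreover have "plug lam ?v s = mon w - lin_ext (\<lambda>t. mon (b @ Op t # c)) g"
      unfolding plug IH(4) 3(1) by (simp add: lin_ext_diff)
    moreover have "rb_less t w" if "t \<in> Poly_Mapping.keys (lin_ext (\<lambda>t. mon (b @ Op t # c) :: 'x rb_word \<Rightarrow>\<^sub>0 'k) g)" for t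
    proof -
      from that obtain t' where "t' \<in> Poly_Mapping.keys g" "t = b @ Op t' # c"
        using keys_lin_ext_mon_subset by fastforce
      then show ?thesis
        using IH(5) rb_less_Op_context unfolding 3(1) by blast
    qed
    ultimately show ?thesis
      using IH(1) by blast
  qed
qed

lemma Irr_comm_rels: "Irr lam (comm_rels :: ('x::linorder rb_word \<Rightarrow>\<^sub>0 'k::field) set) = NW"
proof (intro equalityI subsetI)
  fix w :: "'x rb_word"
  assume w: "w \<in> Irr lam (comm_rels :: ('x rb_word \<Rightarrow>\<^sub>0 'k) set)"
  show "w \<in> NW"
  proof (rule ccontr)
    assume "w \<notin> NW"
    with w obtain s v g where *: "s \<in> (comm_rels :: ('x rb_word \<Rightarrow>\<^sub>0 'k) set)" "v \<in> Phi_star"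
      "plug lam v (mon (lead s)) = mon w" "plug lam v s = mon w - g" "\<forall>t\<in>Poly_Mapping.keys g. rb_less t w"
      using reduct_exists[of w lam] by (auto simp: Irr_def)
    then have "normal_s_word lam v s"
      using lead_eq[of g w] by (simp add: normal_s_word_def)
    with *(1,2) w have "mon w \<noteq> plug lam v (mon (lead s))"
      unfolding Irr_def by blast
    with *(3) show False by simp
  qed
next
  fix w :: "'x rb_word"
  assume w: "w \<in> NW"
  have "mon w \<noteq> plug lam v (mon (lead s))" if "s \<in> (comm_rels :: ('x rb_word \<Rightarrow>\<^sub>0 'k) set)" "v \<in> Phi_star" for s v
  proof
    assume "mon w = plug lam v (mon (lead s))"
    from plug_not_NW[OF that, of w lam, folded this] w show False by simp
  qed
  then show "w \<in> Irr lam (comm_rels :: ('x rb_word \<Rightarrow>\<^sub>0 'k) set)"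
    using NW_subset_Phi[OF w] by (auto simp: Irr_def)
qed


subsection \<open>A commutative model\<close>

text \<open>Finite sums of words over the free commutative monoid are replaced by arbitrary functions on
  words, so that the quasi-shuffle product can be defined by recursion on the word at which the
  product is evaluated.\<close>

definition splits :: "'i multiset \<Rightarrow> ('i multiset \<times> 'i multiset) set" where
  "splits m = {(a, b). a + b = m}"

lemma finite_splits [simp]: "finite (splits m)"
proof (induction m)
  case (add x m)
  have "splits (add_mset x m) \<subseteq>
      (\<lambda>(a, b). (add_mset x a, b)) ` splits m \<union> (\<lambda>(a, b). (a, add_mset x b)) ` splits m"
  proof
    fix p
    assume "p \<in> splits (add_mset x m)"
    then obtain a b where p: "p = (a, b)" "a + b = add_mset x m"
      by (auto simp: splits_def)
    then have "x \<in># a \<or> x \<in># b"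
      by (metis union_iff union_single_eq_member)
    then show "p \<in> (\<lambda>(a, b). (add_mset x a, b)) ` splits m \<union> (\<lambda>(a, b). (a, add_mset x b)) ` splits m"
      using p by (auto simp: splits_def image_iff dest!: multi_member_split)
  qed
  then show ?case
    by (rule finite_subset) (simp add: add)
qed (simp add: splits_def)

lemma sum_splits_swap: "(\<Sum>(a, b)\<in>splits m. \<phi> a b) = (\<Sum>(a, b)\<in>splits m. \<phi> b a)"
  by (rule sum.reindex_bij_witness[of _ "\<lambda>(a, b). (b, a)" "\<lambda>(a, b). (b, a)"])
    (auto simp: splits_def add.commute)

text \<open>Both sides sum over all ordered decompositions of \<open>m\<close> into three parts; the
  two bijections only regroup them.\<close>

lemma sum_splits_assoc:
  "(\<Sum>(a, b)\<in>splits m. \<Sum>(c, d)\<in>splits a. \<phi> c d b) = (\<Sum>(a, b)\<in>splits m. \<Sum>(c, d)\<in>splits b. \<phi> a c d)"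
proof -
  have "(\<Sum>(x, y)\<in>(SIGMA x:splits m. splits (fst x)). \<phi> (fst y) (snd y) (snd x)) =
      (\<Sum>(x, y)\<in>(SIGMA x:splits m. splits (snd x)). \<phi> (fst x) (fst y) (snd y))"
    by (rule sum.reindex_bij_witness[of _ "\<lambda>((a, b), (c, d)). ((a + c, d), (a, c))"
          "\<lambda>((a, b), (c, d)). ((c, d + b), (d, b))"])
      (auto simp: splits_def add.assoc)
  then show ?thesis
    unfolding case_prod_beta by (subst (1 2) sum.Sigma) (simp_all add: case_prod_beta)
qed

lemma sum_splits_zero_left:
  assumes "\<And>a b. a \<noteq> {#} \<Longrightarrow> \<phi> a b = 0"
  shows "(\<Sum>(a, b)\<in>splits m. \<phi> a b) = \<phi> {#} m"
proof -
  have "(\<Sum>(a, b)\<in>splits m. \<phi> a b) = (\<Sum>(a, b)\<in>{({#}, m)}. \<phi> a b)"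
  proof (rule sum.mono_neutral_right)
    show "\<forall>p\<in>splits m - {({#}, m)}. (case p of (a, b) \<Rightarrow> \<phi> a b) = 0"
    proof
      fix p
      assume "p \<in> splits m - {({#}, m)}"
      then have "fst p \<noteq> {#}"
        by (auto simp: splits_def)
      then show "(case p of (a, b) \<Rightarrow> \<phi> a b) = 0"
        using assms by (simp add: case_prod_beta)
    qed
  qed (simp, simp add: splits_def)
  then show ?thesis by simp
qed

text \<open>The coefficient of a word in the quasi-shuffle product of two series. Its first letter
  \<open>m\<close> comes from the first series, from the second, or, with weight \<open>lam\<close>,
  is the product of a letter of each.\<close>

primrec qsh :: "'k::field \<Rightarrow> 'i multiset list \<Rightarrow> ('i multiset list \<Rightarrow> 'k) \<Rightarrow> ('i multiset list \<Rightarrow> 'k) \<Rightarrow> 'k"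
  where
    "qsh lam [] = (\<lambda>f g. f [] * g [])"
  | "qsh lam (m # w) = (\<lambda>f g. qsh lam w (\<lambda>v. f (m # v)) g + qsh lam w f (\<lambda>v. g (m # v))
      + lam * (\<Sum>(a, b)\<in>splits m. qsh lam w (\<lambda>v. f (a # v)) (\<lambda>v. g (b # v))))"

lemma qsh_commute: "qsh lam w f g = qsh lam w g f"
proof (induction w arbitrary: f g)
  case (Cons m w)
  show ?case
    by (simp add: Cons[of f] Cons[of "\<lambda>v. f (_ # v)"] add.commute
        sum_splits_swap[of "\<lambda>a b. qsh lam w (\<lambda>v. g (a # v)) (\<lambda>v. f (b # v))"])
qed simp

lemma qsh_add_left: "qsh lam w (\<lambda>v. f v + f' v) g = qsh lam w f g + qsh lam w f' g"
  by (induction w arbitrary: f f' g) (simp_all add: sum.distrib case_prod_beta algebra_simps)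

lemma qsh_scale_left: "qsh lam w (\<lambda>v. c * f v) g = c * qsh lam w f g"
  by (induction w arbitrary: f g) (simp_all add: sum_distrib_left case_prod_beta algebra_simps)

lemma qsh_zero_left [simp]: "qsh lam w (\<lambda>v. 0) g = 0"
  using qsh_scale_left[of lam w 0 "\<lambda>v. 0" g] by simp

lemma qsh_sum_left: "qsh lam w (\<lambda>v. \<Sum>i\<in>A. f i v) g = (\<Sum>i\<in>A. qsh lam w (f i) g)"
  by (induction A rule: infinite_finite_induct) (simp_all add: qsh_add_left)

lemma qsh_add_right: "qsh lam w g (\<lambda>v. f v + f' v) = qsh lam w g f + qsh lam w g f'"
  by (simp add: qsh_commute[of lam w g] qsh_add_left)

lemma qsh_scale_right: "qsh lam w g (\<lambda>v. c * f v) = c * qsh lam w g f"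
  by (simp add: qsh_commute[of lam w g] qsh_scale_left)

lemma qsh_sum_right: "qsh lam w g (\<lambda>v. \<Sum>i\<in>A. f i v) = (\<Sum>i\<in>A. qsh lam w g (f i))"
  by (simp add: qsh_commute[of lam w g] qsh_sum_left)

lemma qsh_unit_left: "qsh lam w (\<lambda>v. if v = [] then 1 else 0) g = g w"
  by (induction w arbitrary: g) simp_all

text \<open>Expanding both sides at the first letter gives one term for each of the seven nonempty
  sets of series contributing to it. Only the term in which all three contribute needs a regrouping
  of the splits.\<close>

lemma qsh_assoc: "qsh lam w (\<lambda>v. qsh lam v f g) h = qsh lam w f (\<lambda>v. qsh lam v g h)"
proof (induction w arbitrary: f g h)
  case (Cons m w)
  let ?d = "\<lambda>a f v. f (a # v)"
  have "(\<Sum>(a, b)\<in>splits m. \<Sum>(c, d)\<in>splits a. qsh lam w (?d c f) (\<lambda>v. qsh lam v (?d d g) (?d b h))) =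
      (\<Sum>(a, b)\<in>splits m. \<Sum>(c, d)\<in>splits b. qsh lam w (?d a f) (\<lambda>v. qsh lam v (?d c g) (?d d h)))"
    by (rule sum_splits_assoc)
  then show ?case
    by (simp add: qsh_add_left qsh_add_right qsh_scale_left qsh_scale_right qsh_sum_left qsh_sum_right
        case_prod_beta Cons sum.distrib sum_distrib_left[symmetric] distrib_left)
qed simp

text \<open>The product of A \<otimes> QSh(A): outer monomials multiply in A, the words
  quasi-shuffle. \<open>F m w\<close> is the coefficient of x^m \<otimes> w.\<close>

definition qmult ::
  "'k::field \<Rightarrow> ('i multiset \<Rightarrow> 'i multiset list \<Rightarrow> 'k) \<Rightarrow> ('i multiset \<Rightarrow> 'i multiset list \<Rightarrow> 'k) \<Rightarrow>
    'i multiset \<Rightarrow> 'i multiset list \<Rightarrow> 'k" where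
  "qmult lam F G = (\<lambda>m w. \<Sum>(a, b)\<in>splits m. qsh lam w (F a) (G b))"

definition qshift :: "('i multiset \<Rightarrow> 'i multiset list \<Rightarrow> 'k::zero) \<Rightarrow> 'i multiset list \<Rightarrow> 'k" where
  "qshift F w = (case w of [] \<Rightarrow> 0 | n # v \<Rightarrow> F n v)"

text \<open>Sends x^m \<otimes> w to 1 \<otimes> mw, so the values are supported at the outer
  monomial 1, the empty multiset.\<close>

definition qP :: "('i multiset \<Rightarrow> 'i multiset list \<Rightarrow> 'k::zero) \<Rightarrow> 'i multiset \<Rightarrow> 'i multiset list \<Rightarrow> 'k" where
  "qP F m = (if m = {#} then qshift F else (\<lambda>w. 0))"

definition QSh :: "'k::field \<Rightarrow> ('k, 'i multiset \<Rightarrow> 'i multiset list \<Rightarrow> 'k) rb_struct" where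
  "QSh lam = \<lparr>carrier = UNIV, mult = qmult lam, one = undefined, zero = (\<lambda>m w. 0),
    add = (\<lambda>F G m w. F m w + G m w), smult = (\<lambda>c F m w. c * F m w), rbop = qP\<rparr>"

lemma QSh_simps [simp]:
  "carrier (QSh lam) = UNIV" "F \<otimes>\<^bsub>QSh lam\<^esub> G = qmult lam F G" "\<zero>\<^bsub>QSh lam\<^esub> = (\<lambda>m w. 0)"
  "F \<oplus>\<^bsub>QSh lam\<^esub> G = (\<lambda>m w. F m w + G m w)" "c \<odot>\<^bsub>QSh lam\<^esub> F = (\<lambda>m w. c * F m w)"
  "rbop (QSh lam) = qP"
  by (simp_all add: QSh_def)

lemma qmult_commute: "qmult lam F G = qmult lam G F"
proof (intro ext)
  fix m w
  show "qmult lam F G m w = qmult lam G F m w"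
    using sum_splits_swap[of "\<lambda>a b. qsh lam w (F a) (G b)" m] by (simp add: qmult_def qsh_commute)
qed

lemma qmult_assoc: "qmult lam (qmult lam F G) H = qmult lam F (qmult lam G H)"
proof (intro ext)
  fix m w
  show "qmult lam (qmult lam F G) H m w = qmult lam F (qmult lam G H) m w"
    using sum_splits_assoc[of "\<lambda>a b c. qsh lam w (F a) (\<lambda>v. qsh lam v (G b) (H c))" m]
    by (simp add: qmult_def qsh_sum_left qsh_sum_right case_prod_beta qsh_assoc)
qed

lemma qmult_add_left: "qmult lam (\<lambda>m w. F m w + F' m w) G = (\<lambda>m w. qmult lam F G m w + qmult lam F' G m w)"
  by (simp add: fun_eq_iff qmult_def qsh_add_left case_prod_beta sum.distrib)

lemma qmult_scale_left: "qmult lam (\<lambda>m w. c * F m w) G = (\<lambda>m w. c * qmult lam F G m w)"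
  by (simp add: fun_eq_iff qmult_def qsh_scale_left case_prod_beta sum_distrib_left)

lemma qmult_qP_left: "qmult lam (qP F) G = (\<lambda>m w. qsh lam w (qshift F) (G m))"
proof (intro ext)
  fix m w
  show "qmult lam (qP F) G m w = qsh lam w (qshift F) (G m)"
    unfolding qmult_def by (subst sum_splits_zero_left) (simp_all add: qP_def)
qed

lemma qshift_Cons [simp]: "qshift F [] = 0" "qshift F (m # w) = F m w"
  by (simp_all add: qshift_def)

text \<open>At the outer monomial 1 this is the recursion of \<open>qsh\<close> at the first letter:
  a letter taken from the first factor gives P(F P(G)), one from the second gives P(P(F) G), and a
  merged letter gives the weight term.\<close>

lemma qP_rota_baxter:
  "qmult lam (qP F) (qP G) m w =
    qP (qmult lam (qP F) G) m w + qP (qmult lam F (qP G)) m w + lam * qP (qmult lam F G) m w"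
proof -
  have "qsh lam w (qshift F) (qshift G) = qshift (qmult lam (qP F) G) w +
      qshift (qmult lam F (qP G)) w + lam * qshift (qmult lam F G) w"
  proof (cases w)
    case (Cons n v)
    have "qmult lam F (qP G) n v = qsh lam v (F n) (qshift G)"
      by (simp add: qmult_commute[of lam F] qmult_qP_left qsh_commute)
    with Cons show ?thesis
      by (simp add: qmult_qP_left) (simp add: qmult_def)
  qed simp
  then show ?thesis
    unfolding qmult_qP_left[of lam F "qP G"] by (cases "m = {#}") (simp_all add: qP_def qsh_commute[of lam w "qshift F" "\<lambda>w. 0"])
qed

section \<open>Verification of the axioms for the model and its basis vectors\<close>

lemma vectorspace_classI:
  fixes A :: "('k::field, 'a, 'm) module_scheme"
  assumes "abelian_group A"
    and "\<And>c x. x \<in> carrier A \<Longrightarrow> c \<odot>\<^bsub>A\<^esub> x \<in> carrier A"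
    and "\<And>c d x. x \<in> carrier A \<Longrightarrow> (c + d) \<odot>\<^bsub>A\<^esub> x = c \<odot>\<^bsub>A\<^esub> x \<oplus>\<^bsub>A\<^esub> d \<odot>\<^bsub>A\<^esub> x"
    and "\<And>c x y. x \<in> carrier A \<Longrightarrow> y \<in> carrier A \<Longrightarrow> c \<odot>\<^bsub>A\<^esub> (x \<oplus>\<^bsub>A\<^esub> y) = c \<odot>\<^bsub>A\<^esub> x \<oplus>\<^bsub>A\<^esub> c \<odot>\<^bsub>A\<^esub> y"
    and "\<And>c d x. x \<in> carrier A \<Longrightarrow> (c * d) \<odot>\<^bsub>A\<^esub> x = c \<odot>\<^bsub>A\<^esub> (d \<odot>\<^bsub>A\<^esub> x)"
    and "\<And>x. x \<in> carrier A \<Longrightarrow> 1 \<odot>\<^bsub>A\<^esub> x = x"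
  shows "vectorspace (class_ring :: 'k ring) A"
proof -
  have "cring (class_ring :: 'k ring)"
    by unfold_locales
  then show ?thesis
    using assms class_field by (intro vectorspace.intro moduleI) auto
qed

lemma abelian_group_QSh: "abelian_group (QSh lam)"
proof (rule abelian_groupI)
  fix F
  show "\<exists>G\<in>carrier (QSh lam). G \<oplus>\<^bsub>QSh lam\<^esub> F = \<zero>\<^bsub>QSh lam\<^esub>"
    by (rule bexI[of _ "\<lambda>m w. - F m w"]) simp_all
qed (simp_all add: algebra_simps)

lemma comm_rota_baxter_QSh:
  fixes lam :: "'a::field"
  shows "comm_rota_baxter_algebra lam (QSh lam :: ('a, 'b multiset \<Rightarrow> 'b multiset list \<Rightarrow> 'a) rb_struct)"
proof (intro comm_rota_baxter_algebra.intro rota_baxter_algebra.intro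
    rota_baxter_algebra_axioms.intro comm_rota_baxter_algebra_axioms.intro)
  show "vectorspace class_ring (QSh lam)"
    by (rule vectorspace_classI[OF abelian_group_QSh]) (simp_all add: algebra_simps)
  show "rbop (QSh lam) \<in> LinearCombinations.module_hom class_ring (QSh lam) (QSh lam)"
    by (auto simp: LinearCombinations.module_hom_def qP_def qshift_def fun_eq_iff split: list.split)
  fix F G H :: "'b multiset \<Rightarrow> 'b multiset list \<Rightarrow> 'a" and c :: 'a
  show "F \<otimes>\<^bsub>QSh lam\<^esub> (G \<oplus>\<^bsub>QSh lam\<^esub> H) = F \<otimes>\<^bsub>QSh lam\<^esub> G \<oplus>\<^bsub>QSh lam\<^esub> F \<otimes>\<^bsub>QSh lam\<^esub> H"
    by (simp add: qmult_commute[of lam F] qmult_add_left)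
  show "F \<otimes>\<^bsub>QSh lam\<^esub> (c \<odot>\<^bsub>QSh lam\<^esub> G) = c \<odot>\<^bsub>QSh lam\<^esub> (F \<otimes>\<^bsub>QSh lam\<^esub> G)"
    by (simp add: qmult_commute[of lam F] qmult_scale_left)
  show "F \<otimes>\<^bsub>QSh lam\<^esub> G = G \<otimes>\<^bsub>QSh lam\<^esub> F"
    by (simp add: qmult_commute[of lam F])
qed (simp_all add: fun_eq_iff qmult_assoc qmult_add_left qmult_scale_left qP_rota_baxter)

definition qdelta :: "'i multiset \<Rightarrow> 'i multiset list \<Rightarrow> 'i multiset \<Rightarrow> 'i multiset list \<Rightarrow> 'k::zero_neq_one" where
  "qdelta m w = (\<lambda>m' w'. if m' = m \<and> w' = w then 1 else 0)"

lemma qP_qdelta: "qP (qdelta m w) = qdelta {#} (m # w)"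
  by (auto simp: fun_eq_iff qP_def qshift_def qdelta_def split: list.split)

text \<open>Quasi-shuffling with the empty word changes nothing, so only the outer monomials are
  multiplied.\<close>

lemma qmult_qdelta: "qmult lam (qdelta m []) (qdelta n w) = qdelta (m + n) w"
proof (intro ext)
  fix m' w'
  have "qsh lam w' (qdelta m [] a) (qdelta n w b) = (if (a, b) = (m, n) \<and> w' = w then 1 else 0)" for a b
    by (cases "a = m") (auto simp: qdelta_def qsh_unit_left)
  then have "qmult lam (qdelta m []) (qdelta n w) m' w' = (\<Sum>x\<in>splits m'. if x = (m, n) then if w' = w then 1 else 0 else 0)"
    unfolding qmult_def by (intro sum.cong) (auto split: prod.splits)
  then show "qmult lam (qdelta m []) (qdelta n w) m' w' = qdelta (m + n) w m' w'"
    by (simp add: qdelta_def) (auto simp: splits_def)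
qed


subsection \<open>The evaluation homomorphism\<close>

lemma RB_mult_closed:
  assumes "f \<in> carrier (RB lam)" "g \<in> carrier (RB lam)"
  shows "f \<otimes>\<^bsub>RB lam\<^esub> g \<in> carrier (RB lam)"
  unfolding RB_simps mem_Collect_eq
  by (intro keys_lin_ext_subset word_mult_closed) (use assms in auto)

lemma P_ext_closed: "f \<in> carrier (RB lam) \<Longrightarrow> P_ext f \<in> carrier (RB lam)"
  by (auto dest!: keys_P_ext[THEN subsetD])

lemma vectorspace_RB: "vectorspace class_ring (RB lam)"
proof (rule vectorspace_classI)
  show "abelian_group (RB lam)"
  proof (rule abelian_groupI)
    fix f
    assume "f \<in> carrier (RB lam)"
    then show "\<exists>g\<in>carrier (RB lam). g \<oplus>\<^bsub>RB lam\<^esub> f = \<zero>\<^bsub>RB lam\<^esub>"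
      by (intro bexI[of _ "- f"]) simp_all
  qed (simp_all add: add.assoc add.commute keys_add_subset)
qed (simp_all add: pm_scale_add pm_scale_add_left keys_pm_scale_subset)

lemma mult_RB_linear:
  "(f + f') \<otimes>\<^bsub>RB lam\<^esub> g = f \<otimes>\<^bsub>RB lam\<^esub> g + f' \<otimes>\<^bsub>RB lam\<^esub> g"
  "f \<otimes>\<^bsub>RB lam\<^esub> (g + g') = f \<otimes>\<^bsub>RB lam\<^esub> g + f \<otimes>\<^bsub>RB lam\<^esub> g'"
  "(f - f') \<otimes>\<^bsub>RB lam\<^esub> g = f \<otimes>\<^bsub>RB lam\<^esub> g - f' \<otimes>\<^bsub>RB lam\<^esub> g"
  "f \<otimes>\<^bsub>RB lam\<^esub> (g - g') = f \<otimes>\<^bsub>RB lam\<^esub> g - f \<otimes>\<^bsub>RB lam\<^esub> g'"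
  "pm_scale c f \<otimes>\<^bsub>RB lam\<^esub> g = pm_scale c (f \<otimes>\<^bsub>RB lam\<^esub> g)"
  "f \<otimes>\<^bsub>RB lam\<^esub> pm_scale c g = pm_scale c (f \<otimes>\<^bsub>RB lam\<^esub> g)"
  by (simp_all add: lin_ext_add lin_ext_diff lin_ext_scale lin_ext_fun_add lin_ext_fun_diff lin_ext_fun_scale)

lemma mult_RB_mon: "mon u \<otimes>\<^bsub>RB lam\<^esub> mon v = word_mult lam u v"
  by simp

section \<open>Linear maps out of RB(X) and evaluation in an arbitrary Rota-Baxter algebra\<close>

abbreviation class_hom where
  "class_hom A B \<equiv> LinearCombinations.module_hom class_ring A B"

lemma class_homI:
  assumes "\<And>x. x \<in> carrier A \<Longrightarrow> h x \<in> carrier B"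
    and "\<And>x y. x \<in> carrier A \<Longrightarrow> y \<in> carrier A \<Longrightarrow> h (x \<oplus>\<^bsub>A\<^esub> y) = h x \<oplus>\<^bsub>B\<^esub> h y"
    and "\<And>c x. x \<in> carrier A \<Longrightarrow> h (c \<odot>\<^bsub>A\<^esub> x) = c \<odot>\<^bsub>B\<^esub> h x"
  shows "h \<in> class_hom A B"
  using assms by (auto simp: LinearCombinations.module_hom_def)

lemma class_homD:
  assumes "h \<in> class_hom A B" "x \<in> carrier A"
  shows "h x \<in> carrier B"
    and "y \<in> carrier A \<Longrightarrow> h (x \<oplus>\<^bsub>A\<^esub> y) = h x \<oplus>\<^bsub>B\<^esub> h y"
    and "h (c \<odot>\<^bsub>A\<^esub> x) = c \<odot>\<^bsub>B\<^esub> h x"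
  using assms by (auto simp: LinearCombinations.module_hom_def)

lemma class_hom_compose:
  assumes "h \<in> class_hom A B" "g \<in> class_hom B C"
  shows "(\<lambda>x. g (h x)) \<in> class_hom A C"
  using assms by (auto simp: LinearCombinations.module_hom_def Pi_iff)

lemma lin_ext_class_hom:
  fixes F :: "'x rb_word \<Rightarrow> 'y rb_word \<Rightarrow>\<^sub>0 'k::field"
  assumes "\<And>w. w \<in> Phi \<Longrightarrow> Poly_Mapping.keys (F w) \<subseteq> Phi"
  shows "lin_ext F \<in> class_hom (RB lam) (RB lam)"
proof (rule class_homI)
  fix f :: "'x rb_word \<Rightarrow>\<^sub>0 'k"
  assume "f \<in> carrier (RB lam)"
  then show "lin_ext F f \<in> carrier (RB lam)"
    unfolding RB_simps mem_Collect_eq by (intro keys_lin_ext_subset assms) auto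
qed (simp_all add: lin_ext_add lin_ext_scale)

lemma class_smult:
  fixes V :: "('k::field, 'a, 'm) module_scheme"
  assumes "vectorspace class_ring V" "x \<in> carrier V"
  shows "c \<odot>\<^bsub>V\<^esub> x \<in> carrier V" "0 \<odot>\<^bsub>V\<^esub> x = \<zero>\<^bsub>V\<^esub>" "1 \<odot>\<^bsub>V\<^esub> x = x"
    "(c * d) \<odot>\<^bsub>V\<^esub> x = c \<odot>\<^bsub>V\<^esub> (d \<odot>\<^bsub>V\<^esub> x)" "(c + d) \<odot>\<^bsub>V\<^esub> x = c \<odot>\<^bsub>V\<^esub> x \<oplus>\<^bsub>V\<^esub> d \<odot>\<^bsub>V\<^esub> x"
proof -
  interpret vectorspace class_ring V by fact
  show "c \<odot>\<^bsub>V\<^esub> x \<in> carrier V" "0 \<odot>\<^bsub>V\<^esub> x = \<zero>\<^bsub>V\<^esub>" "1 \<odot>\<^bsub>V\<^esub> x = x"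
    "(c * d) \<odot>\<^bsub>V\<^esub> x = c \<odot>\<^bsub>V\<^esub> (d \<odot>\<^bsub>V\<^esub> x)" "(c + d) \<odot>\<^bsub>V\<^esub> x = c \<odot>\<^bsub>V\<^esub> x \<oplus>\<^bsub>V\<^esub> d \<odot>\<^bsub>V\<^esub> x"
    using smult_closed[of c x] smult_l_null[of x] smult_one[of x] smult_assoc1[of c d x]
      smult_l_distr[of c d x] assms(2) by simp_all
qed

text \<open>Reduces every identity between linear maps on RB(X) to single words; the homomorphism
  properties of evaluation and the uniqueness of maps out of the quotient rest on it.\<close>

lemma class_hom_RB_eq:
  fixes lam :: "'k::field" and h h' :: "('x rb_word \<Rightarrow>\<^sub>0 'k) \<Rightarrow> 'a"
  assumes "vectorspace class_ring B" "h \<in> class_hom (RB lam) B" "h' \<in> class_hom (RB lam) B"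
    and eq: "\<And>w. w \<in> Phi \<Longrightarrow> h (mon w) = h' (mon w)"
    and f: "f \<in> carrier (RB lam)"
  shows "h f = h' f"
proof -
  interpret vectorspace class_ring B by fact
  have "h (\<Sum>w\<in>S. pm_scale (Poly_Mapping.lookup f w) (mon w)) =
      h' (\<Sum>w\<in>S. pm_scale (Poly_Mapping.lookup f w) (mon w))" if "S \<subseteq> Poly_Mapping.keys f" for S
    using finite_subset[OF that finite_keys] that
  proof (induction S rule: finite_induct)
    case empty
    have "g 0 = \<zero>\<^bsub>B\<^esub>" if g: "g \<in> class_hom (RB lam) B" for g :: "('x rb_word \<Rightarrow>\<^sub>0 'k) \<Rightarrow> 'a"
      using class_homD(1)[OF g, of 0] class_homD(3)[OF g, of 0 0] class_smult(2)[OF assms(1)] by simp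
    from this[OF assms(2)] this[OF assms(3)] show ?case by simp
  next
    case (insert w S)
    have w: "mon w \<in> carrier (RB lam)" "pm_scale (Poly_Mapping.lookup f w) (mon w) \<in> carrier (RB lam)"
      and S: "(\<Sum>w\<in>S. pm_scale (Poly_Mapping.lookup f w) (mon w)) \<in> carrier (RB lam)"
      using insert.prems f by (auto split: if_splits dest!: keys_sum[THEN subsetD])
    have step: "g (\<Sum>w\<in>insert w S. pm_scale (Poly_Mapping.lookup f w) (mon w)) =
        Poly_Mapping.lookup f w \<odot>\<^bsub>B\<^esub> g (mon w) \<oplus>\<^bsub>B\<^esub>
          g (\<Sum>w\<in>S. pm_scale (Poly_Mapping.lookup f w) (mon w))"
      if g: "g \<in> class_hom (RB lam) B" for g :: "('x rb_word \<Rightarrow>\<^sub>0 'k) \<Rightarrow> 'a"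
      using insert.hyps class_homD(2)[OF g w(2) S] class_homD(3)[OF g w(1)]
      by (simp del: pm_scale_single)
    have "w \<in> Phi"
      using w(1) by simp
    then show ?case
      unfolding step[OF assms(2)] step[OF assms(3)] using insert eq[of w] by simp
  qed
  from this[of "Poly_Mapping.keys f"] show ?thesis
    using lin_ext_mon[of f] by (simp add: lin_ext_def del: lin_ext_mon)
qed

context rota_baxter_algebra
begin

lemma rbop_closed [simp]: "x \<in> carrier A \<Longrightarrow> rbop A x \<in> carrier A"
  using class_homD(1)[OF rbop_linear] .

lemma rbop_add: "x \<in> carrier A \<Longrightarrow> y \<in> carrier A \<Longrightarrow> rbop A (x \<oplus> y) = rbop A x \<oplus> rbop A y"
  using class_homD(2)[OF rbop_linear] .

lemma rbop_smult: "x \<in> carrier A \<Longrightarrow> rbop A (c \<odot>\<^bsub>A\<^esub> x) = c \<odot>\<^bsub>A\<^esub> rbop A x"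
  using class_homD(3)[OF rbop_linear] .

lemmas smult_simps = class_smult[OF vectorspace_axioms]

text \<open>The linear extension of \<open>eval_word\<close>; the target is a record with a carrier,
  so its own \<open>finsum\<close> takes the place of \<open>lin_ext\<close>.\<close>

definition eval_pm :: "('x \<Rightarrow> 'a) \<Rightarrow> ('x rb_word \<Rightarrow>\<^sub>0 'k) \<Rightarrow> 'a" where
  "eval_pm \<theta> f = (\<Oplus>\<^bsub>A\<^esub>w\<in>Poly_Mapping.keys f. Poly_Mapping.lookup f w \<odot>\<^bsub>A\<^esub> eval_word A \<theta> w)"

context
  fixes \<theta> :: "'x \<Rightarrow> 'a"
  assumes \<theta>: "\<And>x. \<theta> x \<in> carrier A"
begin

lemma eval_closed:
  fixes p :: "'x prime_word" and w :: "'x rb_word"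
  shows "[p] \<in> Phi \<Longrightarrow> eval_prime A \<theta> p \<in> carrier A" "w \<in> Phi \<Longrightarrow> eval_word A \<theta> w \<in> carrier A"
proof (induction p and w rule: word_induct)
  case (Cons p w)
  then show ?case
    using Phi_Cons_iff[of p w] by (auto intro: mult_closed)
qed (auto simp: \<theta>)

lemma eval_append:
  "u \<in> Phi \<Longrightarrow> v \<in> Phi \<Longrightarrow> eval_word A \<theta> (u @ v) = eval_word A \<theta> u \<otimes>\<^bsub>A\<^esub> eval_word A \<theta> v"
proof (induction u)
  case (Cons p u)
  then have "[p] \<in> Phi" "u \<noteq> [] \<Longrightarrow> u \<in> Phi" "v \<noteq> []"
    using Phi_Cons_iff[of p u] by auto
  with Cons show ?case
    by (cases "u = []") (simp_all add: eval_closed mult_assoc)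
qed simp

lemma eval_pm_superset:
  assumes "finite S" "Poly_Mapping.keys f \<subseteq> S" "S \<subseteq> Phi"
  shows "eval_pm \<theta> f = (\<Oplus>\<^bsub>A\<^esub>w\<in>S. Poly_Mapping.lookup f w \<odot>\<^bsub>A\<^esub> eval_word A \<theta> w)"
  unfolding eval_pm_def
proof (rule add.finprod_mono_neutral_cong_left)
  show "\<And>w. w \<in> S - Poly_Mapping.keys f \<Longrightarrow>
      Poly_Mapping.lookup f w \<odot>\<^bsub>A\<^esub> eval_word A \<theta> w = \<zero>\<^bsub>A\<^esub>"
    using assms(3) by (auto simp: in_keys_iff eval_closed smult_simps subset_iff)
qed (use assms in \<open>auto intro!: eval_closed simp: smult_simps\<close>)

lemma eval_pm_class_hom: "eval_pm \<theta> \<in> class_hom (RB lam) A"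
proof (rule class_homI)
  fix f :: "'x rb_word \<Rightarrow>\<^sub>0 'k"
  assume f: "f \<in> carrier (RB lam)"
  then show "eval_pm \<theta> f \<in> carrier A"
    unfolding eval_pm_def by (intro finsum_closed) (auto intro!: eval_closed simp: smult_simps)
  have closed [simp]: "eval_word A \<theta> w \<in> carrier A" if "w \<in> Poly_Mapping.keys f" for w
    using that f by (auto intro!: eval_closed)
  fix c
  have "eval_pm \<theta> (pm_scale c f) = (\<Oplus>\<^bsub>A\<^esub>w\<in>Poly_Mapping.keys f. c \<odot>\<^bsub>A\<^esub> (Poly_Mapping.lookup f w \<odot>\<^bsub>A\<^esub> eval_word A \<theta> w))"
    using f by (subst eval_pm_superset[of "Poly_Mapping.keys f"])
      (auto intro!: finsum_cong' simp: smult_simps dest: keys_pm_scale[THEN subsetD])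
  also have "\<dots> = c \<odot>\<^bsub>A\<^esub> eval_pm \<theta> f"
    unfolding eval_pm_def by (rule finsum_smult[symmetric]) (use f in \<open>auto intro!: eval_closed simp: smult_simps\<close>)
  finally show "eval_pm \<theta> (c \<odot>\<^bsub>RB lam\<^esub> f) = c \<odot>\<^bsub>A\<^esub> eval_pm \<theta> f"
    by simp
next
  fix f g :: "'x rb_word \<Rightarrow>\<^sub>0 'k"
  assume fg: "f \<in> carrier (RB lam)" "g \<in> carrier (RB lam)"
  let ?S = "Poly_Mapping.keys f \<union> Poly_Mapping.keys g"
  have S: "?S \<subseteq> Phi"
    using fg by auto
  then have [simp]: "eval_word A \<theta> w \<in> carrier A" if "w \<in> Poly_Mapping.keys f \<or> w \<in> Poly_Mapping.keys g" for w
    using that by (auto intro!: eval_closed)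
  have "eval_pm \<theta> (f + g) = (\<Oplus>\<^bsub>A\<^esub>w\<in>?S. Poly_Mapping.lookup f w \<odot>\<^bsub>A\<^esub> eval_word A \<theta> w \<oplus>
      Poly_Mapping.lookup g w \<odot>\<^bsub>A\<^esub> eval_word A \<theta> w)"
    using S keys_add[of f g] by (subst eval_pm_superset[of ?S], simp, simp, simp)
      (rule finsum_cong', auto simp: lookup_add smult_simps simp del: finsum_addf)
  also have "\<dots> = eval_pm \<theta> f \<oplus> eval_pm \<theta> g"
    using S by (subst (1 2) eval_pm_superset[of ?S]) (auto intro!: finsum_addf simp: smult_simps)
  finally show "eval_pm \<theta> (f \<oplus>\<^bsub>RB lam\<^esub> g) = eval_pm \<theta> f \<oplus> eval_pm \<theta> g"
    by simp
qed

lemma eval_pm_mon [simp]: "w \<in> Phi \<Longrightarrow> eval_pm \<theta> (mon w) = eval_word A \<theta> w"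
  by (simp add: eval_pm_def eval_closed smult_simps)

lemma eval_pm_P_ext:
  assumes "f \<in> carrier (RB lam)"
  shows "eval_pm \<theta> (P_ext f) = rbop A (eval_pm \<theta> f)"
proof (rule class_hom_RB_eq[OF _ _ _ _ assms])
  show "vectorspace class_ring A" ..
  show "(\<lambda>f. eval_pm \<theta> (P_ext f)) \<in> class_hom (RB lam) A"
    unfolding P_ext_def by (intro class_hom_compose[OF lin_ext_class_hom eval_pm_class_hom]) auto
  show "(\<lambda>f. rbop A (eval_pm \<theta> f)) \<in> class_hom (RB lam) A"
    by (rule class_hom_compose[OF eval_pm_class_hom rbop_linear])
qed simp

text \<open>The right-hand side is the counterpart of \<open>sandwich\<close> in \<open>A\<close>,
  again with empty contexts left out. Both sides are linear in \<open>f\<close>, so a single word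
  suffices, and for it the claim is \<open>eval_append\<close>.\<close>

lemma eval_pm_context:
  assumes "f \<in> carrier (RB lam)" "b @ Op u # c \<in> Phi"
  shows "eval_pm \<theta> (lin_ext (\<lambda>w. mon (b @ Op w # c)) f) =
    (let y = (if c = [] then rbop A (eval_pm \<theta> f) else rbop A (eval_pm \<theta> f) \<otimes>\<^bsub>A\<^esub> eval_word A \<theta> c)
     in if b = [] then y else eval_word A \<theta> b \<otimes>\<^bsub>A\<^esub> y)" (is "_ = ?C (rbop A (eval_pm \<theta> f))")
proof -
  note bc = Phi_split[OF assms(2)]
  have C: "?C \<in> class_hom A A"
    using bc eval_closed by (intro class_homI)
      (auto simp: Let_def mult_closed mult_add_left mult_add_right mult_smult_left mult_smult_right)
  have Phi: "b @ Op w # c \<in> Phi" if "w \<in> Phi" for w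
    using Phi_context[OF assms(2), of "Op w"] that by simp
  show ?thesis
  proof (rule class_hom_RB_eq[OF _ _ _ _ assms(1), where h' = "\<lambda>f. ?C (rbop A (eval_pm \<theta> f))"])
    show "vectorspace class_ring A" ..
    show "(\<lambda>f. eval_pm \<theta> (lin_ext (\<lambda>w. mon (b @ Op w # c)) f)) \<in> class_hom (RB lam) A"
      by (intro class_hom_compose[OF lin_ext_class_hom eval_pm_class_hom]) (simp add: Phi)
    show "(\<lambda>f. ?C (rbop A (eval_pm \<theta> f))) \<in> class_hom (RB lam) A"
      by (intro class_hom_compose[OF class_hom_compose[OF eval_pm_class_hom rbop_linear] C])
    fix w :: "'x rb_word"
    assume w: "w \<in> Phi"
    have "Op w # c \<in> Phi"
      using Phi[OF w] by (cases "b = []") (auto simp: Phi_append_iff)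
    with w bc Phi[OF w] show "eval_pm \<theta> (lin_ext (\<lambda>w. mon (b @ Op w # c)) (mon w)) =
        ?C (rbop A (eval_pm \<theta> (mon w)))"
      by (cases "b = []") (auto simp: Let_def eval_append)
  qed
qed

text \<open>At a collision the induction hypotheses evaluate the three products in
  \<open>op_mult\<close>, and the Rota-Baxter identity of \<open>A\<close> reassembles them into a
  product of two values of \<open>P\<close>.\<close>

lemma eval_word_mult:
  "u \<in> Phi \<Longrightarrow> v \<in> Phi \<Longrightarrow> eval_pm \<theta> (word_mult lam u v) = eval_word A \<theta> u \<otimes>\<^bsub>A\<^esub> eval_word A \<theta> v"
proof (induction u v rule: word_mult_induct)
  case (concat u v)
  then have "u @ v \<in> Phi" by (simp add: Phi_append_iff)
  with concat show ?case
    by (simp add: word_mult_concat eval_append)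
next
  case (collide b u v c)
  have u: "u \<in> Phi" and b: "b = [] \<or> b \<in> Phi" and v: "v \<in> Phi" and c: "c = [] \<or> c \<in> Phi"
    using Phi_split[of b "Op u" "[]"] Phi_split[of "[]" "Op v" c] collide.prems by auto
  have "Op v # c \<in> Phi \<Longrightarrow> Op u # c \<in> Phi"
    using Phi_context[of "[]" "Op v" c "Op u"] u by simp
  then have bc: "b @ Op u # c \<in> Phi"
    using collide.prems b by (cases "b = []") (auto simp: Phi_append_iff)
  let ?e = "eval_word A \<theta>" and ?p = "\<lambda>w. rbop A (eval_word A \<theta> w)"
  have closed: "?e u \<in> carrier A" "?e v \<in> carrier A"
    using u v eval_closed by auto
  have uv: "word_mult lam [Op u] v \<in> carrier (RB lam)" "word_mult lam u [Op v] \<in> carrier (RB lam)"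
    "word_mult lam u v \<in> carrier (RB lam)"
    using word_mult_closed[of "[Op u]" v lam] word_mult_closed[of u "[Op v]" lam] word_mult_closed[of u v lam] u v by simp_all
  then have op: "op_mult lam u v \<in> carrier (RB lam)"
    unfolding op_mult_def using keys_add_subset keys_pm_scale_subset by (metis (no_types, lifting) RB_simps(1) mem_Collect_eq)
  have "eval_pm \<theta> (op_mult lam u v) =
      ?p u \<otimes>\<^bsub>A\<^esub> ?e v \<oplus> ?e u \<otimes>\<^bsub>A\<^esub> ?p v \<oplus> lam \<odot>\<^bsub>A\<^esub> (?e u \<otimes>\<^bsub>A\<^esub> ?e v)"
  proof -
    have "pm_scale lam (word_mult lam u v) \<in> carrier (RB lam)"
      "word_mult lam [Op u] v + word_mult lam u [Op v] \<in> carrier (RB lam)"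
      using uv keys_add_subset keys_pm_scale_subset by (metis (no_types, lifting) RB_simps(1) mem_Collect_eq)+
    then show ?thesis
      using uv u v collide.IH class_homD(2)[OF eval_pm_class_hom] class_homD(3)[OF eval_pm_class_hom uv(3)]
      by (simp add: op_mult_def)
  qed
  then have "rbop A (eval_pm \<theta> (op_mult lam u v)) = ?p u \<otimes>\<^bsub>A\<^esub> ?p v"
    using closed by (simp add: rota_baxter rbop_add rbop_smult mult_closed)
  then have "eval_pm \<theta> (word_mult lam (b @ [Op u]) (Op v # c)) =
    (let y = (if c = [] then ?p u \<otimes>\<^bsub>A\<^esub> ?p v else (?p u \<otimes>\<^bsub>A\<^esub> ?p v) \<otimes>\<^bsub>A\<^esub> ?e c)
     in if b = [] then y else ?e b \<otimes>\<^bsub>A\<^esub> y)"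
    unfolding word_mult_Op eval_pm_context[OF op bc] by simp
  also have "\<dots> = ?e (b @ [Op u]) \<otimes>\<^bsub>A\<^esub> ?e (Op v # c)"
    using b c closed u eval_closed(2) by (auto simp: Let_def eval_append mult_assoc mult_closed)
  finally show ?case .
qed auto

lemma eval_pm_mult:
  assumes f: "f \<in> carrier (RB lam)" and g: "g \<in> carrier (RB lam)"
  shows "eval_pm \<theta> (f \<otimes>\<^bsub>RB lam\<^esub> g) = eval_pm \<theta> f \<otimes>\<^bsub>A\<^esub> eval_pm \<theta> g"
proof -
  have V: "vectorspace class_ring A" ..
  have closed: "eval_pm \<theta> h \<in> carrier A" if "h \<in> carrier (RB lam)" for h
    using class_homD(1)[OF eval_pm_class_hom that] .
  have left: "(\<lambda>h. eval_pm \<theta> h \<otimes>\<^bsub>A\<^esub> x) \<in> class_hom (RB lam) A" if "x \<in> carrier A" for x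
    using that closed class_homD(2,3)[OF eval_pm_class_hom]
    by (intro class_homI) (auto simp del: RB_simps simp: mult_closed mult_add_left mult_smult_left)
  have right: "(\<lambda>h. x \<otimes>\<^bsub>A\<^esub> eval_pm \<theta> h) \<in> class_hom (RB lam) A" if "x \<in> carrier A" for x
    using that closed class_homD(2,3)[OF eval_pm_class_hom]
    by (intro class_homI) (auto simp del: RB_simps simp: mult_closed mult_add_right mult_smult_right)
  have "eval_pm \<theta> (mon u \<otimes>\<^bsub>RB lam\<^esub> g) = eval_pm \<theta> (mon u) \<otimes>\<^bsub>A\<^esub> eval_pm \<theta> g" if u: "u \<in> Phi" for u
  proof (rule class_hom_RB_eq[OF V _ _ _ g])
    show "(\<lambda>g. eval_pm \<theta> (mon u \<otimes>\<^bsub>RB lam\<^esub> g)) \<in> class_hom (RB lam) A"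
      using class_hom_compose[OF lin_ext_class_hom eval_pm_class_hom, of "word_mult lam u"] word_mult_closed[OF u, where lam = lam]
      by simp
    show "(\<lambda>g. eval_pm \<theta> (mon u) \<otimes>\<^bsub>A\<^esub> eval_pm \<theta> g) \<in> class_hom (RB lam) A"
      using u by (intro right closed) simp
  qed (simp add: u eval_word_mult)
  moreover have "(\<lambda>f. eval_pm \<theta> (f \<otimes>\<^bsub>RB lam\<^esub> g)) \<in> class_hom (RB lam) A"
    using class_hom_compose[OF lin_ext_class_hom eval_pm_class_hom, of "\<lambda>u. lin_ext (word_mult lam u) g"]
      RB_mult_closed[of "mon _" lam g] g by simp
  ultimately show ?thesis
    using class_hom_RB_eq[OF V _ left[OF closed[OF g]] _ f, of "\<lambda>f. eval_pm \<theta> (f \<otimes>\<^bsub>RB lam\<^esub> g)"] by simp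
qed

lemma eval_pm_rb_hom: "eval_pm \<theta> \<in> rb_hom (RB lam) A"
  unfolding rb_hom_def using eval_pm_class_hom eval_pm_mult eval_pm_P_ext by (simp del: RB_simps(1,2))

end

end


subsection \<open>The commutativity ideal\<close>

lemma module_RB: "module class_ring (RB lam)"
  using vectorspace_RB by (rule vectorspace.axioms)

lemma rb_ideal_RB_iff:
  "rb_ideal (RB lam) I \<longleftrightarrow> I \<subseteq> carrier (RB lam) \<and> 0 \<in> I \<and> (\<forall>f\<in>I. \<forall>g\<in>I. f + g \<in> I) \<and>
    (\<forall>c. \<forall>f\<in>I. pm_scale c f \<in> I) \<and>
    (\<forall>a\<in>carrier (RB lam). \<forall>f\<in>I. a \<otimes>\<^bsub>RB lam\<^esub> f \<in> I \<and> f \<otimes>\<^bsub>RB lam\<^esub> a \<in> I) \<and> (\<forall>f\<in>I. P_ext f \<in> I)"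
  by (auto simp: rb_ideal_def LinearCombinations.submodule_def module_RB simp del: RB_simps(1,2))

lemma rb_ideal_carrier: "rb_ideal (RB lam) (carrier (RB lam))"
  unfolding rb_ideal_RB_iff
  by (intro conjI ballI allI; (rule RB_mult_closed P_ext_closed; assumption)?)
    (simp_all add: keys_add_subset keys_pm_scale_subset)

lemma comm_rels_carrier: "comm_rels \<subseteq> carrier (RB lam)"
proof
  fix s :: "'a rb_word \<Rightarrow>\<^sub>0 'b"
  assume "s \<in> comm_rels"
  then obtain p i where s: "s = mon [p, Gen i] - mon [Gen i, p]" and "[p] \<in> Phi"
    by (auto elim!: comm_rels_cases)
  then have "[p, Gen i] \<in> Phi" "[Gen i, p] \<in> Phi"
    using Phi_Cons_iff[of p "[Gen i]"] Phi_Cons_iff[of "Gen i" "[p]"] by auto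
  then show "s \<in> carrier (RB lam)"
    unfolding s RB_simps mem_Collect_eq by (intro keys_diff_subset) auto
qed

text \<open>The member \<open>J\<close> keeps the intersection inside the carrier; the empty family
  would give the whole type.\<close>

lemma rb_ideal_Inter:
  assumes F: "\<And>I. I \<in> F \<Longrightarrow> rb_ideal (RB lam) I" and J: "J \<in> F"
  shows "rb_ideal (RB lam) (\<Inter>F)"
  unfolding rb_ideal_RB_iff
proof (intro conjI ballI allI)
  show "\<Inter>F \<subseteq> carrier (RB lam)"
    using F[OF J] Inter_lower[OF J] by (meson rb_ideal_RB_iff order.trans)
  note * = F[unfolded rb_ideal_RB_iff]
  show "0 \<in> \<Inter>F"
    using * by blast
  fix f c
  assume f: "f \<in> \<Inter>F"
  show "pm_scale c f \<in> \<Inter>F" "P_ext f \<in> \<Inter>F"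
    using * f by blast+
  fix g
  show "g \<in> \<Inter>F \<Longrightarrow> f + g \<in> \<Inter>F"
    using * f by blast
  assume "g \<in> carrier (RB lam)"
  then show "g \<otimes>\<^bsub>RB lam\<^esub> f \<in> \<Inter>F" "f \<otimes>\<^bsub>RB lam\<^esub> g \<in> \<Inter>F"
    using * f by blast+
qed

lemma rb_ideal_comm_ideal: "rb_ideal (RB lam) (comm_ideal lam)"
  unfolding comm_ideal_def rb_ideal_gen_def
  by (rule rb_ideal_Inter[of _ _ "carrier (RB lam)"]) (use rb_ideal_carrier comm_rels_carrier in auto)

lemma comm_rels_subset_ideal: "comm_rels \<subseteq> comm_ideal lam"
  by (auto simp: comm_ideal_def rb_ideal_gen_def)

lemma comm_ideal_least: "rb_ideal (RB lam) I \<Longrightarrow> comm_rels \<subseteq> I \<Longrightarrow> comm_ideal lam \<subseteq> I"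
  by (auto simp: comm_ideal_def rb_ideal_gen_def)

context
  fixes lam :: "'k::field"
begin

lemma
  shows comm_ideal_carrier: "f \<in> comm_ideal lam \<Longrightarrow> f \<in> carrier (RB lam)"
    and comm_ideal_0: "0 \<in> comm_ideal lam"
    and comm_ideal_add: "f \<in> comm_ideal lam \<Longrightarrow> g \<in> comm_ideal lam \<Longrightarrow> f + g \<in> comm_ideal lam"
    and comm_ideal_scale: "f \<in> comm_ideal lam \<Longrightarrow> pm_scale c f \<in> comm_ideal lam"
    and comm_ideal_P_ext: "f \<in> comm_ideal lam \<Longrightarrow> P_ext f \<in> comm_ideal lam"
    and comm_ideal_mult_left: "a \<in> carrier (RB lam) \<Longrightarrow> f \<in> comm_ideal lam \<Longrightarrow> a \<otimes>\<^bsub>RB lam\<^esub> f \<in> comm_ideal lam"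
    and comm_ideal_mult_right: "a \<in> carrier (RB lam) \<Longrightarrow> f \<in> comm_ideal lam \<Longrightarrow> f \<otimes>\<^bsub>RB lam\<^esub> a \<in> comm_ideal lam"
  using rb_ideal_comm_ideal[of lam] unfolding rb_ideal_RB_iff by blast+

lemma comm_ideal_uminus: "f \<in> comm_ideal lam \<Longrightarrow> - f \<in> comm_ideal lam"
  using comm_ideal_scale[of f "- 1"] by (simp add: pm_scale_minus_one)

lemma comm_ideal_sandwich:
  assumes "f \<in> comm_ideal lam" "b = [] \<or> b \<in> Phi" "c = [] \<or> c \<in> Phi"
  shows "sandwich lam b f c \<in> comm_ideal lam"
  using comm_ideal_mult_left[of "mon b"] comm_ideal_mult_right[of "mon c" f] assms
  by (cases "b = []"; cases "c = []") (auto simp: sandwich_def)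

abbreviation cong :: "('x::linorder rb_word \<Rightarrow>\<^sub>0 'k) \<Rightarrow> ('x rb_word \<Rightarrow>\<^sub>0 'k) \<Rightarrow> bool" where
  "cong f g \<equiv> f - g \<in> comm_ideal lam"

lemma cong_refl: "cong f f"
  by (simp add: comm_ideal_0)

lemma cong_trans: "cong f g \<Longrightarrow> cong g h \<Longrightarrow> cong f h"
  using comm_ideal_add[of "f - g" "g - h"] by simp

lemma cong_sym: "cong f g \<Longrightarrow> cong g f"
  using comm_ideal_uminus[of "f - g"] by simp

text \<open>Up to sign and up to the trivial case of equal generators, the exchange is a relation.
  With both words in \<open>Phi\<close>, the surrounding products are concatenations.\<close>

lemma cong_swap:
  assumes "b @ p # Gen i # c \<in> Phi" "b @ Gen i # p # c \<in> Phi"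
  shows "cong (mon (b @ p # Gen i # c)) (mon (b @ Gen i # p # c))"
proof -
  note Phi = Phi_split[OF assms(1)]
  have bc: "b = [] \<or> b \<in> Phi" "c = [] \<or> c \<in> Phi" "[p] \<in> Phi"
    using Phi Phi_split[of "[]" "Gen i" c] by auto
  have "cong (mon [p, Gen i]) (mon [Gen i, p])"
  proof (cases p)
    case (Gen j)
    consider "i < j" | "i = j" | "j < i" by fastforce
    then show ?thesis
    proof cases
      case 1
      then show ?thesis
        using Gen by (intro subsetD[OF comm_rels_subset_ideal]) (auto simp: comm_rels_def)
    next
      case 3
      then have "cong (mon [Gen i, p]) (mon [p, Gen i])"
        using Gen by (intro subsetD[OF comm_rels_subset_ideal]) (auto simp: comm_rels_def)
      then show ?thesis by (rule cong_sym)
    qed (simp add: Gen comm_ideal_0)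
  next
    case (Op u)
    then show ?thesis
      using bc(3) by (intro subsetD[OF comm_rels_subset_ideal]) (auto simp: comm_rels_def)
  qed
  from comm_ideal_sandwich[OF this bc(1,2)] show ?thesis
    using assms sandwich_concat[of b "[p, Gen i]" c lam] sandwich_concat[of b "[Gen i, p]" c lam]
    by (simp add: sandwich_diff)
qed

lemma map_Gen_append_in_Phi:
  assumes "t = [] \<or> (\<exists>z\<in>Phi. t = [Op z])" "xs \<noteq> [] \<or> t \<noteq> []"
  shows "map Gen xs @ t \<in> Phi"
  using assms by (cases "xs = []"; cases "t = []") (auto simp: Phi_append_iff last_map)

text \<open>The generator \<open>x\<close> moves to its place by neighbouring exchanges;
  \<open>c\<close> collects what it has passed, and \<open>t\<close> is the optional final
  \<open>P\<close> factor.\<close>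

lemma cong_insort:
  assumes "t = [] \<or> (\<exists>z\<in>Phi. t = [Op z])"
  shows "cong (mon (map Gen (c @ x # ys) @ t)) (mon (map Gen (c @ insort x ys) @ t))"
proof (induction ys arbitrary: c)
  case (Cons y ys)
  show ?case
  proof (cases "x \<le> y")
    case False
    have "map Gen (c @ x # y # ys) @ t \<in> Phi" "map Gen (c @ y # x # ys) @ t \<in> Phi"
      using assms by (auto simp del: map_append intro!: map_Gen_append_in_Phi)
    then have "cong (mon (map Gen (c @ x # y # ys) @ t)) (mon (map Gen (c @ y # x # ys) @ t))"
      using cong_swap[of "map Gen c" "Gen x" y "map Gen ys @ t"] by simp
    from cong_trans[OF this] show ?thesis
      using False Cons[of "c @ [y]"] by simp
  qed (simp add: comm_ideal_0)
qed (simp add: comm_ideal_0)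

lemma cong_sort:
  assumes "t = [] \<or> (\<exists>z\<in>Phi. t = [Op z])"
  shows "cong (mon (map Gen (c @ xs) @ t)) (mon (map Gen (c @ sort xs) @ t))"
proof (induction xs arbitrary: c)
  case (Cons x xs)
  have "cong (mon (map Gen (c @ x # xs) @ t)) (mon (map Gen (c @ x # sort xs) @ t))"
    using Cons[of "c @ [x]"] by simp
  then show ?case
    using cong_trans cong_insort[OF assms, of c x "sort xs"] by simp blast
qed (simp add: comm_ideal_0)

lemma cong_Op_right:
  assumes "z \<in> Phi"
  shows "cong (mon (map Gen c @ Op z # map Gen xs)) (mon (map Gen (c @ xs) @ [Op z]))"
proof (induction xs arbitrary: c)
  case (Cons x xs)
  have "map Gen c @ Op z # Gen x # map Gen xs \<in> Phi" "map Gen c @ Gen x # Op z # map Gen xs \<in> Phi"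
    using assms Phi_Cons_iff[of "Op z" "Gen x # map Gen xs"] Phi_Cons_iff[of "Gen x" "Op z # map Gen xs"]
      Phi_Cons_iff[of "Op z" "map Gen xs"] map_Gen_in_Phi[of "x # xs"]
    by (cases "c = []"; cases "xs = []"; auto simp: Phi_append_iff last_map hd_map)+
  from cong_trans[OF cong_swap[OF this]] show ?case
    using Cons[of "c @ [x]"] by simp
qed (simp add: comm_ideal_0)


subsection \<open>Normal words span the quotient\<close>

text \<open>A subspace, shown to be closed under the product and under \<open>P\<close>; as it
  contains the generators, it contains all of RB(X).\<close>

definition reducible_pm :: "('x::linorder rb_word \<Rightarrow>\<^sub>0 'k) set" where
  "reducible_pm = {f. \<exists>g. Poly_Mapping.keys g \<subseteq> NW \<and> cong f g}"

lemma reducible_cong: "cong f f' \<Longrightarrow> f' \<in> reducible_pm \<Longrightarrow> f \<in> reducible_pm"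
  unfolding reducible_pm_def using cong_trans by blast

lemma reducible_NW: "Poly_Mapping.keys f \<subseteq> NW \<Longrightarrow> f \<in> reducible_pm"
  unfolding reducible_pm_def using cong_refl by blast

lemma reducible_add:
  assumes "f \<in> reducible_pm" "f' \<in> reducible_pm"
  shows "f + f' \<in> reducible_pm"
proof -
  from assms obtain g g' where "Poly_Mapping.keys g \<subseteq> NW" "cong f g" "Poly_Mapping.keys g' \<subseteq> NW" "cong f' g'"
    unfolding reducible_pm_def by blast
  then show ?thesis
    using comm_ideal_add[of "f - g" "f' - g'"] keys_add_subset[of g NW g']
    unfolding reducible_pm_def by (auto simp: algebra_simps intro!: exI[of _ "g + g'"])
qed

lemma reducible_scale:
  assumes "f \<in> reducible_pm"
  shows "pm_scale c f \<in> reducible_pm"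
proof -
  from assms obtain g where "Poly_Mapping.keys g \<subseteq> NW" "cong f g"
    unfolding reducible_pm_def by blast
  then show ?thesis
    using comm_ideal_scale[of "f - g" c] keys_pm_scale_subset[of g NW c]
    unfolding reducible_pm_def by (auto simp: pm_scale_diff)
qed

lemma reducible_sum: "(\<And>i. i \<in> A \<Longrightarrow> f i \<in> reducible_pm) \<Longrightarrow> (\<Sum>i\<in>A. f i) \<in> reducible_pm"
  by (induction A rule: infinite_finite_induct) (auto intro: reducible_add reducible_NW)

lemma reducible_lin_ext:
  "(\<And>w. w \<in> Poly_Mapping.keys f \<Longrightarrow> F w \<in> reducible_pm) \<Longrightarrow> lin_ext F f \<in> reducible_pm"
  unfolding lin_ext_def by (intro reducible_sum reducible_scale)

lemma reducible_sorted:
  assumes "t = [] \<or> (\<exists>z\<in>NW. t = [Op z])" "xs \<noteq> [] \<or> t \<noteq> []"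
  shows "mon (map Gen xs @ t) \<in> reducible_pm"
proof -
  have "map Gen (sort xs) @ t \<in> NW"
    using assms NW.gens[of "sort xs"] NW.op[of "sort xs"] by (cases "t = []") (auto simp flip: set_empty)
  moreover have "cong (mon (map Gen xs @ t)) (mon (map Gen (sort xs) @ t))"
    using cong_sort[of t "[]" xs] assms(1) NW_subset_Phi by fastforce
  ultimately show ?thesis
    using reducible_cong reducible_NW by (metis keys_single empty_subsetI insert_subset)
qed

lemma reducible_Op:
  assumes "f \<in> reducible_pm"
  shows "lin_ext (\<lambda>w. mon (map Gen xs @ [Op w])) f \<in> reducible_pm"
proof -
  from assms obtain g where g: "Poly_Mapping.keys g \<subseteq> NW" "cong f g"
    unfolding reducible_pm_def by blast
  have "map Gen xs @ [Op [Gen x]] \<in> Phi" for x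
    by (rule map_Gen_append_in_Phi) auto
  then have "lin_ext (\<lambda>w. mon (map Gen xs @ [Op w])) (f - g) = sandwich lam (map Gen xs) (P_ext (f - g)) []"
    using sandwich_P_ext[of "map Gen xs" _ "[]" lam "f - g"] by metis
  moreover have "\<dots> \<in> comm_ideal lam"
    using g(2) by (intro comm_ideal_sandwich comm_ideal_P_ext) auto
  ultimately have "cong (lin_ext (\<lambda>w. mon (map Gen xs @ [Op w])) f) (lin_ext (\<lambda>w. mon (map Gen xs @ [Op w])) g)"
    by (simp add: lin_ext_diff)
  moreover have "lin_ext (\<lambda>w. mon (map Gen xs @ [Op w])) g \<in> reducible_pm"
    using g(1) by (intro reducible_lin_ext reducible_sorted) auto
  ultimately show ?thesis by (rule reducible_cong)
qed

lemma NW_decomp: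
  assumes "w \<in> NW"
  obtains xs t where "w = map Gen xs @ t" "xs \<noteq> [] \<or> t \<noteq> []" "t = [] \<or> (\<exists>z\<in>NW. t = [Op z])"
  using assms by cases (use that[of _ "[]"] that in auto)

text \<open>Generators are sorted and a single \<open>P\<close> factor is moved to the right end. If
  both words end in a \<open>P\<close> factor, moving the first one up to the second makes them
  collide, which leads to three products of smaller total size.\<close>

lemma reducible_word_mult:
  "u \<in> NW \<Longrightarrow> v \<in> NW \<Longrightarrow> word_mult lam u v \<in> reducible_pm"
proof (induction "size_list size u + size_list size v" arbitrary: u v rule: less_induct)
  case less
  obtain xs t where u: "u = map Gen xs @ t" "xs \<noteq> [] \<or> t \<noteq> []" "t = [] \<or> (\<exists>z\<in>NW. t = [Op z])"
    using NW_decomp[OF less.prems(1)] .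
  obtain ys r where v: "v = map Gen ys @ r" "ys \<noteq> [] \<or> r \<noteq> []" "r = [] \<or> (\<exists>z\<in>NW. r = [Op z])"
    using NW_decomp[OF less.prems(2)] .
  from u(3) show ?case
  proof
    assume t: "t = []"
    then have "word_mult lam u v = mon (map Gen (xs @ ys) @ r)"
      using u(1,2) v(1,2) by (subst word_mult_concat) (auto simp: last_map)
    then show ?thesis
      using reducible_sorted[OF v(3), of "xs @ ys"] u(2) t by simp
  next
    assume "\<exists>z\<in>NW. t = [Op z]"
    then obtain z where z: "z \<in> NW" "t = [Op z]" by blast
    from v(3) show ?thesis
    proof
      assume r: "r = []"
      then have "word_mult lam u v = mon (map Gen xs @ Op z # map Gen ys)"
        using u(1) v(1,2) z(2) by (subst word_mult_concat) (auto simp: hd_map)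
      moreover have "mon (map Gen (xs @ ys) @ [Op z]) \<in> reducible_pm"
        using z(1) by (intro reducible_sorted) auto
      ultimately show ?thesis
        using reducible_cong[OF cong_Op_right] NW_subset_Phi[OF z(1)] by simp
    next
      assume "\<exists>z\<in>NW. r = [Op z]"
      then obtain y where y: "y \<in> NW" "r = [Op y]" by blast
      have "cong (word_mult lam u v) (word_mult lam (map Gen (xs @ ys) @ [Op z]) [Op y])"
      proof (cases "ys = []")
        case True
        then show ?thesis using u(1) v(1) z(2) y(2) by (simp add: comm_ideal_0)
      next
        case False
        \<comment> \<open>Here \<open>ys\<close> still separates the two \<open>P\<close> factors,
          so both bracketings equal the same concatenated word.\<close>
        have "word_mult lam u v = word_mult lam (map Gen xs @ Op z # map Gen ys) [Op y]"
          using u(1) v(1) z(2) y(2) False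
          by (subst (1 2) word_mult_concat) (auto simp: hd_map last_map)
        moreover have "mon [Op y] \<in> carrier (RB lam)"
          using NW_subset_Phi[OF y(1)] by simp
        from comm_ideal_mult_right[OF this cong_Op_right[OF NW_subset_Phi[OF z(1)], of xs ys]]
        have "cong (word_mult lam (map Gen xs @ Op z # map Gen ys) [Op y]) (word_mult lam (map Gen (xs @ ys) @ [Op z]) [Op y])"
          unfolding mult_RB_linear mult_RB_mon .
        ultimately show ?thesis by simp
      qed
      moreover have "op_mult lam z y \<in> reducible_pm"
        unfolding op_mult_def
      proof (intro reducible_add reducible_scale less.hyps)
        show "[Op z] \<in> NW" "[Op y] \<in> NW"
          using z(1) y(1) NW.op[of "[]"] by auto
      qed (use z y u(1) v(1) in auto)
      then have "word_mult lam (map Gen (xs @ ys) @ [Op z]) [Op y] \<in> reducible_pm"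
        unfolding word_mult_Op by (rule reducible_Op)
      ultimately show ?thesis by (rule reducible_cong)
    qed
  qed
qed

text \<open>The difference of the two products telescopes as (f - g)f' + g(f' - g').\<close>

lemma reducible_mult:
  assumes "f \<in> carrier (RB lam)" "f \<in> reducible_pm" "f' \<in> carrier (RB lam)" "f' \<in> reducible_pm"
  shows "f \<otimes>\<^bsub>RB lam\<^esub> f' \<in> reducible_pm"
proof -
  from assms obtain g g' where g: "Poly_Mapping.keys g \<subseteq> NW" "cong f g" "Poly_Mapping.keys g' \<subseteq> NW" "cong f' g'"
    unfolding reducible_pm_def by blast
  then have "g \<in> carrier (RB lam)"
    using NW_subset_Phi by auto
  then have "(f - g) \<otimes>\<^bsub>RB lam\<^esub> f' + g \<otimes>\<^bsub>RB lam\<^esub> (f' - g') \<in> comm_ideal lam"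
    using g assms by (intro comm_ideal_add comm_ideal_mult_left comm_ideal_mult_right)
  then have "cong (f \<otimes>\<^bsub>RB lam\<^esub> f') (g \<otimes>\<^bsub>RB lam\<^esub> g')"
    unfolding mult_RB_linear by simp
  moreover have "g \<otimes>\<^bsub>RB lam\<^esub> g' \<in> reducible_pm"
    using g unfolding RB_simps by (intro reducible_lin_ext reducible_word_mult) auto
  ultimately show ?thesis by (rule reducible_cong)
qed

lemma reducible_words:
  fixes p :: "'x::linorder prime_word" and w :: "'x rb_word"
  shows "[p] \<in> Phi \<Longrightarrow> mon [p] \<in> reducible_pm" "w \<in> Phi \<Longrightarrow> mon w \<in> reducible_pm"
proof (induction p and w rule: word_induct)
  case (Gen x)
  show ?case using NW.gens[of "[x]"] by (intro reducible_NW) simp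
next
  case (Op w)
  then show ?case using reducible_Op[of "mon w" "[]"] by simp
next
  case (Cons p w)
  show ?case
  proof (cases "w = []")
    case False
    then have "[p] \<in> Phi" "w \<in> Phi" "\<not> (is_Op p \<and> is_Op (hd w))"
      using Cons.prems Phi_Cons_iff[of p w] by auto
    then show ?thesis
      using reducible_mult[of "mon [p]" "mon w"] Cons.IH False by (simp add: word_mult_concat)
  qed (use Cons in simp)
qed simp

lemma all_reducible: "f \<in> carrier (RB lam) \<Longrightarrow> f \<in> reducible_pm"
  using reducible_lin_ext[of f mon] reducible_words(2) by auto

end


subsection \<open>The quotient\<close>

definition rb_class :: "'k::field \<Rightarrow> ('x::linorder rb_word \<Rightarrow>\<^sub>0 'k) \<Rightarrow> ('x rb_word \<Rightarrow>\<^sub>0 'k) set" where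
  "rb_class lam f = comm_ideal lam +>\<^bsub>RB lam\<^esub> f"

lemma word_class_eq: "word_class lam w = rb_class lam (mon w)"
  by (simp add: word_class_def rb_class_def)

lemma mem_rb_class: "f \<in> rb_class lam a \<longleftrightarrow> f - a \<in> comm_ideal lam"
  by (force simp: rb_class_def a_r_coset_def r_coset_def)

lemma rb_class_self: "a \<in> rb_class lam a"
  by (simp add: mem_rb_class comm_ideal_0)

lemma rb_class_eq_iff: "rb_class lam a = rb_class lam b \<longleftrightarrow> a - b \<in> comm_ideal lam"
proof
  show "rb_class lam a = rb_class lam b \<Longrightarrow> a - b \<in> comm_ideal lam"
    using rb_class_self[of a lam] by (simp add: mem_rb_class)
next
  assume ab: "a - b \<in> comm_ideal lam"
  show "rb_class lam a = rb_class lam b"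
    using cong_trans[OF _ ab] cong_trans[OF _ cong_sym[OF ab]] by (auto simp: mem_rb_class)
qed

lemma mem_rb_class_carrier: "f \<in> rb_class lam a \<Longrightarrow> a \<in> carrier (RB lam) \<Longrightarrow> f \<in> carrier (RB lam)"
  using comm_ideal_carrier[of "f - a" lam] keys_add_subset[of "f - a" Phi a] by (simp add: mem_rb_class)

lemma carrier_comm_RB: "carrier (comm_RB lam) = rb_class lam ` carrier (RB lam)"
  by (auto simp: comm_RB_def rb_quot_def A_RCOSETS_defs rb_class_def a_r_coset_def simp del: RB_simps(2-))

lemma zero_comm_RB: "\<zero>\<^bsub>comm_RB lam\<^esub> = rb_class lam 0"
  by (auto simp: comm_RB_def rb_quot_def mem_rb_class)

lemma add_comm_RB: "rb_class lam a \<oplus>\<^bsub>comm_RB lam\<^esub> rb_class lam b = rb_class lam (a + b)"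
proof -
  have "rb_class lam a \<oplus>\<^bsub>comm_RB lam\<^esub> rb_class lam b = {f + g | f g. f \<in> rb_class lam a \<and> g \<in> rb_class lam b}"
    by (auto simp: comm_RB_def rb_quot_def set_add_defs)
  also have "\<dots> = rb_class lam (a + b)"
  proof (intro equalityI subsetI)
    fix h
    assume "h \<in> {f + g | f g. f \<in> rb_class lam a \<and> g \<in> rb_class lam b}"
    then obtain f g where "h = f + g" "f - a \<in> comm_ideal lam" "g - b \<in> comm_ideal lam"
      by (auto simp: mem_rb_class)
    then show "h \<in> rb_class lam (a + b)"
      using comm_ideal_add[of "f - a" lam "g - b"] by (simp add: mem_rb_class add_diff_add)
  next
    fix h
    assume "h \<in> rb_class lam (a + b)"
    then have "h - b \<in> rb_class lam a"
      by (simp add: mem_rb_class algebra_simps)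
    then show "h \<in> {f + g | f g. f \<in> rb_class lam a \<and> g \<in> rb_class lam b}"
      using rb_class_self[of b lam] by (metis (mono_tags, lifting) diff_add_cancel mem_Collect_eq)
  qed
  finally show ?thesis .
qed

text \<open>The union in \<open>rb_quot\<close> runs over a constant family, since the class of a
  multiple is independent of the representative.\<close>

lemma smult_comm_RB: "c \<odot>\<^bsub>comm_RB lam\<^esub> rb_class lam a = rb_class lam (pm_scale c a)"
proof -
  have "c \<odot>\<^bsub>comm_RB lam\<^esub> rb_class lam a = (\<Union>x\<in>rb_class lam a. rb_class lam (pm_scale c x))"
    by (simp add: comm_RB_def rb_quot_def rb_class_def)
  also have "\<dots> = rb_class lam (pm_scale c a)"
    by (rule UN_constant_eq[OF rb_class_self])
      (simp add: rb_class_eq_iff mem_rb_class pm_scale_diff[symmetric] comm_ideal_scale)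
  finally show ?thesis .
qed

lemma rbop_comm_RB: "rbop (comm_RB lam) (rb_class lam a) = rb_class lam (P_ext a)"
proof -
  have "rbop (comm_RB lam) (rb_class lam a) = (\<Union>x\<in>rb_class lam a. rb_class lam (P_ext x))"
    by (simp add: comm_RB_def rb_quot_def rb_class_def)
  also have "\<dots> = rb_class lam (P_ext a)"
    by (rule UN_constant_eq[OF rb_class_self])
      (simp add: rb_class_eq_iff mem_rb_class P_ext_linear[symmetric] comm_ideal_P_ext)
  finally show ?thesis .
qed

lemma mult_comm_RB:
  assumes "a \<in> carrier (RB lam)" "b \<in> carrier (RB lam)"
  shows "rb_class lam a \<otimes>\<^bsub>comm_RB lam\<^esub> rb_class lam b = rb_class lam (a \<otimes>\<^bsub>RB lam\<^esub> b)"
proof -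
  have eq: "rb_class lam (x \<otimes>\<^bsub>RB lam\<^esub> y) = rb_class lam (a \<otimes>\<^bsub>RB lam\<^esub> b)"
    if "x \<in> rb_class lam a" "y \<in> rb_class lam b" for x y
  proof -
    have "(x - a) \<otimes>\<^bsub>RB lam\<^esub> y + a \<otimes>\<^bsub>RB lam\<^esub> (y - b) \<in> comm_ideal lam"
      using that mem_rb_class_carrier[OF that(2) assms(2)] assms(1)
      by (intro comm_ideal_add comm_ideal_mult_left comm_ideal_mult_right) (simp_all add: mem_rb_class)
    then show ?thesis
      unfolding rb_class_eq_iff mult_RB_linear by simp
  qed
  have "rb_class lam a \<otimes>\<^bsub>comm_RB lam\<^esub> rb_class lam b =
      (\<Union>x\<in>rb_class lam a. \<Union>y\<in>rb_class lam b. rb_class lam (x \<otimes>\<^bsub>RB lam\<^esub> y))"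
    by (simp add: comm_RB_def rb_quot_def rcoset_mult_def rb_class_def del: RB_simps)
  also have "\<dots> = rb_class lam (a \<otimes>\<^bsub>RB lam\<^esub> b)"
    using eq rb_class_self[of a lam] rb_class_self[of b lam] by blast
  finally show ?thesis .
qed

lemmas comm_RB_class_simps = zero_comm_RB add_comm_RB smult_comm_RB rbop_comm_RB mult_comm_RB

text \<open>The map induced on classes, through a chosen representative; it is meaningful for linear
  \<open>h\<close> that vanish on the ideal.\<close>

definition class_lift :: "(('x::linorder rb_word \<Rightarrow>\<^sub>0 'k::field) \<Rightarrow> 'b) \<Rightarrow> ('x rb_word \<Rightarrow>\<^sub>0 'k) set \<Rightarrow> 'b" where
  "class_lift h C = h (SOME f. f \<in> C)"

lemma class_lift_rb_class:
  fixes B :: "('k::field, 'b, 'm) rb_struct_scheme" and h :: "('x::linorder rb_word \<Rightarrow>\<^sub>0 'k) \<Rightarrow> 'b"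
  assumes B: "vectorspace class_ring B" and h: "h \<in> rb_hom (RB lam) B"
    and vanish: "\<And>f. f \<in> comm_ideal lam \<Longrightarrow> h f = \<zero>\<^bsub>B\<^esub>"
    and a: "a \<in> carrier (RB lam)"
  shows "class_lift h (rb_class lam a) = h a"
proof -
  interpret vectorspace class_ring B by fact
  define f where "f = (SOME f. f \<in> rb_class lam a)"
  have f: "f - a \<in> comm_ideal lam"
    using someI[of "\<lambda>f. f \<in> rb_class lam a", OF rb_class_self] by (simp add: f_def mem_rb_class)
  have hom: "h \<in> class_hom (RB lam) B"
    using h by (simp add: rb_hom_def)
  have "h f = h ((f - a) \<oplus>\<^bsub>RB lam\<^esub> a)"
    by simp
  also have "\<dots> = h (f - a) \<oplus>\<^bsub>B\<^esub> h a"
    using class_homD(2)[OF hom comm_ideal_carrier[OF f] a] .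
  also have "\<dots> = h a"
    using vanish[OF f] class_homD(1)[OF hom a] by simp
  finally show ?thesis
    by (simp add: class_lift_def f_def)
qed

lemma class_lift_rb_hom:
  fixes B :: "('k::field, 'b, 'm) rb_struct_scheme" and h :: "('x::linorder rb_word \<Rightarrow>\<^sub>0 'k) \<Rightarrow> 'b"
  assumes B: "vectorspace class_ring B" and h: "h \<in> rb_hom (RB lam) B"
    and vanish: "\<And>f. f \<in> comm_ideal lam \<Longrightarrow> h f = \<zero>\<^bsub>B\<^esub>"
  shows "class_lift h \<in> rb_hom (comm_RB lam) B"
proof -
  have lift: "class_lift h (rb_class lam a) = h a" if "a \<in> carrier (RB lam)" for a
    using class_lift_rb_class[OF B h vanish that] .
  have hom: "h \<in> class_hom (RB lam) B"
    using h by (simp add: rb_hom_def)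
  have closed: "a + b \<in> carrier (RB lam)" "pm_scale c a \<in> carrier (RB lam)"
    if "a \<in> carrier (RB lam)" "b \<in> carrier (RB lam)" for a b :: "'x rb_word \<Rightarrow>\<^sub>0 'k" and c
    using that by (simp_all add: keys_add_subset keys_pm_scale_subset)
  have "class_lift h \<in> class_hom (comm_RB lam) B"
  proof (rule class_homI)
    fix C D :: "('x rb_word \<Rightarrow>\<^sub>0 'k) set" and c
    assume C: "C \<in> carrier (comm_RB lam)"
    then obtain a where a: "a \<in> carrier (RB lam)" "C = rb_class lam a"
      unfolding carrier_comm_RB by blast
    show "class_lift h C \<in> carrier B"
      using class_homD(1)[OF hom a(1)] unfolding a(2) lift[OF a(1)] .
    show "class_lift h (c \<odot>\<^bsub>comm_RB lam\<^esub> C) = c \<odot>\<^bsub>B\<^esub> class_lift h C"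
      using class_homD(3)[OF hom a(1)] unfolding a(2) smult_comm_RB lift[OF a(1)] lift[OF closed(2)[OF a(1) a(1)]] by simp
    assume "D \<in> carrier (comm_RB lam)"
    then obtain b where b: "b \<in> carrier (RB lam)" "D = rb_class lam b"
      unfolding carrier_comm_RB by blast
    show "class_lift h (C \<oplus>\<^bsub>comm_RB lam\<^esub> D) = class_lift h C \<oplus>\<^bsub>B\<^esub> class_lift h D"
      using class_homD(2)[OF hom a(1) b(1)]
      unfolding a(2) b(2) add_comm_RB lift[OF a(1)] lift[OF b(1)] lift[OF closed(1)[OF a(1) b(1)]] by simp
  qed
  moreover have "class_lift h (C \<otimes>\<^bsub>comm_RB lam\<^esub> D) = class_lift h C \<otimes>\<^bsub>B\<^esub> class_lift h D"
    "class_lift h (rbop (comm_RB lam) C) = rbop B (class_lift h C)"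
    if CD: "C \<in> carrier (comm_RB lam)" "D \<in> carrier (comm_RB lam)" for C D :: "('x rb_word \<Rightarrow>\<^sub>0 'k) set"
  proof -
    obtain a b where a: "a \<in> carrier (RB lam)" "C = rb_class lam a" and b: "b \<in> carrier (RB lam)" "D = rb_class lam b"
      using CD unfolding carrier_comm_RB by blast
    show "class_lift h (C \<otimes>\<^bsub>comm_RB lam\<^esub> D) = class_lift h C \<otimes>\<^bsub>B\<^esub> class_lift h D"
      unfolding a(2) b(2) mult_comm_RB[OF a(1) b(1)] lift[OF a(1)] lift[OF b(1)] lift[OF RB_mult_closed[OF a(1) b(1)]]
      using h a(1) b(1) by (simp add: rb_hom_def del: RB_simps(1,2))
    show "class_lift h (rbop (comm_RB lam) C) = rbop B (class_lift h C)"
      unfolding a(2) rbop_comm_RB lift[OF a(1)] lift[OF P_ext_closed[OF a(1)]]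
      using h a(1) by (simp add: rb_hom_def del: RB_simps(1,2))
  qed
  ultimately show ?thesis
    by (simp add: rb_hom_def)
qed

text \<open>The kernel of evaluation is a Rota-Baxter ideal, and commutativity of \<open>A\<close>
  puts the relations into it.\<close>

lemma (in comm_rota_baxter_algebra) eval_pm_comm_ideal:
  fixes \<theta> :: "'x::linorder \<Rightarrow> 'b"
  assumes \<theta>: "\<And>x. \<theta> x \<in> carrier A" and f: "f \<in> comm_ideal lam"
  shows "eval_pm \<theta> f = \<zero>"
proof -
  have hom: "eval_pm \<theta> \<in> class_hom (RB lam) A"
    by (rule eval_pm_class_hom) (rule \<theta>)
  note closed = class_homD(1)[OF hom]
  let ?K = "{f \<in> carrier (RB lam). eval_pm \<theta> f = \<zero>}"
  have "rb_ideal (RB lam) ?K"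
    unfolding rb_ideal_RB_iff
  proof (intro conjI ballI allI)
    show "0 \<in> ?K" by (simp add: eval_pm_def)
    fix f c
    assume f: "f \<in> ?K"
    have "\<And>x. x \<in> carrier A \<Longrightarrow> \<zero> \<otimes>\<^bsub>A\<^esub> x = \<zero>" "\<And>x. x \<in> carrier A \<Longrightarrow> x \<otimes>\<^bsub>A\<^esub> \<zero> = \<zero>" "rbop A \<zero> = \<zero>"
      using mult_smult_left[of \<zero> _ 0] mult_smult_right[of _ \<zero> 0] rbop_smult[of \<zero> 0]
      by (simp_all add: smult_simps mult_closed)
    note zero = this
    show "pm_scale c f \<in> ?K"
      using f class_homD(3)[OF hom, of f c] smult_simps(2)[of \<zero>] smult_simps(4)[where x = \<zero> and c = c and d = 0]
      by (simp add: keys_pm_scale_subset)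
    show "P_ext f \<in> ?K"
      using f eval_pm_P_ext[OF \<theta>, of f] P_ext_closed[of f] zero by (simp del: RB_simps(1))
    {
      fix g
      assume "g \<in> ?K"
      then show "f + g \<in> ?K"
        using f class_homD(2)[OF hom, of f g] by (simp add: keys_add_subset)
    next
      fix g :: "'x rb_word \<Rightarrow>\<^sub>0 'a"
      assume g: "g \<in> carrier (RB lam)"
      show "g \<otimes>\<^bsub>RB lam\<^esub> f \<in> ?K" "f \<otimes>\<^bsub>RB lam\<^esub> g \<in> ?K"
        using f g eval_pm_mult[OF \<theta>, of f g] eval_pm_mult[OF \<theta>, of g f] RB_mult_closed[of f lam g]
          RB_mult_closed[of g lam f] zero closed[OF g] by (simp_all del: RB_simps(1,2))
    }
  qed auto
  moreover have "comm_rels \<subseteq> ?K"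
  proof
    fix s :: "'x rb_word \<Rightarrow>\<^sub>0 'a"
    assume s: "s \<in> comm_rels"
    then obtain p i where p: "s = mon [p, Gen i] - mon [Gen i, p]" "[p] \<in> Phi"
      by (auto elim!: comm_rels_cases)
    then have Phi: "[p, Gen i] \<in> Phi" "[Gen i, p] \<in> Phi"
      using Phi_Cons_iff[of p "[Gen i]"] Phi_Cons_iff[of "Gen i" "[p]"] by auto
    \<comment> \<open>The relation is brought into additive form, so that its value can be isolated
      by cancellation in \<open>A\<close>.\<close>
    have "eval_pm \<theta> (mon [p, Gen i]) = eval_pm \<theta> (s \<oplus>\<^bsub>RB lam\<^esub> mon [Gen i, p])"
      using p(1) by simp
    also have "\<dots> = eval_pm \<theta> s \<oplus> eval_pm \<theta> (mon [Gen i, p])"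
      using s comm_rels_carrier Phi by (intro class_homD(2)[OF hom]) auto
    finally have "eval_prime A \<theta> p \<otimes>\<^bsub>A\<^esub> \<theta> i = eval_pm \<theta> s \<oplus> \<theta> i \<otimes>\<^bsub>A\<^esub> eval_prime A \<theta> p"
      using eval_pm_mon[of \<theta>, OF \<theta> Phi(1)] eval_pm_mon[of \<theta>, OF \<theta> Phi(2)] by simp
    moreover have "eval_prime A \<theta> p \<in> carrier A"
      using eval_closed(1)[OF \<theta> p(2)] .
    ultimately have "\<theta> i \<otimes>\<^bsub>A\<^esub> eval_prime A \<theta> p = eval_pm \<theta> s \<oplus> \<theta> i \<otimes>\<^bsub>A\<^esub> eval_prime A \<theta> p"
      using mult_comm[of "\<theta> i" "eval_prime A \<theta> p"] \<theta> by simp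
    moreover have "s \<in> carrier (RB lam)"
      using s comm_rels_carrier by blast
    ultimately show "s \<in> ?K"
      using closed[of s] mult_closed[OF \<theta>[of i] \<open>eval_prime A \<theta> p \<in> carrier A\<close>]
      by (simp del: RB_simps(1) add: M.add.l_cancel_one' M.add.r_cancel_one')
  qed
  ultimately show ?thesis
    using comm_ideal_least f by blast
qed


subsection \<open>Linear independence of the normal words\<close>

lemma rb_homD:
  assumes "h \<in> rb_hom A B"
  shows "h \<in> class_hom A B"
    "x \<in> carrier A \<Longrightarrow> y \<in> carrier A \<Longrightarrow> h (x \<otimes>\<^bsub>A\<^esub> y) = h x \<otimes>\<^bsub>B\<^esub> h y"
    "x \<in> carrier A \<Longrightarrow> h (rbop A x) = rbop B (h x)"
  using assms by (simp_all add: rb_hom_def)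

lemma comm_rota_baxter_rota_baxter:
  "comm_rota_baxter_algebra lam B \<Longrightarrow> rota_baxter_algebra lam B"
  by (rule comm_rota_baxter_algebra.axioms)

lemma comm_rota_baxter_vectorspace:
  "comm_rota_baxter_algebra lam B \<Longrightarrow> vectorspace class_ring B"
  by (rule rota_baxter_algebra.axioms(1)[OF comm_rota_baxter_rota_baxter])

abbreviation qgen :: "'i \<Rightarrow> 'i multiset \<Rightarrow> 'i multiset list \<Rightarrow> 'k::zero_neq_one" where
  "qgen x \<equiv> qdelta {#x#} []"

lemma qdelta_eq_iff [simp]:
  "(qdelta m w :: _ \<Rightarrow> _ \<Rightarrow> 'k::zero_neq_one) = qdelta m' w' \<longleftrightarrow> m = m' \<and> w = w'"
proof
  assume "(qdelta m w :: _ \<Rightarrow> _ \<Rightarrow> 'k) = qdelta m' w'"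
  then have "(qdelta m w m w :: 'k) = qdelta m' w' m w" by simp
  then show "m = m' \<and> w = w'" by (simp add: qdelta_def split: if_splits)
qed simp

lemma eval_gens_QSh:
  "xs \<noteq> [] \<Longrightarrow> eval_word (QSh lam) qgen (map Gen xs) = qdelta (mset xs) []"
proof (induction xs)
  case (Cons x xs)
  then show ?case by (cases "xs = []") (simp_all add: qmult_qdelta)
qed simp

text \<open>Separates the outer monomial from the final \<open>P\<close> factor. The base case says
  that \<open>qdelta {#} []\<close> is a unit of the model.\<close>

lemma eval_NW_QSh:
  fixes lam :: "'k::field"
  assumes "w \<in> NW"
  shows "eval_word (QSh lam) qgen (map Gen xs @ [Op w]) =
    qmult lam (qdelta (mset xs) []) (qP (eval_word (QSh lam) qgen w))"
proof (induction xs)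
  case Nil
  have "qmult lam (qdelta {#} []) F = F" for F :: "'a multiset \<Rightarrow> 'a multiset list \<Rightarrow> 'k"
  proof (intro ext)
    fix m v
    have "qmult lam (qdelta {#} []) F m v = qsh lam v (qdelta {#} [] {#}) (F m)"
      unfolding qmult_def by (rule sum_splits_zero_left) (simp add: qdelta_def)
    also have "\<dots> = F m v"
      by (simp add: qdelta_def qsh_unit_left)
    finally show "qmult lam (qdelta {#} []) F m v = F m v" .
  qed
  then show ?case by simp
next
  case (Cons x xs)
  then show ?case
    by (simp add: qmult_assoc[symmetric] qmult_qdelta)
qed

lemma eval_NW_delta:
  "w \<in> NW \<Longrightarrow> \<exists>m v. eval_word (QSh (lam :: 'k::field)) qgen w = qdelta m v"
proof (induction rule: NW.induct)
  case (gens xs)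
  then show ?case using eval_gens_QSh by blast
next
  case (op xs w)
  then show ?case by (auto simp: eval_NW_QSh qP_qdelta qmult_qdelta)
qed

text \<open>The code is decoded from outside: its list is empty exactly when there is no
  \<open>P\<close> factor, its outer multiset determines the sorted generators, and head and tail of
  the list are the code of the argument of \<open>P\<close>.\<close>

lemma eval_NW_inj:
  fixes lam :: "'k::field"
  shows "w \<in> NW \<Longrightarrow> w' \<in> NW \<Longrightarrow> eval_word (QSh lam) qgen w = eval_word (QSh lam) qgen w' \<Longrightarrow> w = w'"
proof (induction arbitrary: w' rule: NW.induct)
  case (gens xs)
  from gens.prems(1) show ?case
  proof cases
    case (gens ys)
    then show ?thesis
      using \<open>sorted xs\<close> \<open>xs \<noteq> []\<close> \<open>eval_word (QSh lam) qgen (map Gen xs) = _\<close>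
      by (simp add: eval_gens_QSh) (metis properties_for_sort)
  next
    case (op ys z)
    then show ?thesis
      using eval_NW_delta[OF op(3), of lam] \<open>xs \<noteq> []\<close> \<open>eval_word (QSh lam) qgen (map Gen xs) = _\<close>
      by (auto simp: eval_gens_QSh eval_NW_QSh qP_qdelta qmult_qdelta)
  qed
next
  case (op xs z)
  obtain m v where z: "eval_word (QSh lam) qgen z = qdelta m v"
    using eval_NW_delta[OF op.hyps(2)] by blast
  from op.prems(1) show ?case
  proof cases
    case (gens ys)
    then show ?thesis
      using op.prems(2) op.hyps(2) z by (simp add: eval_gens_QSh eval_NW_QSh qP_qdelta qmult_qdelta)
  next
    case *: (op ys y)
    obtain m' v' where y: "eval_word (QSh lam) qgen y = qdelta m' v'"
      using eval_NW_delta[OF *(3)] by blast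
    have "mset xs = mset ys" "m # v = m' # v'"
      using op.prems(2) op.hyps(2) *(1,3) z y by (simp_all add: eval_NW_QSh qP_qdelta qmult_qdelta)
    then have "xs = ys" "eval_word (QSh lam) qgen z = eval_word (QSh lam) qgen y"
      using op.hyps(1) *(2) z y by (metis properties_for_sort, simp)
    then show ?thesis
      using op.IH[OF *(3)] *(1) by simp
  qed
qed

definition model_hom :: "'k::field \<Rightarrow> ('i::linorder rb_word \<Rightarrow>\<^sub>0 'k) \<Rightarrow> 'i multiset \<Rightarrow> 'i multiset list \<Rightarrow> 'k" where
  "model_hom lam = rota_baxter_algebra.eval_pm (QSh lam) qgen"

lemma finsum_QSh:
  assumes "finite S"
  shows "finsum (QSh (lam :: 'k::field)) F S = (\<lambda>m v. \<Sum>w\<in>S. F w m v)"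
proof -
  interpret abelian_group "QSh lam :: ('k, 'i multiset \<Rightarrow> 'i multiset list \<Rightarrow> 'k) rb_struct"
    by (rule abelian_group_QSh)
  show ?thesis
    using assms by (induction S rule: finite_induct) simp_all
qed

context
  fixes lam :: "'k::field"
begin

interpretation Q: comm_rota_baxter_algebra lam "QSh lam :: ('k, 'i::linorder multiset \<Rightarrow> 'i multiset list \<Rightarrow> 'k) rb_struct"
  by (rule comm_rota_baxter_QSh)

lemma model_hom_rb_hom: "model_hom lam \<in> rb_hom (RB lam) (QSh lam)"
  unfolding model_hom_def by (rule Q.eval_pm_rb_hom) simp

lemma model_hom_comm_ideal: "f \<in> comm_ideal lam \<Longrightarrow> model_hom lam f = \<zero>\<^bsub>QSh lam\<^esub>"
  unfolding model_hom_def by (rule Q.eval_pm_comm_ideal) simp_all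

lemma model_hom_mon: "w \<in> Phi \<Longrightarrow> model_hom lam (mon w) = eval_word (QSh lam) qgen w"
  unfolding model_hom_def by (rule Q.eval_pm_mon) simp_all

text \<open>Distinct normal words have distinct codes, so the value of the image at the code of
  \<open>w\<close> is the coefficient of \<open>w\<close>.\<close>

lemma model_hom_NW_inj:
  fixes g :: "'i::linorder rb_word \<Rightarrow>\<^sub>0 'k"
  assumes g: "Poly_Mapping.keys g \<subseteq> NW" and zero: "model_hom lam g = \<zero>\<^bsub>QSh lam\<^esub>"
  shows "g = 0"
proof (rule poly_mapping_eqI)
  fix w
  show "Poly_Mapping.lookup g w = Poly_Mapping.lookup 0 w"
  proof (cases "w \<in> Poly_Mapping.keys g")
    case True
    then obtain m v where mv: "eval_word (QSh lam) qgen w = qdelta m v"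
      using g eval_NW_delta by blast
    have val: "eval_word (QSh lam) qgen u m v = (if u = w then 1 else 0)" if u_g: "u \<in> Poly_Mapping.keys g" for u
    proof -
      obtain m' v' where u: "eval_word (QSh lam) qgen u = qdelta m' v'"
        using u_g g eval_NW_delta by blast
      have "u = w" if "m = m'" "v = v'"
        using eval_NW_inj[of u w lam] g True u_g u mv that by auto
      then have "(qdelta m' v' m v :: 'k) = 0" if "u \<noteq> w"
        using that by (auto simp: qdelta_def)
      moreover have "(qdelta m v m v :: 'k) = 1"
        by (simp add: qdelta_def)
      ultimately show ?thesis using mv u by (cases "u = w") simp_all
    qed
    have "model_hom lam g m v = (\<Sum>u\<in>Poly_Mapping.keys g. Poly_Mapping.lookup g u * eval_word (QSh lam) qgen u m v)"
      by (simp add: model_hom_def Q.eval_pm_def finsum_QSh)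
    also have "\<dots> = (\<Sum>u\<in>Poly_Mapping.keys g. if u = w then Poly_Mapping.lookup g u else 0)"
      by (rule sum.cong) (simp_all add: val)
    also have "\<dots> = Poly_Mapping.lookup g w"
      using True by simp
    finally show ?thesis using zero by simp
  qed (simp add: in_keys_iff)
qed

text \<open>Modulo the ideal \<open>f\<close> is a combination of normal words; its image vanishes
  as well, so the combination is 0.\<close>

lemma model_hom_kernel:
  assumes f: "f \<in> carrier (RB lam)" and zero: "model_hom lam f = \<zero>\<^bsub>QSh lam\<^esub>"
  shows "f \<in> comm_ideal lam"
proof -
  obtain g where g: "Poly_Mapping.keys g \<subseteq> NW" "f - g \<in> comm_ideal lam"
    using all_reducible[OF f] unfolding reducible_pm_def by blast
  have gc: "g \<in> carrier (RB lam)"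
    using g(1) NW_subset_Phi by auto
  have "model_hom lam f = model_hom lam ((f - g) \<oplus>\<^bsub>RB lam\<^esub> g)"
    by simp
  also have "\<dots> = model_hom lam (f - g) \<oplus>\<^bsub>QSh lam\<^esub> model_hom lam g"
    using model_hom_rb_hom comm_ideal_carrier[OF g(2)] gc by (intro class_homD(2)) (auto simp: rb_hom_def)
  finally have "model_hom lam g = \<zero>\<^bsub>QSh lam\<^esub>"
    using zero model_hom_comm_ideal[OF g(2)] by simp
  then have "g = 0"
    by (rule model_hom_NW_inj[OF g(1)])
  then show ?thesis using g(2) by simp
qed

end


subsection \<open>The quotient is a commutative Rota-Baxter algebra\<close>

text \<open>The axioms are equations apart from closure and additive inverses, and equations can be
  checked after applying an injective \<open>h\<close> that respects all operations.\<close>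

lemma comm_rota_baxter_pullback:
  fixes A :: "('k::field, 'a, 'm) rb_struct_scheme" and B :: "('k, 'b, 'n) rb_struct_scheme"
  assumes B: "comm_rota_baxter_algebra lam B"
    and inj: "inj_on h (carrier A)" and hom: "h \<in> rb_hom A B" and zero: "h \<zero>\<^bsub>A\<^esub> = \<zero>\<^bsub>B\<^esub>"
    and closed: "\<zero>\<^bsub>A\<^esub> \<in> carrier A"
      "\<And>x y. x \<in> carrier A \<Longrightarrow> y \<in> carrier A \<Longrightarrow> x \<oplus>\<^bsub>A\<^esub> y \<in> carrier A"
      "\<And>x y. x \<in> carrier A \<Longrightarrow> y \<in> carrier A \<Longrightarrow> x \<otimes>\<^bsub>A\<^esub> y \<in> carrier A"
      "\<And>c x. x \<in> carrier A \<Longrightarrow> c \<odot>\<^bsub>A\<^esub> x \<in> carrier A"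
      "\<And>x. x \<in> carrier A \<Longrightarrow> rbop A x \<in> carrier A"
  shows "comm_rota_baxter_algebra lam A"
proof -
  interpret B: comm_rota_baxter_algebra lam B by fact
  have h: "\<And>x. x \<in> carrier A \<Longrightarrow> h x \<in> carrier B"
    "\<And>x y. x \<in> carrier A \<Longrightarrow> y \<in> carrier A \<Longrightarrow> h (x \<oplus>\<^bsub>A\<^esub> y) = h x \<oplus>\<^bsub>B\<^esub> h y"
    "\<And>x y. x \<in> carrier A \<Longrightarrow> y \<in> carrier A \<Longrightarrow> h (x \<otimes>\<^bsub>A\<^esub> y) = h x \<otimes>\<^bsub>B\<^esub> h y"
    "\<And>c x. x \<in> carrier A \<Longrightarrow> h (c \<odot>\<^bsub>A\<^esub> x) = c \<odot>\<^bsub>B\<^esub> h x"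
    "\<And>x. x \<in> carrier A \<Longrightarrow> h (rbop A x) = rbop B (h x)"
    using hom class_homD[of h A B] by (auto simp: rb_hom_def)
  note [simp] = closed h zero B.mult_closed
  have eqI: "x = y" if "h x = h y" "x \<in> carrier A" "y \<in> carrier A" for x y
    using inj_onD[OF inj that] .
  have ac: "a \<oplus>\<^bsub>B\<^esub> b = b \<oplus>\<^bsub>B\<^esub> a" if "a \<in> carrier B" "b \<in> carrier B" for a b
    using that by (rule B.a_comm)
  have smult_add: "c \<odot>\<^bsub>B\<^esub> (a \<oplus>\<^bsub>B\<^esub> b) = c \<odot>\<^bsub>B\<^esub> a \<oplus>\<^bsub>B\<^esub> c \<odot>\<^bsub>B\<^esub> b" if "a \<in> carrier B" "b \<in> carrier B" for c a b
    using B.smult_r_distr[of c a b] that by simp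
  show ?thesis
  proof (intro comm_rota_baxter_algebra.intro rota_baxter_algebra.intro
      rota_baxter_algebra_axioms.intro comm_rota_baxter_algebra_axioms.intro)
    show "vectorspace class_ring A"
    proof (rule vectorspace_classI)
      show "abelian_group A"
      proof (rule abelian_groupI)
        fix x y z
        assume "x \<in> carrier A" "y \<in> carrier A" "z \<in> carrier A"
        then show "x \<oplus>\<^bsub>A\<^esub> y \<oplus>\<^bsub>A\<^esub> z = x \<oplus>\<^bsub>A\<^esub> (y \<oplus>\<^bsub>A\<^esub> z)"
          by (intro eqI) (simp_all add: B.a_assoc)
      next
        fix x y
        assume "x \<in> carrier A" "y \<in> carrier A"
        then show "x \<oplus>\<^bsub>A\<^esub> y = y \<oplus>\<^bsub>A\<^esub> x"
          by (intro eqI) (simp_all add: ac)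
      next
        fix x
        assume x: "x \<in> carrier A"
        then show "\<zero>\<^bsub>A\<^esub> \<oplus>\<^bsub>A\<^esub> x = x"
          by (intro eqI) simp_all
        \<comment> \<open>Additive inverses in \<open>A\<close> are obtained as multiples by -1,
          which stay in the carrier by the closure assumption.\<close>
        have "(- 1) \<odot>\<^bsub>B\<^esub> h x \<oplus>\<^bsub>B\<^esub> h x = \<zero>\<^bsub>B\<^esub>"
          using B.smult_simps(2,3)[of "h x"] B.smult_simps(5)[of "h x" "- 1" 1] x by simp
        then have "(- 1) \<odot>\<^bsub>A\<^esub> x \<oplus>\<^bsub>A\<^esub> x = \<zero>\<^bsub>A\<^esub>"
          using x by (intro eqI) simp_all
        then show "\<exists>y\<in>carrier A. y \<oplus>\<^bsub>A\<^esub> x = \<zero>\<^bsub>A\<^esub>"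
          using closed(4)[OF x] by blast
      qed simp_all
    qed (simp, (rule eqI; simp add: B.smult_simps smult_add)+)
    show "rbop A \<in> class_hom A A"
      by (intro class_homI; (rule eqI)?; simp add: B.rbop_add B.rbop_smult)
  qed (simp, (rule eqI; (simp add: B.mult_assoc B.mult_add_left B.mult_add_right B.mult_smult_left
        B.mult_smult_right B.rota_baxter; fail | simp add: B.mult_comm))+)
qed

lemma class_lift_model_hom:
  "a \<in> carrier (RB lam) \<Longrightarrow> class_lift (model_hom lam) (rb_class lam a) = model_hom lam a"
  by (rule class_lift_rb_class[OF comm_rota_baxter_vectorspace[OF comm_rota_baxter_QSh] model_hom_rb_hom
        model_hom_comm_ideal])

lemma comm_RB_closed:
  "\<zero>\<^bsub>comm_RB lam\<^esub> \<in> carrier (comm_RB lam)"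
  "C \<in> carrier (comm_RB lam) \<Longrightarrow> c \<odot>\<^bsub>comm_RB lam\<^esub> C \<in> carrier (comm_RB lam)"
  "C \<in> carrier (comm_RB lam) \<Longrightarrow> rbop (comm_RB lam) C \<in> carrier (comm_RB lam)"
  "C \<in> carrier (comm_RB lam) \<Longrightarrow> D \<in> carrier (comm_RB lam) \<Longrightarrow> C \<oplus>\<^bsub>comm_RB lam\<^esub> D \<in> carrier (comm_RB lam)"
  "C \<in> carrier (comm_RB lam) \<Longrightarrow> D \<in> carrier (comm_RB lam) \<Longrightarrow> C \<otimes>\<^bsub>comm_RB lam\<^esub> D \<in> carrier (comm_RB lam)"
proof -
  show "\<zero>\<^bsub>comm_RB lam\<^esub> \<in> carrier (comm_RB lam)"
    by (simp add: carrier_comm_RB zero_comm_RB)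
  assume "C \<in> carrier (comm_RB lam)"
  then obtain a where a: "a \<in> carrier (RB lam)" "C = rb_class lam a"
    unfolding carrier_comm_RB by blast
  then show "c \<odot>\<^bsub>comm_RB lam\<^esub> C \<in> carrier (comm_RB lam)"
    unfolding carrier_comm_RB a(2) smult_comm_RB by (intro imageI) (simp add: keys_pm_scale_subset)
  show "rbop (comm_RB lam) C \<in> carrier (comm_RB lam)"
    unfolding carrier_comm_RB a(2) rbop_comm_RB by (intro imageI P_ext_closed a)
  assume "D \<in> carrier (comm_RB lam)"
  then obtain b where b: "b \<in> carrier (RB lam)" "D = rb_class lam b"
    unfolding carrier_comm_RB by blast
  show "C \<otimes>\<^bsub>comm_RB lam\<^esub> D \<in> carrier (comm_RB lam)"
    unfolding a(2) b(2) mult_comm_RB[OF a(1) b(1)] unfolding carrier_comm_RB by (intro imageI RB_mult_closed a b)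
  show "C \<oplus>\<^bsub>comm_RB lam\<^esub> D \<in> carrier (comm_RB lam)"
    unfolding carrier_comm_RB a(2) b(2) add_comm_RB using a(1) b(1) by (intro imageI) (simp add: keys_add_subset)
qed

lemma model_hom_eq_imp_cong:
  fixes a b :: "'i::linorder rb_word \<Rightarrow>\<^sub>0 'k::field"
  assumes a: "a \<in> carrier (RB lam)" and b: "b \<in> carrier (RB lam)" and eq: "model_hom lam a = model_hom lam b"
  shows "a - b \<in> comm_ideal lam"
proof (rule model_hom_kernel)
  show ab: "a - b \<in> carrier (RB lam)"
    using a b by (simp add: keys_diff_subset)
  have "model_hom lam ((a - b) \<oplus>\<^bsub>RB lam\<^esub> b) = model_hom lam (a - b) \<oplus>\<^bsub>QSh lam\<^esub> model_hom lam b"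
    by (rule class_homD(2)[OF rb_homD(1)[OF model_hom_rb_hom] ab b])
  then show "model_hom lam (a - b) = \<zero>\<^bsub>QSh lam\<^esub>"
    using eq by (simp add: fun_eq_iff)
qed

lemma comm_rota_baxter_comm_RB:
  fixes lam :: "'k::field"
  shows "comm_rota_baxter_algebra lam (comm_RB lam :: ('k, ('i::linorder rb_word \<Rightarrow>\<^sub>0 'k) set) rb_struct)"
proof (rule comm_rota_baxter_pullback[OF comm_rota_baxter_QSh])
  let ?A = "comm_RB lam :: ('k, ('i rb_word \<Rightarrow>\<^sub>0 'k) set) rb_struct"
  show "class_lift (model_hom lam) \<in> rb_hom ?A (QSh lam)"
    by (rule class_lift_rb_hom[OF comm_rota_baxter_vectorspace[OF comm_rota_baxter_QSh] model_hom_rb_hom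
          model_hom_comm_ideal])
  show "inj_on (class_lift (model_hom lam)) (carrier ?A)"
  proof (rule inj_onI)
    fix C D
    assume CD: "C \<in> carrier ?A" "D \<in> carrier ?A" "class_lift (model_hom lam) C = class_lift (model_hom lam) D"
    then obtain a b where ab: "a \<in> carrier (RB lam)" "C = rb_class lam a" "b \<in> carrier (RB lam)" "D = rb_class lam b"
      unfolding carrier_comm_RB by blast
    then have "model_hom lam a = model_hom lam b"
      using CD(3) by (simp only: class_lift_model_hom)
    then show "C = D"
      unfolding ab(2,4) rb_class_eq_iff by (rule model_hom_eq_imp_cong[OF ab(1,3)])
  qed
  show "class_lift (model_hom lam) \<zero>\<^bsub>?A\<^esub> = \<zero>\<^bsub>QSh lam\<^esub>"
    unfolding zero_comm_RB using model_hom_comm_ideal[OF comm_ideal_0] by (subst class_lift_model_hom) simp_all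
qed (fact comm_RB_closed)+

lemma word_class_carrier: "w \<in> Phi \<Longrightarrow> word_class lam w \<in> carrier (comm_RB lam)"
  by (simp add: word_class_eq carrier_comm_RB)

lemma rb_class_rb_hom: "rb_class lam \<in> rb_hom (RB lam) (comm_RB lam)"
  unfolding rb_hom_def
proof (intro CollectI conjI ballI)
  show "rb_class lam \<in> class_hom (RB lam) (comm_RB lam)"
    by (rule class_homI) (auto simp: carrier_comm_RB comm_RB_class_simps simp del: RB_simps(1))
qed (simp_all add: comm_RB_class_simps del: RB_simps(1,2))

text \<open>In the quotient the class of every word is built from classes of generators by products
  and \<open>P\<close>; linearity does the rest.\<close>

lemma rb_hom_comm_RB_unique:
  fixes B :: "('k::field, 'b) rb_struct" and lam :: 'k
    and g h :: "('i::linorder rb_word \<Rightarrow>\<^sub>0 'k) set \<Rightarrow> 'b"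
  assumes B: "comm_rota_baxter_algebra lam B" and g: "g \<in> rb_hom (comm_RB lam) B" and h: "h \<in> rb_hom (comm_RB lam) B"
    and gen: "\<And>x. g (word_class lam [Gen x]) = h (word_class lam [Gen x])"
    and C: "C \<in> carrier (comm_RB lam)"
  shows "g C = h C"
proof -
  obtain a where a: "a \<in> carrier (RB lam)" "C = rb_class lam a"
    using C unfolding carrier_comm_RB by blast
  have words: "[p] \<in> Phi \<longrightarrow> g (rb_class lam (mon [p])) = h (rb_class lam (mon [p]))"
    "w \<in> Phi \<longrightarrow> g (rb_class lam (mon w)) = h (rb_class lam (mon w))" for p :: "'i prime_word" and w :: "'i rb_word"
  proof (induction p and w rule: word_induct)
    case (Gen x)
    show ?case using gen[of x] by (simp add: word_class_eq)
  next
    case (Op w)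
    have Op_eq: "k (rb_class lam (mon [Op w])) = rbop B (k (rb_class lam (mon w)))"
      if "w \<in> Phi" "k \<in> rb_hom (comm_RB lam) B" for k
    proof -
      have "rb_class lam (mon w) \<in> carrier (comm_RB lam)"
        using that(1) by (simp add: carrier_comm_RB)
      then show ?thesis
        using rb_homD(3)[OF that(2), of "rb_class lam (mon w)"] by (simp add: rbop_comm_RB)
    qed
    show ?case using Op Op_eq[OF _ g] Op_eq[OF _ h] by simp
  next
    case (Cons p w)
    have Cons_eq: "k (rb_class lam (mon (p # w))) = k (rb_class lam (mon [p])) \<otimes>\<^bsub>B\<^esub> k (rb_class lam (mon w))"
      if "p # w \<in> Phi" "w \<noteq> []" "k \<in> rb_hom (comm_RB lam) B" for k
    proof -
      have Phi: "[p] \<in> Phi" "w \<in> Phi" "\<not> (is_Op p \<and> is_Op (hd w))"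
        using that(1,2) Phi_Cons_iff[of p w] by auto
      then have "rb_class lam (mon [p]) \<in> carrier (comm_RB lam)" "rb_class lam (mon w) \<in> carrier (comm_RB lam)"
        by (simp_all add: carrier_comm_RB)
      then have "k (rb_class lam (mon [p]) \<otimes>\<^bsub>comm_RB lam\<^esub> rb_class lam (mon w)) =
          k (rb_class lam (mon [p])) \<otimes>\<^bsub>B\<^esub> k (rb_class lam (mon w))"
        by (rule rb_homD(2)[OF that(3)])
      then show ?thesis
        using Phi that(2) by (simp add: mult_comm_RB word_mult_concat)
    qed
    then show ?case
      using Cons Cons_eq[OF _ _ g] Cons_eq[OF _ _ h] Phi_Cons_iff[of p w] by (cases "w = []") auto
  qed simp
  have hom: "(\<lambda>a. f (rb_class lam a)) \<in> class_hom (RB lam) B" if "f \<in> rb_hom (comm_RB lam) B" for f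
    by (rule class_hom_compose[OF rb_homD(1)[OF rb_class_rb_hom] rb_homD(1)[OF that]])
  show ?thesis
    unfolding a(2)
    by (rule class_hom_RB_eq[OF comm_rota_baxter_vectorspace[OF B] hom[OF g] hom[OF h] words(2)[rule_format] a(1)])
qed

lemma free_comm_rb_algebra_comm_RB:
  "free_comm_rb_algebra TYPE('b) lam (comm_RB lam) (\<lambda>i::'i::linorder. word_class lam [Gen i])"
  unfolding free_comm_rb_algebra_def
proof (intro conjI allI impI)
  let ?A = "comm_RB lam :: ('a, ('i rb_word \<Rightarrow>\<^sub>0 'a) set) rb_struct"
  show "comm_rota_baxter_algebra lam ?A"
    by (rule comm_rota_baxter_comm_RB)
  show "range (\<lambda>i::'i. word_class lam [Gen i]) \<subseteq> carrier ?A"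
    by (auto intro!: word_class_carrier)
  fix B :: "('a, 'b) rb_struct" and f :: "'i \<Rightarrow> 'b"
  assume "comm_rota_baxter_algebra lam B \<and> range f \<subseteq> carrier B"
  then have B: "comm_rota_baxter_algebra lam B" and f: "\<And>x. f x \<in> carrier B"
    by auto
  interpret B: comm_rota_baxter_algebra lam B by fact
  define k where "k = class_lift (B.eval_pm f)"
  have eval: "B.eval_pm f \<in> rb_hom (RB lam) B" "\<And>a. a \<in> comm_ideal lam \<Longrightarrow> B.eval_pm f a = \<zero>\<^bsub>B\<^esub>"
    using B.eval_pm_rb_hom B.eval_pm_comm_ideal f by blast+
  have k: "k \<in> rb_hom ?A B"
    unfolding k_def by (rule class_lift_rb_hom[OF B.vectorspace_axioms eval])
  have k_gen: "k (word_class lam [Gen x]) = f x" for x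
    unfolding k_def word_class_eq using class_lift_rb_class[OF B.vectorspace_axioms eval, of "mon [Gen x]"] f
    by (simp add: B.eval_pm_mon)
  have restr: "restrict k (carrier ?A) \<in> rb_hom ?A B"
    using k by (auto simp: rb_hom_def LinearCombinations.module_hom_def comm_RB_closed)
  show "\<exists>!h. h \<in> rb_hom ?A B \<inter> extensional (carrier ?A) \<and> (\<forall>x. h (word_class lam [Gen x]) = f x)"
  \<comment> \<open>Uniqueness as functions requires a fixed value outside the carrier, hence the
    restriction.\<close>
  proof (rule ex1I[of _ "restrict k (carrier ?A)"])
    show "restrict k (carrier ?A) \<in> rb_hom ?A B \<inter> extensional (carrier ?A) \<and>
        (\<forall>x. restrict k (carrier ?A) (word_class lam [Gen x]) = f x)"
      using restr k_gen by (simp add: word_class_carrier)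
    fix h
    assume h: "h \<in> rb_hom ?A B \<inter> extensional (carrier ?A) \<and> (\<forall>x. h (word_class lam [Gen x]) = f x)"
    show "h = restrict k (carrier ?A)"
      using h k_gen rb_hom_comm_RB_unique[OF B _ k, of h]
      by (intro extensionalityI[of _ "carrier ?A"]) auto
  qed
qed


subsection \<open>The basis of normal words\<close>

lemma inj_word_class: "inj_on (word_class lam) (NW :: 'i::linorder rb_word set)"
proof (rule inj_onI)
  fix w w' :: "'i rb_word"
  assume w: "w \<in> NW" "w' \<in> NW" "word_class lam w = word_class lam w'"
  have Phi: "mon w \<in> carrier (RB lam)" "mon w' \<in> carrier (RB lam)" "w \<in> Phi" "w' \<in> Phi"
    using w(1,2) NW_subset_Phi by auto
  have "model_hom lam (mon w) = model_hom lam (mon w')"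
    using w(3) class_lift_model_hom[OF Phi(1)] class_lift_model_hom[OF Phi(2)] by (simp add: word_class_eq)
  then show "w = w'"
    using eval_NW_inj[OF w(1,2)] model_hom_mon[OF Phi(3)] model_hom_mon[OF Phi(4)] by metis
qed

text \<open>Moves a combination of classes back to RB(X). Injectivity of \<open>word_class\<close>
  on normal words ensures that no summands merge in the sum over the image.\<close>

lemma finsum_word_class:
  fixes lam :: "'k::field" and S :: "'i::linorder rb_word set"
  assumes "finite S" "S \<subseteq> NW"
  shows "(\<Oplus>\<^bsub>comm_RB lam\<^esub>C\<in>word_class lam ` S. a C \<odot>\<^bsub>comm_RB lam\<^esub> C) =
    rb_class lam (\<Sum>w\<in>S. Poly_Mapping.single w (a (word_class lam w)))"
proof -
  interpret comm_rota_baxter_algebra lam "comm_RB lam :: ('k, ('i rb_word \<Rightarrow>\<^sub>0 'k) set) rb_struct"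
    by (rule comm_rota_baxter_comm_RB)
  show ?thesis
    using assms
  proof (induction S rule: finite_induct)
    case empty
    then show ?case by (simp add: zero_comm_RB)
  next
    case (insert w S)
    have "word_class lam w \<notin> word_class lam ` S"
      using insert.hyps(2) insert.prems inj_word_class[of lam] by (auto dest: inj_onD)
    moreover have "word_class lam v \<in> carrier (comm_RB lam)" if "v \<in> insert w S" for v
      using that insert.prems NW_subset_Phi word_class_carrier by blast
    ultimately have "(\<Oplus>\<^bsub>comm_RB lam\<^esub>C\<in>word_class lam ` insert w S. a C \<odot>\<^bsub>comm_RB lam\<^esub> C) =
        a (word_class lam w) \<odot>\<^bsub>comm_RB lam\<^esub> word_class lam w \<oplus>\<^bsub>comm_RB lam\<^esub>
          (\<Oplus>\<^bsub>comm_RB lam\<^esub>C\<in>word_class lam ` S. a C \<odot>\<^bsub>comm_RB lam\<^esub> C)"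
      unfolding image_insert using insert.hyps(1) by (intro finsum_insert) (auto intro: comm_RB_closed(2))
    then show ?case
      using insert by (simp add: word_class_eq smult_comm_RB add_comm_RB)
  qed
qed

lemma basis_NW:
  fixes lam :: "'k::field"
  shows "vectorspace.basis class_ring (comm_RB lam) (word_class lam ` (NW :: 'i::linorder rb_word set))"
proof -
  interpret comm_rota_baxter_algebra lam "comm_RB lam :: ('k, ('i rb_word \<Rightarrow>\<^sub>0 'k) set) rb_struct"
    by (rule comm_rota_baxter_comm_RB)
  let ?W = "word_class lam ` (NW :: 'i rb_word set)"
  have W: "?W \<subseteq> carrier (comm_RB lam)"
    using NW_subset_Phi word_class_carrier by blast
  have "lin_indpt ?W"
    unfolding lin_dep_def
  proof (intro notI, elim exE conjE)
    fix A a C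
    assume A: "finite A" "A \<subseteq> ?W" "lincomb a A = \<zero>\<^bsub>comm_RB lam\<^esub>" "C \<in> A" "a C \<noteq> \<zero>\<^bsub>class_ring\<^esub>"
    obtain S where S: "S \<subseteq> NW" "finite S" "A = word_class lam ` S"
      using finite_subset_image[OF A(1,2)] by blast
    \<comment> \<open>A dependence between classes becomes a combination of normal words inside the
      ideal, which the model forces to be 0.\<close>
    define g where "g = (\<Sum>w\<in>S. Poly_Mapping.single w (a (word_class lam w)))"
    have lookup: "Poly_Mapping.lookup g w = (if w \<in> S then a (word_class lam w) else 0)" for w
      using S(2) by (simp add: g_def lookup_sum lookup_single when_def)
    have keys: "Poly_Mapping.keys g \<subseteq> NW"
      using S(1) by (auto simp: in_keys_iff lookup split: if_splits)
    have "rb_class lam g = rb_class lam 0"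
      using A(3) finsum_word_class[OF S(2,1), of lam a] by (simp add: lincomb_def S(3) g_def zero_comm_RB)
    then have "g \<in> comm_ideal lam"
      by (simp add: rb_class_eq_iff)
    then have "g = 0"
      using model_hom_NW_inj[OF keys] model_hom_comm_ideal by blast
    then show False
      using A(4,5) S(3) lookup by (auto simp: class_ring_simps) (metis lookup_zero)
  qed
  moreover have "span ?W = carrier (comm_RB lam)"
  proof
    show "span ?W \<subseteq> carrier (comm_RB lam)"
      using span_closed[OF W] by blast
    show "carrier (comm_RB lam) \<subseteq> span ?W"
    proof
      fix C :: "('i rb_word \<Rightarrow>\<^sub>0 'k) set"
      assume "C \<in> carrier (comm_RB lam)"
      then obtain f where f: "f \<in> carrier (RB lam)" "C = rb_class lam f"
        unfolding carrier_comm_RB by blast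
      then obtain g where g: "Poly_Mapping.keys g \<subseteq> NW" "f - g \<in> comm_ideal lam"
        using all_reducible unfolding reducible_pm_def by blast
      \<comment> \<open>Coefficients of a \<open>lincomb\<close> are indexed by classes, so the
        normal word is recovered from its class.\<close>
      define a where "a = (\<lambda>C. Poly_Mapping.lookup g (inv_into NW (word_class lam) C))"
      have a: "a (word_class lam w) = Poly_Mapping.lookup g w" if "w \<in> NW" for w
        unfolding a_def inv_into_f_f[OF inj_word_class that] ..
      have "lincomb a (word_class lam ` Poly_Mapping.keys g) =
          rb_class lam (\<Sum>w\<in>Poly_Mapping.keys g. Poly_Mapping.single w (a (word_class lam w)))"
        unfolding lincomb_def by (rule finsum_word_class) (use g in simp_all)
      also have "(\<Sum>w\<in>Poly_Mapping.keys g. Poly_Mapping.single w (a (word_class lam w))) = lin_ext mon g"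
        unfolding lin_ext_def using g(1) a by (intro sum.cong) auto
      finally have "lincomb a (word_class lam ` Poly_Mapping.keys g) = C"
        using cong_sym[OF g(2)] f(2) by (simp add: rb_class_eq_iff)
      then show "C \<in> span ?W"
        unfolding span_def using g(1) by (force simp: class_ring_simps)
    qed
  qed
  ultimately show ?thesis
    unfolding basis_def using W by blast
qed

theorem corollary4p2:
  fixes lam :: "'k::field_char_0"
  shows "Irr lam (comm_rels :: ('i::wellorder rb_word \<Rightarrow>\<^sub>0 'k) set) = Y1 \<union> Y2 \<union> Y3 \<and>
    free_comm_rb_algebra TYPE('b) lam (comm_RB lam) (\<lambda>i::'i. word_class lam [Gen i]) \<and>
    inj_on (word_class lam) (Irr lam (comm_rels :: ('i rb_word \<Rightarrow>\<^sub>0 'k) set)) \<and>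
    vectorspace.basis class_ring (comm_RB lam)
      (word_class lam ` Irr lam (comm_rels :: ('i rb_word \<Rightarrow>\<^sub>0 'k) set))"
  unfolding Irr_comm_rels
  using NW_eq free_comm_rb_algebra_comm_RB inj_word_class basis_NW by blast

end
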